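(* Each individual curve in a multiple $\mathrm{SLE}(0)$ ensemble is Möbius invariant. That is: let $\boldsymbol x=\{x_1,\dots,x_{2n}\}$ be distinct real points, let $R\in\mathrm{CRR}_{n+1}(\boldsymbol x)$ have pole set $\{\zeta_1,\dots,\zeta_{n+1}\}$ consisting of $n+1$ distinct points, and let $\gamma$ be the curve in $\Gamma(R)\cap\mathbb H$ grown from $x_j$ as the $\mathrm{SLE}(0,x_j,\boldsymbol\rho_j)$ curve with $\boldsymbol\rho_j=\sum_{k\ne j}2\delta_{x_k}-\sum_{k=1}^{n+1}4\delta_{\zeta_k}$. Then for every $\phi\in \mathrm{PSL}(2,\mathbb R)$ with $\phi(x_j)\neq\infty$, the image curve $t\mapsto\phi(\gamma(t))$ is, up to a time change, the $\mathrm{SLE}(0,\phi(x_j),\phi_\#\boldsymbol\rho_j)$ curve, where $\phi_\#\boldsymbol\rho_j$ is the pushforward of $\boldsymbol\rho_j$ by $\phi$.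
   Context: $\mathbb H$ is the upper half-plane, $\widehat{\mathbb C}$ the Riemann sphere, $\widehat{\mathbb R}=\mathbb R\cup\{\infty\}$; $\mathrm{PSL}(2,\mathbb R)$ is the group of Möbius automorphisms of $\mathbb H$. $\mathrm{CRR}_{n+1}(\boldsymbol x)$ is the set of real rational functions of degree $n+1$ whose critical points are precisely $\boldsymbol x$, and $\Gamma(R)=\{z\in\widehat{\mathbb C}:R(z)\in\widehat{\mathbb R}\}$, which consists of the real line, $n$ disjoint simple curves in $\mathbb H$ pairing up the points of $\boldsymbol x$ (these $n$ curves are what is called a multiple $\mathrm{SLE}(0)$ ensemble), and their conjugates. $\mathrm{SLE}(0,x,\boldsymbol\rho)$, for $x\in\mathbb R$ and a finite atomic signed measure $\boldsymbol\rho$ on $\widehat{\mathbb C}$ symmetric under conjugation, is the Loewner chain $\partial_tg_t(z)=\frac{2}{g_t(z)-x_t}$, $g_0(z)=z$, with driving function $\dot x_t=\int_{\mathbb C}\frac{d\boldsymbol\rho(w)}{x_t-g_t(w)}$, $x_0=x$ (charges at $\infty$ do not contribute to the integral, but are moved by $\phi_\#$), run until the first time $x_t=g_t(w)$ for some $w\in\mathrm{supp}\,\boldsymbol\rho$. *)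

theory Defs
  imports "HOL-Analysis.Analysis" "HOL-Computational_Algebra.Polynomial" "HOL-Library.Poly_Mapping"
begin

text \<open>The Riemann sphere is \<^typ>\<open>complex option\<close>, with \<^term>\<open>None\<close> as the point at infinity
  (as in the library's Alexandroff compactification).\<close>

type_synonym sphere = "complex option"

definition upper_half_plane :: "complex set" where
  "upper_half_plane = {z. Im z > 0}"

definition extended_reals :: "sphere set" where
  "extended_reals = insert None (Some ` \<real>)"

text \<open>The point with homogeneous coordinates \<open>[a : b]\<close>.\<close>

definition sphere_quot :: "complex \<Rightarrow> complex \<Rightarrow> sphere" where
  "sphere_quot a b = (if b = 0 then None else Some (a / b))"

text \<open>The self-map \<open>p / q\<close> of the sphere, meant for coprime \<open>p\<close> and \<open>q\<close>.
  Its degree is then \<^term>\<open>max (degree p) (degree q)\<close>.\<close>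

definition rat_map :: "real poly \<Rightarrow> real poly \<Rightarrow> sphere \<Rightarrow> sphere" where
  "rat_map p q z =
    (case z of
      Some u \<Rightarrow> sphere_quot (poly (map_poly of_real p) u) (poly (map_poly of_real q) u)
    | None \<Rightarrow> sphere_quot (of_real (coeff p (max (degree p) (degree q))))
                          (of_real (coeff q (max (degree p) (degree q)))))"

text \<open>The coordinate around \<open>a\<close> is \<open>z\<close> if \<open>a\<close> is finite and \<open>1/z\<close> if \<open>a\<close> is infinity;
  the point outside the domain of the chart gets the junk value \<open>0\<close>.\<close>

definition sphere_chart :: "sphere \<Rightarrow> sphere \<Rightarrow> complex" where
  "sphere_chart a w =
    (case w of None \<Rightarrow> 0 | Some z \<Rightarrow> (if a = None then 1 / z else z))"

definition sphere_chart_inv :: "sphere \<Rightarrow> complex \<Rightarrow> sphere" where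
  "sphere_chart_inv a u = (if a = None then sphere_quot 1 u else Some u)"

definition critical_points :: "(sphere \<Rightarrow> sphere) \<Rightarrow> sphere set" where
  "critical_points R =
    {a. ((\<lambda>u. sphere_chart (R a) (R (sphere_chart_inv a u))) has_field_derivative 0)
          (at (sphere_chart a a))}"

definition CRR :: "nat \<Rightarrow> real set \<Rightarrow> (sphere \<Rightarrow> sphere) set" where
  "CRR d A = {R. (\<exists>p q. q \<noteq> 0 \<and> coprime p q \<and> max (degree p) (degree q) = d \<and> R = rat_map p q)
                  \<and> critical_points R = (\<lambda>r. Some (complex_of_real r)) ` A}"

definition pole_set :: "(sphere \<Rightarrow> sphere) \<Rightarrow> sphere set" where
  "pole_set R = {z. R z = None}"

definition real_locus :: "(sphere \<Rightarrow> sphere) \<Rightarrow> sphere set" where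
  "real_locus R = {z. R z \<in> extended_reals}"

text \<open>The curves of the ensemble, as subsets of the upper half-plane.\<close>

definition SLE0_ensemble :: "(sphere \<Rightarrow> sphere) \<Rightarrow> complex set set" where
  "SLE0_ensemble R = components {z \<in> upper_half_plane. Some z \<in> real_locus R}"

definition PSL2R :: "(sphere \<Rightarrow> sphere) set" where
  "PSL2R = {\<phi>. \<exists>a b c d. a * d - b * c = 1 \<and> \<phi> = rat_map [:b, a:] [:d, c:]}"

text \<open>Finite atomic signed measures on the sphere are finitely supported real weights;
  \<^term>\<open>Poly_Mapping.single w r\<close> is \<open>r\<close> times the Dirac mass at \<open>w\<close>.\<close>

type_synonym charge = "sphere \<Rightarrow>\<^sub>0 real"

definition conj_symmetric :: "charge \<Rightarrow> bool" where
  "conj_symmetric \<rho> \<longleftrightarrow>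
    (\<forall>w. Poly_Mapping.lookup \<rho> (map_option cnj w) = Poly_Mapping.lookup \<rho> w)"

definition pushforward :: "(sphere \<Rightarrow> sphere) \<Rightarrow> charge \<Rightarrow> charge" where
  "pushforward \<phi> \<rho> =
    (\<Sum>w\<in>Poly_Mapping.keys \<rho>. Poly_Mapping.single (\<phi> w) (Poly_Mapping.lookup \<rho> w))"

definition finite_support :: "charge \<Rightarrow> complex set" where
  "finite_support \<rho> = {w. Some w \<in> Poly_Mapping.keys \<rho>}"

text \<open>\<open>u\<close> solves the Loewner equation with driving function \<open>X\<close>, started from \<open>z\<close>, on the closed
  time interval \<open>[0, t]\<close>.\<close>

definition loewner_solution ::
  "(real \<Rightarrow> real) \<Rightarrow> real \<Rightarrow> complex \<Rightarrow> (real \<Rightarrow> complex) \<Rightarrow> bool" where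
  "loewner_solution X t z u \<longleftrightarrow> u 0 = z \<and>
    (\<forall>s\<in>{0..t}. u s \<noteq> of_real (X s) \<and>
       (u has_vector_derivative 2 / (u s - of_real (X s))) (at s within {0..t}))"

text \<open>Points of the whole plane, the real line included, whose flow dies by time \<open>t\<close>.\<close>

definition swallowed :: "(real \<Rightarrow> real) \<Rightarrow> real \<Rightarrow> complex set" where
  "swallowed X t = {z. \<nexists>u. loewner_solution X t z u}"

definition time_interval :: "ereal \<Rightarrow> real set" where
  "time_interval T = {t. 0 \<le> t \<and> ereal t < T}"

definition loewner_chain ::
  "ereal \<Rightarrow> (real \<Rightarrow> real) \<Rightarrow> (real \<Rightarrow> complex \<Rightarrow> complex) \<Rightarrow> bool" where
  "loewner_chain T X g \<longleftrightarrow>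
    (\<forall>t\<in>time_interval T. \<forall>z. z \<notin> swallowed X t \<longrightarrow> loewner_solution X t z (\<lambda>s. g s z))"

text \<open>The \<open>SLE(0, x, \<rho>)\<close> chain with lifetime \<open>T\<close>. The last conjunct says that a finite \<open>T\<close> is the
  time at which the driving point meets the image of a charge (the flow of that charge is only
  defined before \<open>T\<close>, hence the left limit). The driving equation is written in the complex plane; the
  sum is real by symmetry of \<open>\<rho>\<close>.\<close>

definition SLE0_chain ::
  "real \<Rightarrow> charge \<Rightarrow> ereal \<Rightarrow> (real \<Rightarrow> real) \<Rightarrow> (real \<Rightarrow> complex \<Rightarrow> complex) \<Rightarrow> bool" where
  "SLE0_chain x \<rho> T X g \<longleftrightarrow>
    0 < T \<and> conj_symmetric \<rho> \<and> X 0 = x \<and> loewner_chain T X g \<and>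
    (\<forall>t\<in>time_interval T.
       finite_support \<rho> \<inter> swallowed X t = {} \<and>
       ((\<lambda>s. complex_of_real (X s)) has_vector_derivative
          (\<Sum>w\<in>finite_support \<rho>.
             of_real (Poly_Mapping.lookup \<rho> (Some w)) / (of_real (X t) - g t w)))
         (at t within {0..})) \<and>
    (\<forall>T'. T = ereal T' \<longrightarrow>
       (\<exists>w\<in>finite_support \<rho>. ((\<lambda>t. of_real (X t) - g t w) \<longlongrightarrow> 0) (at_left T')))"

text \<open>The curve generating the hulls of the chain: at every time, the complement of the hull is the
  unbounded component of the complement of the curve.\<close>

definition SLE0_curve :: "real \<Rightarrow> charge \<Rightarrow> ereal \<Rightarrow> (real \<Rightarrow> complex) \<Rightarrow> bool" where
  "SLE0_curve x \<rho> T \<gamma> \<longleftrightarrow>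
    (\<exists>X g. SLE0_chain x \<rho> T X g \<and>
       continuous_on (time_interval T) \<gamma> \<and> \<gamma> 0 = of_real x \<and>
       (\<forall>t\<in>time_interval T. \<gamma> t \<in> closure upper_half_plane \<and>
          upper_half_plane - swallowed X t \<in> components (upper_half_plane - \<gamma> ` {0..t}) \<and>
          \<not> bounded (upper_half_plane - swallowed X t)))"

definition time_change :: "ereal \<Rightarrow> ereal \<Rightarrow> (real \<Rightarrow> real) \<Rightarrow> bool" where
  "time_change T S \<sigma> \<longleftrightarrow>
    continuous_on (time_interval T) \<sigma> \<and> strict_mono_on (time_interval T) \<sigma> \<and>
    bij_betw \<sigma> (time_interval T) (time_interval S)"

text \<open>The charge seen by the curve growing from \<open>x j\<close> when the growth points are
  \<open>x 1, \<dots>, x (2 n)\<close> and the poles are \<open>\<zeta> 1, \<dots>, \<zeta> (n + 1)\<close>.\<close>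

definition ensemble_charge ::
  "nat \<Rightarrow> (nat \<Rightarrow> real) \<Rightarrow> (nat \<Rightarrow> sphere) \<Rightarrow> nat \<Rightarrow> charge" where
  "ensemble_charge n x \<zeta> j =
    (\<Sum>k\<in>{1..2*n} - {j}. Poly_Mapping.single (Some (of_real (x k))) 2)
    - (\<Sum>k\<in>{1..n+1}. Poly_Mapping.single (\<zeta> k) 4)"

end

theory Submission
  imports Defs "HOL-Complex_Analysis.Complex_Analysis"
begin

text \<open>
  If \<open>g\<close> is the given chain with driving function \<open>X\<close>, the image chain is \<open>H t \<circ> g t \<circ> \<phi>\<^sup>-\<^sup>1\<close> for
  real Moebius maps \<open>H t\<close> with \<open>H 0 = \<phi>\<close> and pole \<open>g t (\<phi>\<^sup>-\<^sup>1 \<infinity>)\<close>; they solve an explicit system of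
  differential equations, and the new clock runs at speed \<open>(H t)' (X t)\<^sup>2\<close>. The new driving function
  \<open>H t (X t)\<close> obeys the driving equation for \<open>\<phi>\<^sub># \<rho>\<close> precisely because the total charge is \<open>- 6\<close>.
  Before the end of the lifetime the driving function is continuously differentiable, so no real
  point other than the starting point is swallowed and the pole of \<open>H t\<close> persists.

  The delicate point is that the new chain, if its lifetime \<open>S\<close> is finite, ends with a collision.
  All critical points of \<open>R\<close> are simple, so its real locus does not approach \<open>\<phi>\<^sup>-\<^sup>1 \<infinity>\<close>
  tangentially to the real axis; in the new chart, discs of any given radius around far away real
  points survive, and the Schwarz lemma bounds the driving function. It then converges at \<open>S\<close> by a
  moment argument. If no charge were hit, the driving function would be Lipschitz up to \<open>S\<close>, the
  flow of \<open>\<phi> \<infinity>\<close> would stay away from it, and going back to the old chart \<open>T\<close> would be finite without a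
  collision at \<open>T\<close>.
\<close>

section \<open>Loewner flows\<close>

text \<open>The number -6 is kappa - 6 at kappa = 0. Transport by \<open>H t\<close> turns the speed
  of the driving point into \<open>H'(X) * X' - 3 * H''(X)\<close>, and each charge picks up a
  constant term of the same shape as \<open>H''(X)\<close>; these terms match exactly when all
  charges, the one at infinity included, add up to -6. So the driving equation transfers by algebra.
  What does not transfer is the lifetime: a finite lifetime must end in a collision, yet the new
  clock can run out at a finite time while the old one is infinite, and the change of chart can
  degenerate at that moment. Hence the collision is proved by contradiction, from bounds that hold
  up to the final time although no flow is known to continue there. The Schwarz lemma takes the
  place of distortion estimates for hulls: all it asks of the curve is to miss two discs centred on
  the real axis. The weight -4 of the poles matters because the driving point counts with weight 2
  in the moments that converge: nonreal charges come in multiples of 4 and can neither supply nor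
  absorb a mass 2.\<close>

text \<open>The derivative is controlled only below the level \<open>\<delta>\<close>, so the mean
  value theorem is applied after the last time at which \<open>f\<close> was at least
  \<open>\<delta>\<close>. Most a priori bounds on flows below are instances of this
  argument.\<close>

lemma barrier:
  fixes f f' :: "real \<Rightarrow> real"
  assumes deriv: "\<And>s. s \<in> {0..t} \<Longrightarrow> (f has_vector_derivative f' s) (at s within {0..t})"
    and init: "\<delta> \<le> f 0"
    and push: "\<And>s. s \<in> {0..t} \<Longrightarrow> f s < \<delta> \<Longrightarrow> 0 \<le> f' s"
    and s1: "s1 \<in> {0..t}"
  shows "\<delta> \<le> f s1"
proof (rule ccontr)
  assume neg: "\<not> \<delta> \<le> f s1"
  have "continuous_on {0..t} f"
    using deriv has_vector_derivative_continuous continuous_on_eq_continuous_within by blast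
  then have cont: "continuous_on {0..s1} f"
    using s1 continuous_on_subset by fastforce
  define A where "A = {0..s1} \<inter> f -` {\<delta>..}"
  have "compact A"
  proof (subst compact_eq_bounded_closed, intro conjI)
    show "bounded A"
      unfolding A_def by (rule bounded_subset[OF bounded_closed_interval[of 0 s1]]) auto
    show "closed A"
      unfolding A_def by (rule continuous_closed_preimage[OF cont]) auto
  qed
  moreover have "0 \<in> A"
    using init s1 by (auto simp: A_def)
  ultimately obtain s0 where s0: "s0 \<in> A" "\<And>r. r \<in> A \<Longrightarrow> r \<le> s0"
    by (metis compact_attains_sup empty_iff)
  have lt: "0 \<le> s0" "s0 < s1"
    using s0(1) neg by (auto simp: A_def less_le)
  have "\<exists>r\<in>{s0<..<s1}. f s1 - f s0 = (\<lambda>h. h *\<^sub>R f' r) (s1 - s0)"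
  proof (rule mvt_simple[OF lt(2)])
    fix r assume "s0 \<le> r" "r \<le> s1"
    then have "(f has_vector_derivative f' r) (at r within {s0..s1})"
      using deriv[of r] lt s1 by (intro has_vector_derivative_within_subset[OF deriv]) auto
    then show "(f has_derivative (\<lambda>h. h *\<^sub>R f' r)) (at r within {s0..s1})"
      by (simp add: has_vector_derivative_def)
  qed
  then obtain r where r: "s0 < r" "r < s1" "f s1 - f s0 = (s1 - s0) * f' r"
    by auto
  have "r \<notin> A"
    using r s0(2) by force
  then have "0 \<le> f' r"
    using r lt s1 by (intro push) (auto simp: A_def)
  then have "0 \<le> (s1 - s0) * f' r"
    using lt(2) by simp
  then have "f s0 \<le> f s1"
    using r(3) by linarith
  then show False
    using neg s0(1) by (auto simp: A_def)
qed

text \<open>Integrating factor. The main use is qualitative: a quantity with a linear equation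
  vanishes always or never, which gives uniqueness of flows, the invariance of the half-planes and
  the persistence of nonzero chart denominators.\<close>

lemma linear_ode:
  fixes d k :: "real \<Rightarrow> 'a::{real_normed_field,banach}"
  assumes deriv: "\<And>s. s \<in> {0..t} \<Longrightarrow> (d has_vector_derivative k s * d s) (at s within {0..t})"
    and cont: "continuous_on {0..t} k"
    and s: "s \<in> {0..t}"
  shows "d s = d 0 * exp (integral {0..s} k)"
proof -
  define E where "E s = d s * exp (- integral {0..s} k)" for s
  have "(E has_vector_derivative 0) (at r within {0..t})" if r: "r \<in> {0..t}" for r
  proof -
    have "((\<lambda>s. - integral {0..s} k) has_vector_derivative - k r) (at r within {0..t})"
      by (intro derivative_intros integral_has_vector_derivative cont r)
    moreover have "(exp has_field_derivative exp (- integral {0..r} k))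
        (at (- integral {0..r} k) within (\<lambda>s. - integral {0..s} k) ` {0..t})"
      using DERIV_exp has_field_derivative_at_within by blast
    ultimately have "((exp \<circ> (\<lambda>s. - integral {0..s} k)) has_vector_derivative
        (- k r * exp (- integral {0..r} k))) (at r within {0..t})"
      by (rule field_vector_diff_chain_within)
    from has_vector_derivative_mult[OF deriv[OF r] this] show ?thesis
      by (simp add: E_def [abs_def] o_def algebra_simps)
  qed
  then obtain c where c: "\<And>r. r \<in> {0..t} \<Longrightarrow> E r = c"
    using has_vector_derivative_zero_constant[of "{0..t}" E] by auto
  have "E s = E 0"
    using c[of s] c[of 0] s by auto
  then show ?thesis
    by (simp add: E_def exp_minus field_simps)
qed

text \<open>The norm need not be differentiable, so the barrier is applied to minus the squared norm
  with weight \<open>exp (- (2 * L * s))\<close>, whose derivative is nonnegative by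
  Cauchy-Schwarz.\<close>

lemma gronwall:
  fixes d d' :: "real \<Rightarrow> 'a::real_inner"
  assumes deriv: "\<And>s. s \<in> {0..t} \<Longrightarrow> (d has_vector_derivative d' s) (at s within {0..t})"
    and le: "\<And>s. s \<in> {0..t} \<Longrightarrow> norm (d' s) \<le> L * norm (d s)"
    and s: "s \<in> {0..t}"
  shows "norm (d s) \<le> norm (d 0) * exp (L * s)"
proof -
  define f where "f s = - ((d s \<bullet> d s) * exp (- (2 * L * s)))" for s
  define f' where "f' s = (2 * L * (d s \<bullet> d s) - 2 * (d s \<bullet> d' s)) * exp (- (2 * L * s))" for s
  have "f 0 \<le> f s"
  proof (rule barrier[where f = f and f' = f' and t = t and ?s1.0 = s])
    fix r assume r: "r \<in> {0..t}"
    have *: "((\<lambda>s. d s \<bullet> d s) has_real_derivative 2 * (d r \<bullet> d' r)) (at r within {0..t})"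
      using has_derivative_inner[OF deriv[OF r, unfolded has_vector_derivative_def]
          deriv[OF r, unfolded has_vector_derivative_def]]
      unfolding has_field_derivative_def
      by (rule has_derivative_eq_rhs) (auto simp: inner_commute algebra_simps)
    have "(f has_real_derivative f' r) (at r within {0..t})"
      unfolding f_def [abs_def] f'_def
      by (auto intro!: derivative_eq_intros * simp: algebra_simps)
    then show "(f has_vector_derivative f' r) (at r within {0..t})"
      by (simp add: has_real_derivative_iff_has_vector_derivative)
    have "d r \<bullet> d' r \<le> norm (d r) * norm (d' r)"
      by (rule norm_cauchy_schwarz)
    also have "\<dots> \<le> norm (d r) * (L * norm (d r))"
      by (intro mult_left_mono le r) auto
    also have "\<dots> = L * (d r \<bullet> d r)"
      by (simp add: power2_norm_eq_inner[symmetric] power2_eq_square)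
    finally show "0 \<le> f' r"
      by (simp add: f'_def)
  qed (use s in auto)
  then have "(norm (d s))\<^sup>2 * exp (- (2 * L * s)) \<le> (norm (d 0))\<^sup>2"
    by (simp add: f_def power2_norm_eq_inner)
  then have "(norm (d s))\<^sup>2 \<le> (norm (d 0))\<^sup>2 * exp (2 * L * s)"
    by (simp add: exp_minus field_simps)
  also have "\<dots> = (norm (d 0) * exp (L * s))\<^sup>2"
    by (simp add: power_mult_distrib mult_exp_exp power2_eq_square)
  finally show ?thesis
    by (rule power2_le_imp_le) auto
qed

text \<open>With a global Lipschitz constant the increments of the Picard iteration are bounded by
  the terms of an exponential series, so it converges on the whole interval at once. The Loewner
  field is singular; it is truncated before this lemma is applied, and the truncation is then shown
  to be inactive.\<close>

lemma picard_global:
  fixes F :: "real \<Rightarrow> 'a::banach \<Rightarrow> 'a"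
  assumes L: "0 \<le> L"
    and cont: "\<And>u. continuous_on {0..t} u \<Longrightarrow> continuous_on {0..t} (\<lambda>s. F s (u s))"
    and lip: "\<And>s v w. s \<in> {0..t} \<Longrightarrow> norm (F s v - F s w) \<le> L * norm (v - w)"
  obtains u where "u 0 = z"
    "\<And>s. s \<in> {0..t} \<Longrightarrow> (u has_vector_derivative F s (u s)) (at s within {0..t})"
proof -
  define w where "w = rec_nat (\<lambda>s. z) (\<lambda>n v s. z + integral {0..s} (\<lambda>r. F r (v r)))"
  have w0: "w 0 = (\<lambda>s. z)" and wS: "w (Suc n) = (\<lambda>s. z + integral {0..s} (\<lambda>r. F r (w n r)))" for n
    by (auto simp: w_def)
  have contw: "continuous_on {0..t} (w n)" for n
    by (induction n) (auto simp: w0 wS intro!: continuous_intros indefinite_integral_continuous_1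
        integrable_continuous_real cont)
  have int: "(\<lambda>r. F r (v r)) integrable_on {0..s}" if "s \<in> {0..t}" "continuous_on {0..t} v" for s v
    using that by (intro integrable_continuous_real continuous_on_subset[OF cont]) auto
  have "bounded ((\<lambda>s. F s z) ` {0..t})"
    using cont[of "\<lambda>s. z"] by (auto intro!: compact_imp_bounded compact_continuous_image)
  then obtain K0 where K0: "\<And>s. s \<in> {0..t} \<Longrightarrow> norm (F s z) \<le> K0"
    by (force simp: bounded_iff)
  define K where "K = \<bar>K0\<bar> * \<bar>t\<bar>"
  have step: "norm (w (Suc n) s - w n s) \<le> K * (L * s) ^ n / fact n" if "s \<in> {0..t}" for n s
    using that
  proof (induction n arbitrary: s)
    case 0
    have "norm (integral {0..s} (\<lambda>r. F r z)) \<le> integral {0..s} (\<lambda>r. \<bar>K0\<bar>)"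
      using 0 K0 by (intro integral_norm_bound_integral int) (auto intro: order_trans[OF _ abs_ge_self])
    also have "\<dots> \<le> K"
      using 0 by (auto simp: K_def mult.commute[of _ "\<bar>K0\<bar>"] intro: mult_left_mono)
    finally show ?case
      by (simp add: w0 wS)
  next
    case (Suc n)
    have hi: "((\<lambda>r. L * (K * (L * r) ^ n / fact n)) has_integral
        K * (L * s) ^ Suc n / fact (Suc n) - K * (L * 0) ^ Suc n / fact (Suc n)) {0..s}"
    proof (rule fundamental_theorem_of_calculus)
      fix r
      have "((\<lambda>r. K * (L * r) ^ Suc n / fact (Suc n)) has_real_derivative
          L * (K * (L * r) ^ n / fact n)) (at r within {0..s})"
        by (rule derivative_eq_intros refl | simp add: field_simps del: of_nat_Suc)+
      then show "((\<lambda>r. K * (L * r) ^ Suc n / fact (Suc n)) has_vector_derivative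
          L * (K * (L * r) ^ n / fact n)) (at r within {0..s})"
        by (simp add: has_real_derivative_iff_has_vector_derivative)
    qed (use Suc in auto)
    have "w (Suc (Suc n)) s - w (Suc n) s
        = integral {0..s} (\<lambda>r. F r (w (Suc n) r) - F r (w n r))"
      by (simp add: wS[of "Suc n"] wS[of n, THEN fun_cong, of s]
          Henstock_Kurzweil_Integration.integral_diff int[OF Suc.prems contw])
    also have "norm \<dots> \<le> integral {0..s} (\<lambda>r. L * (K * (L * r) ^ n / fact n))"
    proof (rule integral_norm_bound_integral)
      show "(\<lambda>r. F r (w (Suc n) r) - F r (w n r)) integrable_on {0..s}"
        by (intro integrable_diff int[OF Suc.prems contw])
      fix r assume "r \<in> {0..s}"
      then have r: "r \<in> {0..t}"
        using Suc.prems by auto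
      show "norm (F r (w (Suc n) r) - F r (w n r)) \<le> L * (K * (L * r) ^ n / fact n)"
        using lip[OF r] Suc.IH[OF r] L by (meson mult_left_mono order_trans)
    qed (use hi in blast)
    also have "\<dots> = K * (L * s) ^ Suc n / fact (Suc n)"
      unfolding integral_unique[OF hi] by simp
    finally show ?case .
  qed
  have bnd: "norm (w (Suc n) s - w n s) \<le> K * ((L * \<bar>t\<bar>) ^ n / fact n)" if s: "s \<in> {0..t}" for n s
  proof -
    have "(L * s) ^ n \<le> (L * \<bar>t\<bar>) ^ n"
      using s L by (intro power_mono mult_left_mono) auto
    then have "K * (L * s) ^ n / fact n \<le> K * (L * \<bar>t\<bar>) ^ n / fact n"
      by (intro divide_right_mono mult_left_mono) (auto simp: K_def)
    then show ?thesis
      using step[OF s, of n] by simp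
  qed
  have "summable (\<lambda>n. K * ((L * \<bar>t\<bar>) ^ n / fact n))"
    using summable_exp[of "L * \<bar>t\<bar>"] by (intro summable_mult) (simp add: field_simps)
  then have ul: "uniform_limit {0..t} (\<lambda>n s. \<Sum>i<n. w (Suc i) s - w i s)
      (\<lambda>s. suminf (\<lambda>i. w (Suc i) s - w i s)) sequentially"
    by (rule Weierstrass_m_test[rotated]) (use bnd in auto)
  define u where "u s = z + suminf (\<lambda>i. w (Suc i) s - w i s)" for s
  have "uniform_limit {0..t} (\<lambda>n s. z + (\<Sum>i<n. w (Suc i) s - w i s)) u sequentially"
    unfolding u_def [abs_def] by (intro uniform_limit_intros ul)
  moreover have "(\<lambda>n s. z + (\<Sum>i<n. w (Suc i) s - w i s)) = w"
  proof (intro ext)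
    fix n s
    show "z + (\<Sum>i<n. w (Suc i) s - w i s) = w n s"
      unfolding sum_lessThan_telescope[of "\<lambda>i. w i s" n] by (simp add: w0)
  qed
  ultimately have ulw: "uniform_limit {0..t} w u sequentially"
    by simp
  have contu: "continuous_on {0..t} u"
    by (rule uniform_limit_theorem[OF always_eventually ulw]) (use contw in auto)
  have eq: "u s = z + integral {0..s} (\<lambda>r. F r (u r))" if s: "s \<in> {0..t}" for s
  proof -
    have "(\<lambda>n. w n s) \<longlonglongrightarrow> u s"
      using tendsto_uniform_limitI[OF ulw s] .
    then have 1: "(\<lambda>n. w (Suc n) s) \<longlonglongrightarrow> u s"
      by (rule LIMSEQ_Suc)
    have "(\<lambda>n. w (Suc n) s) \<longlonglongrightarrow> z + integral {0..s} (\<lambda>r. F r (u r))"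
    proof (rule metric_LIMSEQ_I)
      fix e :: real assume e: "0 < e"
      define e' where "e' = e / (L * \<bar>t\<bar> + 1)"
      have pos: "0 < L * \<bar>t\<bar> + 1"
        using L by (simp add: add_nonneg_pos)
      have "e' > 0"
        using e pos by (simp add: e'_def)
      from uniform_limitD[OF ulw this] obtain N where
        N: "\<forall>n\<ge>N. \<forall>r\<in>{0..t}. dist (w n r) (u r) < e'"
        unfolding eventually_sequentially by blast
      have "dist (w (Suc n) s) (z + integral {0..s} (\<lambda>r. F r (u r))) < e" if n: "n \<ge> N" for n
      proof -
        have "dist (w (Suc n) s) (z + integral {0..s} (\<lambda>r. F r (u r)))
            = norm (integral {0..s} (\<lambda>r. F r (w n r) - F r (u r)))"
          by (simp add: wS dist_norm Henstock_Kurzweil_Integration.integral_diff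
              int[OF s contw] int[OF s contu])
        also have "\<dots> \<le> integral {0..s} (\<lambda>r. L * e')"
        proof (rule integral_norm_bound_integral)
          show "(\<lambda>r. F r (w n r) - F r (u r)) integrable_on {0..s}"
            by (intro integrable_diff int[OF s contw] int[OF s contu])
          fix r assume "r \<in> {0..s}"
          then have r: "r \<in> {0..t}"
            using s by auto
          show "norm (F r (w n r) - F r (u r)) \<le> L * e'"
            using order_trans[OF lip[OF r, of "w n r" "u r"] mult_left_mono[OF _ L, of _ e']] N n r
            by (simp add: dist_norm less_imp_le)
        qed auto
        also have "\<dots> = L * s * e'"
          using s by simp
        also have "\<dots> \<le> L * \<bar>t\<bar> * e'"
          using s L \<open>e' > 0\<close> by (intro mult_right_mono mult_left_mono) auto
        also have "\<dots> < (L * \<bar>t\<bar> + 1) * e'"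
          using \<open>e' > 0\<close> by (simp add: algebra_simps)
        also have "\<dots> = e"
          using pos by (simp add: e'_def)
        finally show ?thesis .
      qed
      then show "\<exists>N. \<forall>n\<ge>N. dist (w (Suc n) s) (z + integral {0..s} (\<lambda>r. F r (u r))) < e"
        by blast
    qed
    with 1 show ?thesis
      using LIMSEQ_unique by blast
  qed
  show thesis
  proof (cases "0 \<le> t")
    case True
    show thesis
    proof (rule that)
      show "u 0 = z"
        using eq[of 0] True by simp
      fix s assume s: "s \<in> {0..t}"
      have "((\<lambda>s. z + integral {0..s} (\<lambda>r. F r (u r))) has_vector_derivative 0 + F s (u s))
          (at s within {0..t})"
        by (intro has_vector_derivative_add has_vector_derivative_const
            integral_has_vector_derivative cont contu s)
      then show "(u has_vector_derivative F s (u s)) (at s within {0..t})"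
        using has_vector_derivative_transform[OF s] eq by (metis (no_types, lifting) add_0)
    qed
  next
    case False
    show thesis
      by (rule that[of "\<lambda>s. z"]) (use False in auto)
  qed
qed

section \<open>Solutions of the Loewner equation: uniqueness, stability, survival of real
  points\<close>

lemma loewner_solutionD:
  assumes "loewner_solution X t z u"
  shows "u 0 = z" "\<And>s. s \<in> {0..t} \<Longrightarrow> u s \<noteq> of_real (X s)"
    "\<And>s. s \<in> {0..t} \<Longrightarrow> (u has_vector_derivative 2 / (u s - of_real (X s))) (at s within {0..t})"
    "continuous_on {0..t} u"
proof -
  show *: "u 0 = z" "\<And>s. s \<in> {0..t} \<Longrightarrow> u s \<noteq> of_real (X s)"
    "\<And>s. s \<in> {0..t} \<Longrightarrow> (u has_vector_derivative 2 / (u s - of_real (X s))) (at s within {0..t})"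
    using assms by (auto simp: loewner_solution_def)
  show "continuous_on {0..t} u"
    using *(3) has_vector_derivative_continuous continuous_on_eq_continuous_within by blast
qed

lemma loewner_solution_cnj:
  assumes "loewner_solution X t z u"
  shows "loewner_solution X t (cnj z) (\<lambda>s. cnj (u s))"
  unfolding loewner_solution_def
proof (intro conjI ballI)
  fix s assume s: "s \<in> {0..t}"
  show "cnj (u s) \<noteq> of_real (X s)"
    using loewner_solutionD(2)[OF assms s] by (metis complex_cnj_cnj complex_cnj_complex_of_real)
  show "((\<lambda>s. cnj (u s)) has_vector_derivative 2 / (cnj (u s) - of_real (X s))) (at s within {0..t})"
    using has_vector_derivative_cnj[OF loewner_solutionD(3)[OF assms s]] by simp
qed (use loewner_solutionD(1)[OF assms] in simp)

lemma loewner_solution_reflect: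
  assumes "loewner_solution (\<lambda>s. - X s) t (- z) u"
  shows "loewner_solution X t z (\<lambda>s. - u s)"
  unfolding loewner_solution_def
proof (intro conjI ballI)
  fix s assume s: "s \<in> {0..t}"
  note D = loewner_solutionD(2,3)[OF assms s]
  show "- u s \<noteq> of_real (X s)"
    using D(1) by (metis minus_minus of_real_minus)
  have "2 / (u s + of_real (X s)) = - (2 / (- u s - of_real (X s)))"
    by (metis minus_diff_eq minus_divide_right diff_minus_eq_add minus_diff_commute)
  then show "((\<lambda>s. - u s) has_vector_derivative 2 / (- u s - of_real (X s))) (at s within {0..t})"
    using has_vector_derivative_minus[OF D(2)] by simp
qed (use loewner_solutionD(1)[OF assms] in simp)

text \<open>The difference of two Loewner fields is the difference of the points times
  \<open>- 2 / ((u - X) * (v - X))\<close>, so the equation is linear in \<open>u - v\<close>. Equal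
  starting points give uniqueness; nearby ones give the difference quotient of the flow map.\<close>

lemma loewner_difference:
  assumes X: "continuous_on {0..t} X"
    and u: "loewner_solution X t z u" and v: "loewner_solution X t z' v" and s: "s \<in> {0..t}"
  shows "u s - v s = (z - z') * exp (integral {0..s}
           (\<lambda>r. - 2 / ((u r - of_real (X r)) * (v r - of_real (X r)))))"
proof -
  note U = loewner_solutionD[OF u] and V = loewner_solutionD[OF v]
  have "(\<lambda>s. u s - v s) s = (\<lambda>s. u s - v s) 0 * exp (integral {0..s}
           (\<lambda>r. - 2 / ((u r - of_real (X r)) * (v r - of_real (X r)))))"
  proof (rule linear_ode[OF _ _ s])
    fix r assume r: "r \<in> {0..t}"
    have "2 / (u r - of_real (X r)) - 2 / (v r - of_real (X r))
        = - 2 / ((u r - of_real (X r)) * (v r - of_real (X r))) * (u r - v r)"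
      using U(2)[OF r] V(2)[OF r] by (simp add: diff_frac_eq) (simp add: minus_divide_left algebra_simps)
    then show "((\<lambda>s. u s - v s) has_vector_derivative
        - 2 / ((u r - of_real (X r)) * (v r - of_real (X r))) * (u r - v r)) (at r within {0..t})"
      using has_vector_derivative_diff[OF U(3)[OF r] V(3)[OF r]] by simp
  next
    show "continuous_on {0..t} (\<lambda>r. - 2 / ((u r - of_real (X r)) * (v r - of_real (X r))))"
      using U(2) V(2) by (intro continuous_intros U(4) V(4) X) auto
  qed
  then show ?thesis
    using U(1) V(1) by simp
qed

lemma loewner_unique:
  assumes "continuous_on {0..t} X" "loewner_solution X t z u" "loewner_solution X t z v" "s \<in> {0..t}"
  shows "u s = v s"
  using loewner_difference[OF assms] by simp

text \<open>Imaginary parts satisfy a linear equation with a real coefficient. The exponential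
  factor is positive, so the sign of the imaginary part never changes and real points stay
  real.\<close>

lemma loewner_Im:
  assumes X: "continuous_on {0..t} X" and u: "loewner_solution X t z u" and s: "s \<in> {0..t}"
  shows "Im (u s) = Im z * exp (integral {0..s} (\<lambda>r. - 2 / (cmod (u r - of_real (X r)))\<^sup>2))"
proof -
  note U = loewner_solutionD[OF u]
  have "(\<lambda>s. Im (u s)) s = (\<lambda>s. Im (u s)) 0 * exp (integral {0..s}
           (\<lambda>r. - 2 / (cmod (u r - of_real (X r)))\<^sup>2))"
  proof (rule linear_ode[OF _ _ s])
    fix r assume r: "r \<in> {0..t}"
    have "Im (2 / (u r - of_real (X r))) = - 2 / (cmod (u r - of_real (X r)))\<^sup>2 * Im (u r)"
      by (simp add: Im_divide cmod_power2)
    then show "((\<lambda>s. Im (u s)) has_vector_derivative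
        - 2 / (cmod (u r - of_real (X r)))\<^sup>2 * Im (u r)) (at r within {0..t})"
      using bounded_linear.has_vector_derivative[OF bounded_linear_Im U(3)[OF r]] by simp
  next
    show "continuous_on {0..t} (\<lambda>r. - 2 / (cmod (u r - of_real (X r)))\<^sup>2)"
      using U(2) by (intro continuous_intros U(4) X) auto
  qed
  then show ?thesis
    using U(1) by simp
qed

text \<open>The squared height decreases at rate
  \<open>4 * (Im u)\<^sup>2 / (cmod (u - X))\<^sup>2\<close>, which is at most 4. This is the usual
  fact that the hull at time \<open>s\<close> has height at most \<open>2 * sqrt s\<close>.\<close>

lemma loewner_Im_lower_bound:
  assumes u: "loewner_solution X t z u" and s: "s \<in> {0..t}"
  shows "(Im z)\<^sup>2 - 4 * s \<le> (Im (u s))\<^sup>2"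
proof -
  note U = loewner_solutionD[OF u]
  define f' where "f' r = 2 * Im (u r) * Im (2 / (u r - of_real (X r))) + 4" for r
  have "(Im z)\<^sup>2 \<le> (Im (u s))\<^sup>2 + 4 * s"
  proof (rule barrier[where f = "\<lambda>s. (Im (u s))\<^sup>2 + 4 * s" and f' = f' and t = t and ?s1.0 = s])
    fix r assume r: "r \<in> {0..t}"
    have Imd: "((\<lambda>s. Im (u s)) has_real_derivative Im (2 / (u r - of_real (X r)))) (at r within {0..t})"
      unfolding has_real_derivative_iff_has_vector_derivative
      by (rule bounded_linear.has_vector_derivative[OF bounded_linear_Im U(3)[OF r]])
    have "((\<lambda>s. (Im (u s))\<^sup>2 + 4 * s) has_real_derivative f' r) (at r within {0..t})"
      using DERIV_add[OF DERIV_power[OF Imd, of 2] DERIV_cmult[OF DERIV_ident, of 4]]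
      by (simp add: f'_def mult_ac)
    then show "((\<lambda>s. (Im (u s))\<^sup>2 + 4 * s) has_vector_derivative f' r) (at r within {0..t})"
      by (simp add: has_real_derivative_iff_has_vector_derivative)
    define D where "D = (cmod (u r - of_real (X r)))\<^sup>2"
    have D: "D = (Re (u r) - X r)\<^sup>2 + (Im (u r))\<^sup>2"
      by (simp add: D_def cmod_power2)
    then have "(Im (u r))\<^sup>2 \<le> D"
      by simp
    moreover have "D > 0"
      using U(2)[OF r] by (simp add: D_def)
    moreover have "f' r = 4 * (1 - (Im (u r))\<^sup>2 / D)"
      unfolding f'_def D by (simp add: Im_divide power2_eq_square)
    ultimately show "0 \<le> f' r"
      by (simp add: divide_le_eq)
  qed (use s U(1) in auto)
  then show ?thesis
    by simp
qed

text \<open>Survival is an open condition. Near the given solution, the displacement in the field is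
  projected to a disc on which the field is Lipschitz; Gronwall keeps the displacement of a close
  starting point inside this disc, where the projection is the identity and the modified solution is
  a true one.\<close>

lemma loewner_stable:
  assumes X: "continuous_on {0..t} X" and u: "loewner_solution X t z u"
  obtains \<delta> K where "\<delta> > 0"
    "\<And>z'. cmod (z' - z) < \<delta> \<Longrightarrow> \<exists>v. loewner_solution X t z' v \<and>
       (\<forall>s\<in>{0..t}. cmod (v s - u s) \<le> K * cmod (z' - z))"
proof (cases "0 \<le> t")
  case False
  show thesis
  proof (rule that[of 1 0])
    fix z' show "\<exists>v. loewner_solution X t z' v \<and> (\<forall>s\<in>{0..t}. cmod (v s - u s) \<le> 0 * cmod (z' - z))"
      using False by (intro exI[of _ "\<lambda>s. z'"]) (auto simp: loewner_solution_def)
  qed simp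
next
  case True
  note U = loewner_solutionD[OF u]
  define a where "a s = u s - of_real (X s)" for s
  have conta: "continuous_on {0..t} a"
    unfolding a_def [abs_def] by (intro continuous_intros U(4) X)
  have "continuous_on {0..t} (\<lambda>s. cmod (a s))"
    by (intro continuous_intros conta)
  then obtain s0 where s0: "s0 \<in> {0..t}" "\<And>s. s \<in> {0..t} \<Longrightarrow> cmod (a s0) \<le> cmod (a s)"
    using continuous_attains_inf[of "{0..t}" "\<lambda>s. cmod (a s)"] True by auto
  define m where "m = cmod (a s0)"
  have m: "m > 0"
    using U(2)[OF s0(1)] by (simp add: m_def a_def)
  \<comment> \<open>\<open>m\<close> is the least distance of the given solution from the driving
    point, so projecting the displacement to radius \<open>m/2\<close> keeps all denominators at
    least \<open>m/2\<close>. Nearest-point projection to a convex set is 1-Lipschitz, which leads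
    to the constant \<open>L = 8 / m\<^sup>2\<close>, that is
    \<open>2 / (m/2)\<^sup>2\<close>.\<close>
  define pr :: "complex \<Rightarrow> complex" where "pr = closest_point (cball 0 (m/2))"
  have pr_in: "cmod (pr e) \<le> m/2" for e
    using closest_point_in_set[of "cball 0 (m/2)" e] m by (simp add: pr_def)
  have pr_lip: "cmod (pr e - pr e') \<le> cmod (e - e')" for e e'
    using closest_point_lipschitz[of "cball 0 (m/2)" e e'] m by (simp add: pr_def dist_norm)
  have pr_id: "pr e = e" if "cmod e \<le> m/2" for e
    using that by (simp add: pr_def closest_point_self)
  have den: "m/2 \<le> cmod (a s + pr e)" if "s \<in> {0..t}" for s e
    using s0(2)[OF that] pr_in[of e] norm_triangle_ineq2[of "a s" "- pr e"] by (simp add: m_def)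
  have den0: "a s + pr e \<noteq> 0" if "s \<in> {0..t}" for s e
    using den[OF that, of e] m by auto
  define L where "L = 8 / m\<^sup>2"
  have L: "0 \<le> L"
    by (simp add: L_def)
  have lip: "cmod (2 / (a s + pr e) - 2 / (a s + pr e')) \<le> L * cmod (e - e')"
    if s: "s \<in> {0..t}" for s e e'
  proof -
    have "2 / (a s + pr e) - 2 / (a s + pr e') = 2 * (pr e' - pr e) / ((a s + pr e) * (a s + pr e'))"
      using den0[OF s] by (simp add: field_simps)
    also have "cmod \<dots> = 2 * cmod (pr e' - pr e) / (cmod (a s + pr e) * cmod (a s + pr e'))"
      by (simp only: norm_mult norm_divide) simp
    also have "\<dots> \<le> 2 * cmod (pr e' - pr e) / (m/2 * (m/2))"
    proof (rule frac_le)
      show "0 < m/2 * (m/2)"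
        using m by simp
      show "m/2 * (m/2) \<le> cmod (a s + pr e) * cmod (a s + pr e')"
        using m by (intro mult_mono den s) auto
    qed auto
    also have "\<dots> \<le> 2 * cmod (e - e') / (m/2 * (m/2))"
      using pr_lip[of e' e] m by (intro divide_right_mono mult_left_mono) (auto simp: norm_minus_commute)
    also have "\<dots> = L * cmod (e - e')"
      using m by (simp add: L_def power2_eq_square)
    finally show ?thesis .
  qed
  have contpr: "continuous_on UNIV pr"
    unfolding pr_def using m by (intro continuous_on_closest_point) auto
  define K where "K = exp (L * t)"
  show thesis
  proof (rule that[of "m / (2 * K)" K])
    show "m / (2 * K) > 0"
      using m by (simp add: K_def)
    fix z' assume z': "cmod (z' - z) < m / (2 * K)"
    obtain v where v: "v 0 = z'" "\<And>s. s \<in> {0..t} \<Longrightarrow>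
        (v has_vector_derivative 2 / (a s + pr (v s - u s))) (at s within {0..t})"
    proof (rule picard_global[OF L, where F = "\<lambda>s v. 2 / (a s + pr (v - u s))" and t = t and z = z'])
      show "continuous_on {0..t} (\<lambda>s. 2 / (a s + pr (v s - u s)))" if "continuous_on {0..t} v" for v
        using den0 by (intro continuous_intros conta that U(4)
            continuous_on_compose2[OF contpr]) auto
      show "cmod (2 / (a s + pr (v - u s)) - 2 / (a s + pr (w - u s))) \<le> L * cmod (v - w)"
        if "s \<in> {0..t}" for s v w
        using lip[OF that, of "v - u s" "w - u s"] by simp
    qed auto
    have close: "cmod (v s - u s) \<le> cmod (z' - z) * exp (L * s)" if s: "s \<in> {0..t}" for s
    proof -
      have "cmod ((\<lambda>s. v s - u s) s) \<le> cmod ((\<lambda>s. v s - u s) 0) * exp (L * s)"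
      proof (rule gronwall[OF _ _ s])
        fix r assume r: "r \<in> {0..t}"
        show "((\<lambda>s. v s - u s) has_vector_derivative
            2 / (a r + pr (v r - u r)) - 2 / a r) (at r within {0..t})"
          using has_vector_derivative_diff[OF v(2)[OF r] U(3)[OF r]] by (simp add: a_def)
        show "cmod (2 / (a r + pr (v r - u r)) - 2 / a r) \<le> L * cmod (v r - u r)"
          using lip[OF r, of "v r - u r" 0] m by (simp add: pr_id)
      qed
      then show ?thesis
        by (simp add: v(1) U(1))
    qed
    have close': "cmod (v s - u s) \<le> K * cmod (z' - z)" if s: "s \<in> {0..t}" for s
    proof -
      have "exp (L * s) \<le> K"
        using s L by (auto simp: K_def intro: mult_left_mono)
      then show ?thesis
        using order_trans[OF close[OF s] mult_left_mono[of "exp (L * s)" K "cmod (z' - z)"]]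
        by (simp add: mult.commute)
    qed
    have small: "cmod (v s - u s) \<le> m/2" if s: "s \<in> {0..t}" for s
    proof -
      have "K * cmod (z' - z) \<le> m/2"
        using z' by (simp add: K_def field_simps)
      then show ?thesis
        using close'[OF s] by linarith
    qed
    have eq: "a s + pr (v s - u s) = v s - of_real (X s)" if s: "s \<in> {0..t}" for s
      using small[OF s] by (simp add: pr_id a_def)
    have "loewner_solution X t z' v"
      unfolding loewner_solution_def
    proof (intro conjI ballI)
      fix s assume s: "s \<in> {0..t}"
      show "v s \<noteq> of_real (X s)"
        using den0[OF s, of "v s - u s"] eq[OF s] by auto
      show "(v has_vector_derivative 2 / (v s - of_real (X s))) (at s within {0..t})"
        using v(2)[OF s] by (simp add: eq[OF s])
    qed (use v(1) in simp)
    then show "\<exists>v. loewner_solution X t z' v \<and> (\<forall>s\<in>{0..t}. cmod (v s - u s) \<le> K * cmod (z' - z))"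
      using close' by blast
  qed
qed

text \<open>A real point is repelled with speed 2 divided by its distance, so a driving point of
  bounded speed can never catch it. Points to the left are treated by reflection.\<close>

lemma loewner_real_solution:
  assumes X: "\<And>s. s \<in> {0..t} \<Longrightarrow> (X has_vector_derivative X' s) (at s within {0..t})"
    and C: "\<And>s. s \<in> {0..t} \<Longrightarrow> \<bar>X' s\<bar> \<le> C"
    and p: "p \<noteq> X 0"
  obtains u where "loewner_solution X t (of_real p) u"
proof -
  have right: "\<exists>u. loewner_solution X t (of_real p) u"
    if X: "\<And>s. s \<in> {0..t} \<Longrightarrow> (X has_vector_derivative X' s) (at s within {0..t})"
    and C: "\<And>s. s \<in> {0..t} \<Longrightarrow> \<bar>X' s\<bar> \<le> C"
    and p: "X 0 < p" for X X' p
  proof -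
    have contX: "continuous_on {0..t} X"
      using X has_vector_derivative_continuous continuous_on_eq_continuous_within by blast
    \<comment> \<open>The second entry gives \<open>C * \<delta> \<le> 2\<close>: at distance
      \<open>\<delta>\<close> the flow is at least as fast as the driving point. The summand 1
      avoids a division by zero. The field is cut off below \<open>\<delta>\<close>, and the barrier
      shows that the cut-off is never felt.\<close>
    define \<delta> where "\<delta> = min (p - X 0) (2 / (\<bar>C\<bar> + 1))"
    have \<delta>: "\<delta> > 0" "\<delta> \<le> p - X 0" "C * \<delta> \<le> 2"
    proof -
      show "\<delta> > 0" "\<delta> \<le> p - X 0"
        using p by (auto simp: \<delta>_def)
      have "\<delta> \<le> 2 / (\<bar>C\<bar> + 1)"
        by (simp add: \<delta>_def)
      then have "(\<bar>C\<bar> + 1) * \<delta> \<le> 2"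
        by (simp add: field_simps)
      moreover have "C * \<delta> \<le> (\<bar>C\<bar> + 1) * \<delta>"
        using \<open>\<delta> > 0\<close> by (intro mult_right_mono) auto
      ultimately show "C * \<delta> \<le> 2"
        by linarith
    qed
    obtain v :: "real \<Rightarrow> real" where v: "v 0 = p" "\<And>s. s \<in> {0..t} \<Longrightarrow>
        (v has_vector_derivative 2 / max \<delta> (v s - X s)) (at s within {0..t})"
    proof (rule picard_global[where L = "2 / \<delta>\<^sup>2" and F = "\<lambda>s v. 2 / max \<delta> (v - X s)" and t = t and z = p])
      show "continuous_on {0..t} (\<lambda>s. 2 / max \<delta> (v s - X s))" if "continuous_on {0..t} v" for v
        using \<delta>(1) by (intro continuous_intros that contX) auto
      show "norm (2 / max \<delta> (v - X s) - 2 / max \<delta> (w - X s)) \<le> 2 / \<delta>\<^sup>2 * norm (v - w)" for s v w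
      proof -
        define x y where "x = max \<delta> (v - X s)" and "y = max \<delta> (w - X s)"
        have xy: "\<delta> \<le> x" "\<delta> \<le> y" "\<bar>x - y\<bar> \<le> \<bar>v - w\<bar>"
          by (auto simp: x_def y_def)
        have "2 / x - 2 / y = 2 * (y - x) / (x * y)"
          using xy \<delta> by (simp add: field_simps)
        then have "\<bar>2 / x - 2 / y\<bar> = 2 * \<bar>x - y\<bar> / (x * y)"
          using xy \<delta> by (simp only: abs_divide abs_mult) (simp add: abs_minus_commute)
        also have "\<dots> \<le> 2 * \<bar>v - w\<bar> / (\<delta> * \<delta>)"
          using xy \<delta> by (intro frac_le mult_mono) auto
        finally show ?thesis
          by (simp add: x_def y_def power2_eq_square)
      qed
    qed auto
    have pos: "\<delta> \<le> v s - X s" if s: "s \<in> {0..t}" for s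
    proof (rule barrier[where f = "\<lambda>s. v s - X s" and f' = "\<lambda>s. 2 / max \<delta> (v s - X s) - X' s"
          and t = t and ?s1.0 = s])
      fix r assume r: "r \<in> {0..t}"
      show "((\<lambda>s. v s - X s) has_vector_derivative 2 / max \<delta> (v r - X r) - X' r) (at r within {0..t})"
        by (intro has_vector_derivative_diff v r X)
      assume "v r - X r < \<delta>"
      moreover have "X' r * \<delta> \<le> C * \<delta>"
        using C[OF r] \<delta>(1) by (intro mult_right_mono) auto
      then have "X' r * \<delta> \<le> 2"
        using \<delta>(3) by linarith
      then have "X' r \<le> 2 / \<delta>"
        using \<delta>(1) by (simp add: pos_le_divide_eq)
      ultimately show "0 \<le> 2 / max \<delta> (v r - X r) - X' r"
        by (simp add: max_def)
    qed (use \<delta> v s in auto)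
    have "loewner_solution X t (of_real p) (\<lambda>s. of_real (v s))"
      unfolding loewner_solution_def
    proof (intro conjI ballI)
      fix s assume s: "s \<in> {0..t}"
      show "complex_of_real (v s) \<noteq> of_real (X s)"
        using pos[OF s] \<delta>(1) by auto
      show "((\<lambda>s. complex_of_real (v s)) has_vector_derivative
          2 / (complex_of_real (v s) - of_real (X s))) (at s within {0..t})"
        using bounded_linear.has_vector_derivative[OF bounded_linear_of_real[where 'a=complex] v(2)[OF s]] pos[OF s]
        by (simp add: max_absorb2)
    qed (use v in simp)
    then show ?thesis
      by blast
  qed
  show thesis
  proof (cases "X 0 < p")
    case True
    then show thesis
      using right[OF X C] that by blast
  next
    case False
    have "\<exists>u. loewner_solution (\<lambda>s. - X s) t (of_real (- p)) u"
    proof (rule right[where X' = "\<lambda>s. - X' s"])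
      show "((\<lambda>s. - X s) has_vector_derivative - X' s) (at s within {0..t})" if "s \<in> {0..t}" for s
        by (intro has_vector_derivative_minus X that)
      show "- X 0 < - p"
        using p False by simp
    qed (use C in auto)
    then show thesis
      using that loewner_solution_reflect[of X t "of_real p"] by fastforce
  qed
qed

section \<open>One-sided derivatives and limits at the end of a time interval\<close>

lemma at_within_atLeastAtMost_eq:
  fixes s t :: real
  assumes "s < t"
  shows "at s within {0..t} = at s within {0..}"
  by (rule at_within_nhd[of s "{..<t}"]) (use assms in auto)

lemma at_left_eq_within:
  fixes S :: real
  assumes "0 < S"
  shows "at S within {0..<S} = at_left S"
  by (rule at_within_nhd[of S "{0<..}"]) (use assms in auto)

lemma loewner_solution_deriv:
  assumes "\<And>t. \<lbrakk>0 \<le> t; t < S\<rbrakk> \<Longrightarrow> loewner_solution X t z u" "0 \<le> s" "s < S"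
  shows "(u has_vector_derivative 2 / (u s - of_real (X s))) (at s within {0..})"
proof -
  obtain t where "s < t" "t < S"
    using assms(3) dense by blast
  then show ?thesis
    using loewner_solutionD(3)[OF assms(1), of t s] assms(2) by (simp add: at_within_atLeastAtMost_eq)
qed

lemma continuous_on_deriv_atLeast:
  assumes "\<And>s. s \<in> {0..<S} \<Longrightarrow> (f has_vector_derivative f' s) (at s within {0..})"
  shows "continuous_on {0..<S} f"
  unfolding continuous_on_eq_continuous_within
proof
  fix s assume s: "s \<in> {0..<S}"
  have "(f has_vector_derivative f' s) (at s within {0..<S})"
    by (rule has_vector_derivative_within_subset[OF assms[OF s]]) auto
  then show "continuous (at s within {0..<S}) f"
    by (rule has_vector_derivative_continuous)
qed

lemma vector_lipschitz:
  fixes f :: "real \<Rightarrow> 'a::real_normed_vector"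
  assumes "\<And>s. s \<in> I \<Longrightarrow> (f has_vector_derivative f' s) (at s within I)"
    and "\<And>s. s \<in> I \<Longrightarrow> norm (f' s) \<le> B" and "convex I" "x \<in> I" "y \<in> I"
  shows "norm (f x - f y) \<le> B * \<bar>x - y\<bar>"
proof -
  have "norm (f x - f y) \<le> B * norm (x - y)"
  proof (rule differentiable_bound[OF assms(3) _ _ assms(4,5)])
    fix s assume s: "s \<in> I"
    show "(f has_derivative (\<lambda>h. h *\<^sub>R f' s)) (at s within I)"
      using assms(1)[OF s] by (simp add: has_vector_derivative_def)
    show "onorm (\<lambda>h. h *\<^sub>R f' s) \<le> B"
    proof (rule onorm_le)
      fix h :: real
      show "norm (h *\<^sub>R f' s) \<le> B * norm h"
        using mult_right_mono[OF assms(2)[OF s], of "\<bar>h\<bar>"] by (simp add: mult.commute)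
    qed
  qed
  then show ?thesis
    by simp
qed

lemma tendsto_at_left_bounded_deriv:
  fixes f :: "real \<Rightarrow> 'a::{real_normed_vector,complete_space}"
  assumes S: "0 < S"
    and deriv: "\<And>s. s \<in> {0..<S} \<Longrightarrow> (f has_vector_derivative f' s) (at s within {0..})"
    and bound: "\<And>s. s \<in> {0..<S} \<Longrightarrow> norm (f' s) \<le> B"
  obtains l where "(f \<longlongrightarrow> l) (at_left S)"
proof -
  have lip: "norm (f x - f y) \<le> B * \<bar>x - y\<bar>" if "x \<in> {0..<S}" "y \<in> {0..<S}" for x y
  proof (rule vector_lipschitz[OF _ bound _ that])
    fix s assume s: "s \<in> {0..<S}"
    show "(f has_vector_derivative f' s) (at s within {0..<S})"
      by (rule has_vector_derivative_within_subset[OF deriv[OF s]]) auto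
  qed auto
  have "uniformly_continuous_on {0..<S} f"
    unfolding uniformly_continuous_on_def
  proof (intro allI impI)
    fix e :: real assume e: "e > 0"
    define d where "d = e / (\<bar>B\<bar> + 1)"
    have "dist (f y) (f x) < e" if xy: "x \<in> {0..<S}" "y \<in> {0..<S}" "dist y x < d" for x y
    proof -
      have "dist (f y) (f x) \<le> B * \<bar>y - x\<bar>"
        using lip[OF xy(2,1)] by (simp add: dist_norm)
      also have "\<dots> \<le> (\<bar>B\<bar> + 1) * \<bar>y - x\<bar>"
        by (intro mult_right_mono) auto
      also have "\<dots> < (\<bar>B\<bar> + 1) * d"
        using xy(3) by (intro mult_strict_left_mono) (auto simp: dist_real_def)
      also have "\<dots> = e"
        by (simp add: d_def)
      finally show ?thesis .
    qed
    moreover have "d > 0"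
      using e by (simp add: d_def)
    ultimately show "\<exists>d>0. \<forall>x\<in>{0..<S}. \<forall>y\<in>{0..<S}. dist y x < d \<longrightarrow> dist (f y) (f x) < e"
      by blast
  qed
  moreover have "S \<in> closure {0..<S}"
    using S by (simp add: closure_atLeastLessThan)
  ultimately obtain l where "(f \<longlongrightarrow> l) (at S within {0..<S})"
    by (rule uniformly_continuous_on_extension_at_closure)
  then show thesis
    using that by (simp add: at_left_eq_within[OF S])
qed

section \<open>Signs, holomorphy and distortion along the flow\<close>

lemma nonzero_same_sign:
  fixes f :: "real \<Rightarrow> real"
  assumes "continuous_on {a..b} f" "\<And>x. x \<in> {a..b} \<Longrightarrow> f x \<noteq> 0" "s \<in> {a..b}" "t \<in> {a..b}"
  shows "0 < f s * f t"
proof (rule ccontr)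
  assume "\<not> 0 < f s * f t"
  then have "f s * f t < 0"
    using assms(2)[OF assms(3)] assms(2)[OF assms(4)] by (simp add: not_less le_less)
  then have *: "f s < 0 \<and> 0 < f t \<or> 0 < f s \<and> f t < 0"
    by (auto simp: mult_less_0_iff)
  have conn: "connected (f ` {a..b})"
    by (intro connected_continuous_image assms(1)) simp
  have mem: "f s \<in> f ` {a..b}" "f t \<in> f ` {a..b}"
    using assms(3,4) by blast+
  have "0 \<in> f ` {a..b}"
    using connectedD_interval[OF conn mem, of 0] connectedD_interval[OF conn mem(2,1), of 0] *
    by (metis less_imp_le)
  then show False
    using assms(2) by force
qed

lemma loewner_real:
  assumes "continuous_on {0..t} X" "loewner_solution X t (of_real q) u" "s \<in> {0..t}"
  shows "Im (u s) = 0" "0 < (Re (u s) - X s) * (q - X 0)"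
proof -
  have *: "Im (u r) = 0" if "r \<in> {0..t}" for r
    using loewner_Im[OF assms(1,2) that] by simp
  then show "Im (u s) = 0"
    using assms(3) .
  note U = loewner_solutionD[OF assms(2)]
  have "0 < (Re (u s) - X s) * (Re (u 0) - X 0)"
  proof (rule nonzero_same_sign[where f = "\<lambda>r. Re (u r) - X r" and a = 0 and b = t])
    show "continuous_on {0..t} (\<lambda>r. Re (u r) - X r)"
      by (intro continuous_intros U(4) assms(1))
    fix r assume r: "r \<in> {0..t}"
    show "Re (u r) - X r \<noteq> 0"
      using U(2)[OF r] *[OF r] by (auto simp: complex_eq_iff)
  qed (use assms(3) in auto)
  then show "0 < (Re (u s) - X s) * (q - X 0)"
    by (simp add: U(1))
qed

text \<open>By \<open>loewner_difference\<close> the difference quotient at \<open>z\<close> is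
  exactly the exponential of an integral depending on \<open>z'\<close>. Stability of the flow makes
  this integral continuous at \<open>z\<close>, so the quotient converges; no differentiation with
  respect to initial data is required.\<close>

lemma loewner_map_holomorphic:
  assumes X: "continuous_on {0..t} X" and t: "0 \<le> t" and U: "open U"
    and alive: "\<And>z. z \<in> U \<Longrightarrow> loewner_solution X t z (\<lambda>s. g s z)"
  shows "g t holomorphic_on U"
proof (rule holomorphic_onI)
  fix z assume z: "z \<in> U"
  note G = loewner_solutionD[OF alive[OF z]]
  define a where "a s = g s z - of_real (X s)" for s
  have conta: "continuous_on {0..t} a"
    unfolding a_def [abs_def] by (intro continuous_intros G(4) X)
  have "continuous_on {0..t} (\<lambda>s. cmod (a s))"
    by (intro continuous_intros conta)
  then obtain s0 where s0: "s0 \<in> {0..t}" "\<And>s. s \<in> {0..t} \<Longrightarrow> cmod (a s0) \<le> cmod (a s)"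
    using continuous_attains_inf[of "{0..t}" "\<lambda>s. cmod (a s)"] t by auto
  define m where "m = cmod (a s0)"
  have m: "m > 0"
    using G(2)[OF s0(1)] by (simp add: m_def a_def)
  obtain \<delta> K where \<delta>: "\<delta> > 0" "\<And>z'. cmod (z' - z) < \<delta> \<Longrightarrow> \<exists>v. loewner_solution X t z' v \<and>
       (\<forall>s\<in>{0..t}. cmod (v s - g s z) \<le> K * cmod (z' - z))"
    using loewner_stable[OF X alive[OF z]] by blast
  define I where "I z' = integral {0..t} (\<lambda>s. - 2 / ((g s z' - of_real (X s)) * a s))" for z'
  obtain \<epsilon> where \<epsilon>: "\<epsilon> > 0" "ball z \<epsilon> \<subseteq> U"
    using U z open_contains_ball by blast
  define d where "d = min (min \<delta> \<epsilon>) (m / (2 * (\<bar>K\<bar> + 1)))"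
  have d: "d > 0"
    using \<delta>(1) \<epsilon>(1) m by (simp add: d_def)
  have close: "cmod (g s z' - g s z) \<le> \<bar>K\<bar> * cmod (z' - z)" "m / 2 \<le> cmod (g s z' - of_real (X s))"
    if z': "cmod (z' - z) < d" and s: "s \<in> {0..t}" for z' s
  proof -
    have "z' \<in> U"
      using z' \<epsilon>(2) by (auto simp: d_def dist_norm norm_minus_commute)
    obtain v where v: "loewner_solution X t z' v"
      "\<forall>s\<in>{0..t}. cmod (v s - g s z) \<le> K * cmod (z' - z)"
      using \<delta>(2)[of z'] z' by (auto simp: d_def)
    have "g s z' = v s"
      by (rule loewner_unique[OF X alive[OF \<open>z' \<in> U\<close>] v(1) s])
    then have "cmod (g s z' - g s z) \<le> K * cmod (z' - z)"
      using v(2) s by simp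
    also have "\<dots> \<le> \<bar>K\<bar> * cmod (z' - z)"
      by (intro mult_right_mono) auto
    finally show 1: "cmod (g s z' - g s z) \<le> \<bar>K\<bar> * cmod (z' - z)" .
    have "\<bar>K\<bar> * cmod (z' - z) \<le> (\<bar>K\<bar> + 1) * (m / (2 * (\<bar>K\<bar> + 1)))"
      using z' m by (intro mult_mono) (auto simp: d_def)
    also have "\<dots> = m / 2"
      by (simp add: field_simps add_pos_nonneg)
    finally have "cmod (g s z' - g s z) \<le> m / 2"
      using 1 by linarith
    moreover have "m \<le> cmod (a s)"
      using s0(2)[OF s] by (simp add: m_def)
    moreover have "cmod (a s) \<le> cmod (g s z' - of_real (X s)) + cmod (g s z' - g s z)"
      using norm_triangle_ineq4[of "g s z' - of_real (X s)" "g s z' - g s z"] by (simp add: a_def)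
    ultimately show "m / 2 \<le> cmod (g s z' - of_real (X s))"
      by linarith
  qed
  \<comment> \<open>Lipschitz constant of the integrand in \<open>z'\<close>: near \<open>z\<close>
    the moving denominator is at least \<open>m / 2\<close> and the two fixed ones at least
    \<open>m\<close>, while \<open>g s z'\<close> moves by at most
    \<open>\<bar>K\<bar> * cmod (z' - z)\<close>.\<close>
  define C where "C = 2 * \<bar>K\<bar> / (m / 2 * m * m)"
  have inI: "(\<lambda>s. - 2 / ((g s z' - of_real (X s)) * a s)) integrable_on {0..t}"
    if z': "cmod (z' - z) < d" for z'
  proof (rule integrable_continuous_real)
    have "z' \<in> U"
      using z' \<epsilon>(2) by (auto simp: d_def dist_norm norm_minus_commute)
    note G' = loewner_solutionD[OF alive[OF this]]
    show "continuous_on {0..t} (\<lambda>s. - 2 / ((g s z' - of_real (X s)) * a s))"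
      using G'(2) G(2) by (intro continuous_intros G'(4) conta X) (auto simp: a_def)
  qed
  have I_close: "cmod (I z' - I z) \<le> t * C * cmod (z' - z)" if z': "cmod (z' - z) < d" for z'
  proof -
    have "I z' - I z = integral {0..t} (\<lambda>s. - 2 / ((g s z' - of_real (X s)) * a s)
        - (- 2 / ((g s z - of_real (X s)) * a s)))"
      unfolding I_def using inI[OF z'] inI[of z] d
      by (subst Henstock_Kurzweil_Integration.integral_diff) auto
    also have "cmod \<dots> \<le> integral {0..t} (\<lambda>s. C * cmod (z' - z))"
    proof (rule integral_norm_bound_integral)
      show "(\<lambda>s. - 2 / ((g s z' - of_real (X s)) * a s)
        - (- 2 / ((g s z - of_real (X s)) * a s))) integrable_on {0..t}"
        using inI[OF z'] inI[of z] d by (intro integrable_diff) auto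
      fix s assume s: "s \<in> {0..t}"
      define b where "b = g s z' - of_real (X s)"
      have b: "m / 2 \<le> cmod b" "m \<le> cmod (a s)"
        using close(2)[OF z' s] s0(2)[OF s] by (auto simp: b_def m_def)
      then have nz: "b \<noteq> 0" "a s \<noteq> 0"
        using m by auto
      have "- 2 / (b * a s) - (- 2 / (a s * a s)) = 2 * (b - a s) / (b * a s * a s)"
        using nz by (simp add: divide_simps)
      also have "cmod \<dots> = 2 * cmod (b - a s) / (cmod b * cmod (a s) * cmod (a s))"
        by (simp only: norm_mult norm_divide) simp
      also have "\<dots> \<le> 2 * (\<bar>K\<bar> * cmod (z' - z)) / (m / 2 * m * m)"
      proof (rule frac_le)
        show "2 * cmod (b - a s) \<le> 2 * (\<bar>K\<bar> * cmod (z' - z))"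
          using close(1)[OF z' s] by (simp add: b_def a_def)
        show "0 < m / 2 * m * m"
          using m by simp
        show "m / 2 * m * m \<le> cmod b * cmod (a s) * cmod (a s)"
          using m b by (intro mult_mono) auto
      qed auto
      also have "\<dots> = C * cmod (z' - z)"
        by (simp add: C_def)
      finally show "cmod (- 2 / ((g s z' - of_real (X s)) * a s)
        - (- 2 / ((g s z - of_real (X s)) * a s))) \<le> C * cmod (z' - z)"
        by (simp add: b_def a_def)
    qed auto
    also have "\<dots> = t * C * cmod (z' - z)"
      using t by simp
    finally show ?thesis .
  qed
  have "((\<lambda>z'. I z' - I z) \<longlongrightarrow> 0) (at z)"
  proof (rule Lim_null_comparison)
    show "\<forall>\<^sub>F z' in at z. cmod (I z' - I z) \<le> t * C * cmod (z' - z)"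
      using I_close d by (auto simp: eventually_at dist_norm)
    have "((\<lambda>z'. t * C * cmod (z' - z)) \<longlongrightarrow> t * C * cmod (z - z)) (at z)"
      by (intro tendsto_intros)
    then show "((\<lambda>z'. t * C * cmod (z' - z)) \<longlongrightarrow> 0) (at z)"
      by simp
  qed
  then have "(I \<longlongrightarrow> I z) (at z)"
    by (simp add: LIM_zero_iff)
  then have "((\<lambda>z'. exp (I z')) \<longlongrightarrow> exp (I z)) (at z)"
    by (intro tendsto_intros)
  moreover have "\<forall>\<^sub>F z' in at z. (g t z' - g t z) / (z' - z) = exp (I z')"
    unfolding eventually_at
  proof (intro exI conjI ballI impI)
    fix z' assume z': "z' \<noteq> z \<and> dist z' z < d"
    then have "z' \<in> U"
      using \<epsilon>(2) by (auto simp: d_def dist_commute)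
    then have "g t z' - g t z = (z' - z) * exp (I z')"
      unfolding I_def a_def using t by (intro loewner_difference[OF X alive alive] z) auto
    then show "(g t z' - g t z) / (z' - z) = exp (I z')"
      using z' by simp
  qed (use d in auto)
  ultimately have "((\<lambda>z'. (g t z' - g t z) / (z' - z)) \<longlongrightarrow> exp (I z)) (at z)"
    using tendsto_cong by fast
  then have "(g t has_field_derivative exp (I z)) (at z within U)"
    using has_field_derivative_iff has_field_derivative_at_within by blast
  then show "g t field_differentiable at z within U"
    using field_differentiable_def by blast
qed

text \<open>Schwarz lemma for \<open>(f - f q) / (f + f q)\<close>.\<close>

lemma schwarz_right_half_plane:
  fixes f :: "complex \<Rightarrow> complex"
  assumes hol: "f holomorphic_on ball q \<rho>" and pos: "\<And>z. z \<in> ball q \<rho> \<Longrightarrow> 0 < Re (f z)"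
    and real: "Im (f q) = 0" and z: "z \<in> ball q \<rho>"
  shows "cmod (f z) * (\<rho> - cmod (z - q)) \<le> cmod (f q) * (\<rho> + cmod (z - q))"
proof -
  have \<rho>: "0 < \<rho>"
    using z by (metis ball_eq_empty empty_iff not_less)
  define c where "c = Re (f q)"
  have c: "0 < c" "f q = of_real c"
    using pos[of q] \<rho> real by (auto simp: c_def complex_eq_iff)
  define h where "h w = (f (q + of_real \<rho> * w) - of_real c) / (f (q + of_real \<rho> * w) + of_real c)" for w
  have mem: "q + of_real \<rho> * w \<in> ball q \<rho>" if "cmod w < 1" for w
    using that \<rho> by (simp add: dist_norm norm_mult)
  have nz: "f (q + of_real \<rho> * w) + of_real c \<noteq> 0" if "cmod w < 1" for w
    using pos[OF mem[OF that]] c(1) by (auto simp: complex_eq_iff)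
  have holc: "(\<lambda>w. f (q + of_real \<rho> * w)) holomorphic_on ball 0 1"
    by (rule holomorphic_on_compose_gen[of "\<lambda>w. q + of_real \<rho> * w" _ f "ball q \<rho>", unfolded o_def])
      (use mem hol in \<open>auto intro!: holomorphic_intros\<close>)
  have hh: "h holomorphic_on ball 0 1"
    unfolding h_def [abs_def] using nz by (intro holomorphic_intros holc) auto
  have h0: "h 0 = 0"
    by (simp add: h_def c(2))
  have h1: "cmod (h w) < 1" if w: "cmod w < 1" for w
  proof -
    define F where "F = f (q + of_real \<rho> * w)"
    have "0 < Re F"
      using pos[OF mem[OF w]] by (simp add: F_def)
    then have "(cmod (F - of_real c))\<^sup>2 < (cmod (F + of_real c))\<^sup>2"
      using c(1) by (simp only: cmod_power2) (simp add: power2_eq_square algebra_simps)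
    then have "cmod (F - of_real c) < cmod (F + of_real c)"
      by (rule power_less_imp_less_base) simp
    then show ?thesis
      using nz[OF w] by (simp add: h_def F_def norm_divide)
  qed
  define w where "w = (z - q) / of_real \<rho>"
  have w: "cmod w < 1" "q + of_real \<rho> * w = z" "cmod w = cmod (z - q) / \<rho>"
    using z \<rho> by (auto simp: w_def norm_divide dist_norm norm_minus_commute)
  have "cmod (h w) \<le> cmod w"
    by (rule Schwarz_Lemma(1)[OF hh h0 h1 w(1)])
  then have "cmod (f z - of_real c) / cmod (f z + of_real c) \<le> cmod (z - q) / \<rho>"
    using w by (simp add: h_def norm_divide)
  moreover have "0 < cmod (f z + of_real c)"
    using nz[OF w(1)] w(2) by simp
  ultimately have 1: "\<rho> * cmod (f z - of_real c) \<le> cmod (z - q) * cmod (f z + of_real c)"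
    using \<rho> by (simp add: field_simps)
  have "\<rho> * (cmod (f z) - c) \<le> \<rho> * cmod (f z - of_real c)"
    using norm_triangle_ineq2[of "f z" "of_real c"] \<rho> c(1) by (intro mult_left_mono) auto
  moreover have "cmod (z - q) * cmod (f z + of_real c) \<le> cmod (z - q) * (cmod (f z) + c)"
    using norm_triangle_ineq[of "f z" "of_real c"] c(1) by (intro mult_left_mono) auto
  ultimately have "\<rho> * (cmod (f z) - c) \<le> cmod (z - q) * (cmod (f z) + c)"
    using 1 by linarith
  then show ?thesis
    using c by (simp add: algebra_simps)
qed

text \<open>Along the flow the point \<open>q + i \<eta>\<close> stays above height \<open>1\<close>, hence away from the driving
  point; a branch of \<open>sqrt (g t - X t)\<close> maps the disc to a half-plane and carries this over to
  \<open>q\<close> by the Schwarz lemma.\<close>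

lemma loewner_real_point_far:
  assumes X: "continuous_on {0..t} X" and t: "0 \<le> t" "t \<le> S" and \<rho>: "0 < \<rho>"
    and big: "4 * S + 1 < \<rho>\<^sup>2"
    and alive: "\<And>z. z \<in> ball (of_real q) \<rho> \<Longrightarrow> loewner_solution X t z (\<lambda>s. g s z)"
  shows "((\<rho> - sqrt (4 * S + 1)) / (\<rho> + sqrt (4 * S + 1)))\<^sup>2 \<le> cmod (g t (of_real q) - of_real (X t))"
proof -
  \<comment> \<open>The squared height drops by at most 4 per unit of time, so a point of this
    height is still at height at least 1 at any time up to \<open>S\<close>.\<close>
  define \<eta> where "\<eta> = sqrt (4 * S + 1)"
  have \<eta>: "0 < \<eta>" "\<eta> < \<rho>" "\<eta>\<^sup>2 = 4 * S + 1"
  proof -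
    show "0 < \<eta>" "\<eta>\<^sup>2 = 4 * S + 1"
      using t by (auto simp: \<eta>_def)
    then show "\<eta> < \<rho>"
      using big \<rho> by (intro power_less_imp_less_base[of \<eta> 2 \<rho>]) auto
  qed
  have tt: "t \<in> {0..t}" "0 \<in> {0..t}"
    using t by auto
  have notX0: "of_real (X 0) \<notin> ball (complex_of_real q) \<rho>"
    using loewner_solutionD(1,2)[OF alive] tt by metis
  \<comment> \<open>\<open>csqrt\<close> has its cut on the nonpositive reals. The sign turns the
    image of the disc so that its real points, which all lie on one side of the driving point,
    become positive and the cut is avoided.\<close>
  define sg where "sg = sgn (q - X 0)"
  have qX: "\<rho> \<le> \<bar>q - X 0\<bar>"
    using notX0 by (simp add: dist_norm flip: of_real_diff)
  then have sg: "sg = 1 \<or> sg = - 1"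
    using \<rho> by (auto simp: sg_def sgn_if)
  define w where "w z = of_real sg * (g t z - of_real (X t))" for z
  have wn: "w z \<notin> \<real>\<^sub>\<le>\<^sub>0" if z: "z \<in> ball (of_real q) \<rho>" for z
  proof (cases "Im z = 0")
    case True
    then have zr: "z = of_real (Re z)"
      by (simp add: complex_eq_iff)
    have "\<bar>Re z - q\<bar> < \<rho>"
      using z zr by (metis dist_commute dist_norm dist_of_real mem_ball real_norm_def)
    then have "0 < sg * (Re z - X 0)"
      using qX \<rho> by (auto simp: sg_def sgn_if abs_if split: if_splits)
    moreover have "0 < (Re (g t z) - X t) * (Re z - X 0)"
      using loewner_real(2)[OF X _ tt(1), of "Re z" "\<lambda>s. g s z"] alive[OF z] zr by simp
    ultimately have "0 < sg * (Re (g t z) - X t)"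
      using sg by (auto simp: zero_less_mult_iff)
    then show ?thesis
      using sg by (auto simp: w_def complex_nonpos_Reals_iff)
  next
    case False
    have "Im (g t z) \<noteq> 0"
      using loewner_Im[OF X alive[OF z] tt(1)] False by simp
    then show ?thesis
      using sg by (auto simp: w_def complex_nonpos_Reals_iff)
  qed
  have holw: "w holomorphic_on ball (of_real q) \<rho>"
    unfolding w_def [abs_def]
    by (intro holomorphic_intros loewner_map_holomorphic[OF X t(1) _ alive]) auto
  define f where "f z = csqrt (w z)" for z
  have holf: "f holomorphic_on ball (of_real q) \<rho>"
    unfolding f_def [abs_def] by (rule holomorphic_on_csqrt'[OF holw wn])
  have posf: "0 < Re (f z)" if "z \<in> ball (of_real q) \<rho>" for z
  proof -
    have "Re (f z) \<noteq> 0"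
    proof
      assume "Re (f z) = 0"
      moreover have "w z = (f z)\<^sup>2"
        by (simp add: f_def)
      ultimately have "w z = of_real (- (Im (f z))\<^sup>2)"
        by (simp add: complex_eq_iff power2_eq_square)
      then show False
        using wn[OF that] by (metis complex_nonpos_Reals_iff Im_complex_of_real Re_complex_of_real
            neg_le_0_iff_le zero_le_power2)
    qed
    then show ?thesis
      using Re_csqrt[of "w z"] by (simp add: f_def)
  qed
  have qin: "of_real q \<in> ball (complex_of_real q) \<rho>"
    using \<rho> by simp
  have "Im (g t (of_real q)) = 0"
    by (rule loewner_real(1)[OF X alive[OF qin] tt(1)])
  then have "Im (w (of_real q)) = 0"
    by (simp add: w_def)
  then have imf: "Im (f (of_real q)) = 0"
    using wn[OF qin] by (simp add: f_def csqrt.sel complex_nonpos_Reals_iff cmod_eq_Re)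
  define z0 where "z0 = Complex q \<eta>"
  have z0d: "cmod (z0 - of_real q) = \<eta>"
    using \<eta>(1) by (simp add: z0_def cmod_def)
  then have z0: "z0 \<in> ball (of_real q) \<rho>"
    using \<eta>(2) by (simp add: dist_norm norm_minus_commute)
  have "cmod (f z0) * (\<rho> - cmod (z0 - of_real q)) \<le> cmod (f (of_real q)) * (\<rho> + cmod (z0 - of_real q))"
    by (rule schwarz_right_half_plane[OF holf posf imf z0])
  then have main: "cmod (f z0) * (\<rho> - \<eta>) \<le> cmod (f (of_real q)) * (\<rho> + \<eta>)"
    by (simp add: z0d)
  have fsq: "(cmod (f z))\<^sup>2 = cmod (g t z - of_real (X t))" for z
  proof -
    have "(cmod (f z))\<^sup>2 = cmod ((f z)\<^sup>2)"
      by (simp add: norm_power)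
    then show ?thesis
      using sg by (auto simp: f_def w_def norm_mult)
  qed
  have "\<eta>\<^sup>2 - 4 * t \<le> (Im (g t z0))\<^sup>2"
    using loewner_Im_lower_bound[OF alive[OF z0] tt(1)] by (simp add: z0_def)
  then have "1 \<le> (Im (g t z0))\<^sup>2"
    using \<eta>(3) t(2) by linarith
  then have "1 \<le> \<bar>Im (g t z0 - of_real (X t))\<bar>"
    using abs_le_square_iff[of 1 "Im (g t z0)"] by simp
  then have "1 \<le> (cmod (f z0))\<^sup>2"
    using abs_Im_le_cmod[of "g t z0 - of_real (X t)"] unfolding fsq by linarith
  then have "1 \<le> cmod (f z0)"
    using abs_le_square_iff[of 1 "cmod (f z0)"] by simp
  then have "1 * (\<rho> - \<eta>) \<le> cmod (f z0) * (\<rho> - \<eta>)"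
    using \<eta> by (intro mult_right_mono) auto
  from order_trans[OF this main] have "\<rho> - \<eta> \<le> cmod (f (of_real q)) * (\<rho> + \<eta>)"
    by simp
  then have "(\<rho> - \<eta>) / (\<rho> + \<eta>) \<le> cmod (f (of_real q))"
    using \<eta> by (simp add: field_simps)
  then have "((\<rho> - \<eta>) / (\<rho> + \<eta>))\<^sup>2 \<le> (cmod (f (of_real q)))\<^sup>2"
    using \<eta> by (intro power_mono) auto
  then show ?thesis
    unfolding fsq \<eta>_def .
qed

text \<open>Two real points, one on each side of the driving point, stay at distance at least
  \<open>\<delta>\<close> from it, so they move with speed at most \<open>2 / \<delta>\<close>. The
  driving point remains trapped between them.\<close>

lemma driving_bounded:
  assumes S: "0 < S" and X: "continuous_on {0..<S} X" and \<rho>: "0 < \<rho>" "4 * S + 1 < \<rho>\<^sup>2"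
    and q: "q1 < X 0" "X 0 < q2"
    and alive: "\<And>t z. \<lbrakk>0 \<le> t; t < S; z \<in> ball (of_real q1) \<rho> \<union> ball (of_real q2) \<rho>\<rbrakk>
      \<Longrightarrow> loewner_solution X t z (\<lambda>s. g s z)"
  obtains M where "\<And>t. t \<in> {0..<S} \<Longrightarrow> \<bar>X t\<bar> \<le> M"
proof -
  define \<delta> where "\<delta> = ((\<rho> - sqrt (4 * S + 1)) / (\<rho> + sqrt (4 * S + 1)))\<^sup>2"
  have "sqrt (4 * S + 1) < \<rho>"
    using \<rho> by (simp add: real_less_lsqrt)
  moreover have "0 < sqrt (4 * S + 1)"
    using S by simp
  ultimately have "0 < (\<rho> - sqrt (4 * S + 1)) / (\<rho> + sqrt (4 * S + 1))"
    using \<rho>(1) by (intro divide_pos_pos) linarith+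
  then have \<delta>: "\<delta> > 0"
    unfolding \<delta>_def by (rule zero_less_power)
  have contX: "continuous_on {0..t} X" if "t < S" for t
    by (rule continuous_on_subset[OF X]) (use that in auto)
  have bound: "\<bar>Re (g t (of_real q)) - q\<bar> \<le> 2 / \<delta> * S" "Im (g t (of_real q)) = 0"
      "0 < (Re (g t (of_real q)) - X t) * (q - X 0)"
    if q: "q = q1 \<or> q = q2" and t: "t \<in> {0..<S}" for q t
  proof -
    have al: "loewner_solution X s z (\<lambda>s. g s z)" if "0 \<le> s" "s < S" "z \<in> ball (of_real q) \<rho>" for s z
      using alive that q by blast
    have qin: "of_real q \<in> ball (complex_of_real q) \<rho>"
      using \<rho> by simp
    have t': "0 \<le> t" "t < S"
      using t by auto
    note D = loewner_solutionD[OF al[OF t' qin]]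
    have far: "\<delta> \<le> cmod (g s (of_real q) - of_real (X s))" if s: "s \<in> {0..t}" for s
      unfolding \<delta>_def
    proof (rule loewner_real_point_far[OF contX _ _ \<rho>])
      show "loewner_solution X s z (\<lambda>s. g s z)" if "z \<in> ball (of_real q) \<rho>" for z
        by (rule al[OF _ _ that]) (use s t' in simp_all)
    qed (use s t' in simp_all)
    have "norm (g t (of_real q) - g 0 (of_real q)) \<le> 2 / \<delta> * \<bar>t - 0\<bar>"
    proof (rule vector_lipschitz[where I = "{0..t}" and f = "\<lambda>s. g s (of_real q)"])
      fix s assume s: "s \<in> {0..t}"
      show "((\<lambda>s. g s (of_real q)) has_vector_derivative 2 / (g s (of_real q) - of_real (X s))) (at s within {0..t})"
        using D(3)[OF s] .
      show "cmod (2 / (g s (of_real q) - of_real (X s))) \<le> 2 / \<delta>"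
        using far[OF s] \<delta> by (simp add: norm_divide frac_le)
    qed (use t in auto)
    also have "\<dots> \<le> 2 / \<delta> * S"
      using t \<delta> by (intro mult_left_mono) auto
    finally have "norm (g t (of_real q) - of_real q) \<le> 2 / \<delta> * S"
      using D(1) by simp
    then show "\<bar>Re (g t (of_real q)) - q\<bar> \<le> 2 / \<delta> * S"
      using abs_Re_le_cmod[of "g t (of_real q) - of_real q"] by simp
    show "Im (g t (of_real q)) = 0" "0 < (Re (g t (of_real q)) - X t) * (q - X 0)"
      using loewner_real[OF contX[OF t'(2)] al[OF t' qin], of t] t' by simp_all
  qed
  show thesis
  proof (rule that)
    fix t assume t: "t \<in> {0..<S}"
    have "Re (g t (of_real q1)) < X t" "X t < Re (g t (of_real q2))"
      using bound(3)[of q1 t] bound(3)[of q2 t] t q by (auto simp: zero_less_mult_iff)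
    then show "\<bar>X t\<bar> \<le> \<bar>q1\<bar> + \<bar>q2\<bar> + 2 / \<delta> * S"
      using bound(1)[of q1 t] bound(1)[of q2 t] t by auto
  qed
qed

section \<open>The driving function at the end of its lifetime\<close>

text \<open>A bounded function without a limit has a cluster value \<open>L\<close> and also
  deviates from \<open>L\<close> by some \<open>e\<close>, always on one and the same side, at times
  arbitrarily close to \<open>S\<close>. The intermediate value theorem then yields every value
  between the two levels, again at times tending to \<open>S\<close>.\<close>

lemma not_convergent_at_left_oscillates:
  fixes f :: "real \<Rightarrow> real"
  assumes S: "0 < S" and cont: "continuous_on {0..<S} f"
    and M: "\<And>t. t \<in> {0..<S} \<Longrightarrow> \<bar>f t\<bar> \<le> M" and div: "\<nexists>L. (f \<longlongrightarrow> L) (at_left S)"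
  obtains a b where "a < b" "\<And>c. \<lbrakk>a < c; c < b\<rbrakk> \<Longrightarrow>
    \<exists>\<tau>::nat \<Rightarrow> real. (\<forall>n. \<tau> n \<in> {0..<S}) \<and> \<tau> \<longlonglongrightarrow> S \<and> (\<forall>n. f (\<tau> n) = c)"
proof -
  \<comment> \<open>\<open>F P\<close> says that \<open>P (f t)\<close> holds for times
    \<open>t\<close> arbitrarily close to \<open>S\<close> from the left, the frequently-quantifier
    of \<open>at_left S\<close> restricted to nonnegative times.\<close>
  define F where "F P \<longleftrightarrow> (\<forall>r<S. \<exists>t. r < t \<and> t < S \<and> 0 \<le> t \<and> P (f t))" for P
  define \<sigma> where "\<sigma> n = S - S / real (n + 2)" for n
  have \<sigma>: "\<sigma> n \<in> {0..<S}" for n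
    using S by (auto simp: \<sigma>_def field_simps)
  have "(\<lambda>n. S - S / real (n + 2)) \<longlonglongrightarrow> S - 0"
    by (intro tendsto_diff tendsto_const LIMSEQ_ignore_initial_segment lim_const_over_n)
  then have \<sigma>lim: "\<sigma> \<longlonglongrightarrow> S"
    by (simp add: \<sigma>_def [abs_def])
  have "bounded (range (\<lambda>n. f (\<sigma> n)))"
    unfolding bounded_iff using M \<sigma> by auto
  then obtain L r where r: "strict_mono r" "((\<lambda>n. f (\<sigma> n)) \<circ> r) \<longlonglongrightarrow> L"
    using bounded_imp_convergent_subsequence by blast
  from div have "\<not> (f \<longlongrightarrow> L) (at_left S)"
    by blast
  then obtain e where e: "e > 0" "\<not> (\<forall>\<^sub>F t in at_left S. dist (f t) L < e)"
    by (auto simp: tendsto_iff)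
  have near: "F (\<lambda>y. \<bar>y - L\<bar> < e / 2)"
    unfolding F_def
  proof (intro allI impI)
    fix s assume s: "s < S"
    have "\<forall>\<^sub>F n in sequentially. dist (f (\<sigma> (r n))) L < e / 2"
      using tendstoD[OF r(2), of "e / 2"] e(1) by simp
    moreover have "(\<lambda>n. \<sigma> (r n)) \<longlonglongrightarrow> S"
      using LIMSEQ_subseq_LIMSEQ[OF \<sigma>lim r(1)] by (simp add: o_def)
    then have "\<forall>\<^sub>F n in sequentially. s < \<sigma> (r n)"
      using s by (rule order_tendstoD)
    ultimately have "\<forall>\<^sub>F n in sequentially. dist (f (\<sigma> (r n))) L < e / 2 \<and> s < \<sigma> (r n)"
      by (rule eventually_conj)
    then obtain n where "dist (f (\<sigma> (r n))) L < e / 2" "s < \<sigma> (r n)"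
      by (auto simp: eventually_sequentially)
    then show "\<exists>t>s. t < S \<and> 0 \<le> t \<and> \<bar>f t - L\<bar> < e / 2"
      using \<sigma>[of "r n"] by (intro exI[of _ "\<sigma> (r n)"]) (auto simp: dist_real_def)
  qed
  have far: "F (\<lambda>y. e \<le> \<bar>y - L\<bar>)"
    unfolding F_def
  proof (intro allI impI)
    fix s assume s: "s < S"
    have "\<not> (\<exists>b<S. \<forall>t>b. t < S \<longrightarrow> dist (f t) L < e)"
      using e(2) eventually_at_left[of 0 S] S by simp
    then have "\<not> (\<forall>t>max s 0. t < S \<longrightarrow> dist (f t) L < e)"
      using s S by (metis max_less_iff_conj)
    then show "\<exists>t>s. t < S \<and> 0 \<le> t \<and> e \<le> \<bar>f t - L\<bar>"
      by (auto simp: dist_real_def not_less)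
  qed
  have mono: "F P \<Longrightarrow> (\<And>y. P y \<Longrightarrow> Q y) \<Longrightarrow> F Q" for P Q
    unfolding F_def by blast
  have "F (\<lambda>y. L + e \<le> y) \<or> F (\<lambda>y. y \<le> L - e)"
  proof (rule ccontr)
    assume "\<not> ?thesis"
    then obtain r1 r2 where r12: "r1 < S" "\<And>t. \<lbrakk>r1 < t; t < S; 0 \<le> t\<rbrakk> \<Longrightarrow> f t < L + e"
      "r2 < S" "\<And>t. \<lbrakk>r2 < t; t < S; 0 \<le> t\<rbrakk> \<Longrightarrow> L - e < f t"
      unfolding F_def by (metis not_le)
    then obtain t where "max r1 r2 < t" "t < S" "0 \<le> t" "e \<le> \<bar>f t - L\<bar>"
      using far unfolding F_def by (metis max_less_iff_conj)
    then show False
      using r12(2)[of t] r12(4)[of t] by auto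
  qed
  then obtain a b where ab: "a < b" "F (\<lambda>y. y \<le> a)" "F (\<lambda>y. b \<le> y)"
  proof
    assume "F (\<lambda>y. L + e \<le> y)"
    moreover have "F (\<lambda>y. y \<le> L + e / 2)"
      by (rule mono[OF near]) (auto simp: abs_if split: if_splits)
    ultimately show thesis
      using that[of "L + e / 2" "L + e"] e(1) by simp
  next
    assume "F (\<lambda>y. y \<le> L - e)"
    moreover have "F (\<lambda>y. L - e / 2 \<le> y)"
      by (rule mono[OF near]) (auto simp: abs_if split: if_splits)
    ultimately show thesis
      using that[of "L - e" "L - e / 2"] e(1) by simp
  qed
  show thesis
  proof (rule that[OF ab(1)])
    fix c assume c: "a < c" "c < b"
    have hit: "\<exists>t. r < t \<and> t \<in> {0..<S} \<and> f t = c" if r: "r < S" for r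
    proof -
      define I where "I = {max r 0..<S}"
      obtain t1 where t1: "max r 0 < t1" "t1 < S" "f t1 \<le> a"
        using ab(2) r S unfolding F_def by (metis max_less_iff_conj)
      obtain t2 where t2: "max r 0 < t2" "t2 < S" "b \<le> f t2"
        using ab(3) r S unfolding F_def by (metis max_less_iff_conj)
      have "connected (f ` {max r 0<..<S})"
        by (intro connected_continuous_image continuous_on_subset[OF cont]) auto
      moreover have "f t1 \<in> f ` {max r 0<..<S}" "f t2 \<in> f ` {max r 0<..<S}"
        using t1 t2 by auto
      ultimately have "c \<in> f ` {max r 0<..<S}"
        by (rule connectedD_interval) (use t1 t2 c in linarith)+
      then show ?thesis
        by auto
    qed
    have "\<forall>n. \<exists>t. S - 1 / real (Suc n) < t \<and> t \<in> {0..<S} \<and> f t = c"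
      by (intro allI hit) simp
    then obtain \<tau> where \<tau>: "\<And>n. S - 1 / real (Suc n) < \<tau> n" "\<And>n. \<tau> n \<in> {0..<S}" "\<And>n. f (\<tau> n) = c"
      by metis
    have "\<tau> \<longlonglongrightarrow> S"
    proof (rule tendsto_sandwich)
      have "(\<lambda>n. S - 1 / real (Suc n)) \<longlonglongrightarrow> S - 0"
        by (intro tendsto_diff tendsto_const LIMSEQ_Suc lim_const_over_n)
      then show "(\<lambda>n. S - 1 / real (Suc n)) \<longlonglongrightarrow> S"
        by simp
      show "\<forall>\<^sub>F n in sequentially. S - 1 / real (Suc n) \<le> \<tau> n" "\<forall>\<^sub>F n in sequentially. \<tau> n \<le> S"
        using \<tau>(1,2) by (auto intro!: always_eventually less_imp_le)
    qed simp
    then show "\<exists>\<tau>::nat \<Rightarrow> real. (\<forall>n. \<tau> n \<in> {0..<S}) \<and> \<tau> \<longlonglongrightarrow> S \<and> (\<forall>n. f (\<tau> n) = c)"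
      using \<tau> by blast
  qed
qed

section \<open>Compactness and uniform bounds up to the final time\<close>

lemma joint_convergent_subsequence:
  fixes h :: "'b \<Rightarrow> nat \<Rightarrow> 'a::heine_borel"
  assumes "finite W" "\<And>w. w \<in> W \<Longrightarrow> bounded (range (h w))"
  obtains r l where "strict_mono (r::nat \<Rightarrow> nat)" "\<And>w. w \<in> W \<Longrightarrow> (\<lambda>n. h w (r n)) \<longlonglongrightarrow> l w"
proof -
  have "\<exists>r. strict_mono (r::nat \<Rightarrow> nat) \<and> (\<forall>w\<in>W. \<exists>l. (\<lambda>n. h w (r n)) \<longlonglongrightarrow> l)"
    using assms
  proof (induction rule: finite_induct)
    case empty
    show ?case
      using strict_mono_id by auto
  next
    case (insert x W)
    then obtain r where r: "strict_mono (r::nat \<Rightarrow> nat)" "\<And>w. w \<in> W \<Longrightarrow> \<exists>l. (\<lambda>n. h w (r n)) \<longlonglongrightarrow> l"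
      by auto
    have "bounded (range (\<lambda>n. h x (r n)))"
      by (rule bounded_subset[OF insert.prems[of x]]) auto
    then obtain l r' where r': "strict_mono r'" "((\<lambda>n. h x (r n)) \<circ> r') \<longlonglongrightarrow> l"
      using bounded_imp_convergent_subsequence by blast
    have "\<exists>l. (\<lambda>n. h w ((r \<circ> r') n)) \<longlonglongrightarrow> l" if "w \<in> insert x W" for w
    proof (cases "w = x")
      case True
      then show ?thesis
        using r'(2) by (auto simp: o_def)
    next
      case False
      then have "w \<in> W"
        using that by simp
      then obtain l where "(\<lambda>n. h w (r n)) \<longlonglongrightarrow> l"
        using r(2) by blast
      then have "((\<lambda>n. h w (r n)) \<circ> r') \<longlonglongrightarrow> l"
        using LIMSEQ_subseq_LIMSEQ r'(1) by blast
      then show ?thesis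
        by (auto simp: o_def)
    qed
    then show ?case
      using strict_mono_o[OF r(1) r'(1)] by blast
  qed
  then show thesis
    using that by metis
qed

text \<open>Outside the disc of radius \<open>M + 1\<close> the point is at distance at least 1 from
  the driving point, so its speed is at most 2 and hence at most twice its modulus. The barrier is
  applied to minus the squared modulus with weight \<open>exp (- (4 * s))\<close>.\<close>

lemma loewner_flow_bounded:
  assumes sol: "loewner_solution X t z u" and M: "\<And>s. s \<in> {0..t} \<Longrightarrow> \<bar>X s\<bar> \<le> M" and s: "s \<in> {0..t}"
  shows "cmod (u s) \<le> max (cmod z) (M + 1) * exp (2 * s)"
proof -
  note U = loewner_solutionD[OF sol]
  define K where "K = max (cmod z) (M + 1)"
  define f where "f s = - ((u s \<bullet> u s) * exp (- (4 * s)))" for s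
  define f' where "f' r = (4 * (u r \<bullet> u r) - 2 * (u r \<bullet> (2 / (u r - of_real (X r))))) * exp (- (4 * r))" for r
  have "\<bar>X 0\<bar> \<le> M"
    using M s by auto
  then have K: "0 \<le> K" "M + 1 \<le> K" "1 \<le> K" "cmod z \<le> K"
    by (auto simp: K_def)
  have "- K\<^sup>2 \<le> f s"
  proof (rule barrier[where f = f and f' = f' and t = t and ?s1.0 = s])
    fix r assume r: "r \<in> {0..t}"
    note D = U(3)[OF r, unfolded has_vector_derivative_def]
    have *: "((\<lambda>s. u s \<bullet> u s) has_real_derivative 2 * (u r \<bullet> (2 / (u r - of_real (X r))))) (at r within {0..t})"
      using has_derivative_inner[OF D D]
      unfolding has_field_derivative_def
      by (rule has_derivative_eq_rhs) (auto simp: inner_commute algebra_simps)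
    have "(f has_real_derivative f' r) (at r within {0..t})"
      unfolding f_def [abs_def] f'_def
      by (auto intro!: derivative_eq_intros * simp: algebra_simps)
    then show "(f has_vector_derivative f' r) (at r within {0..t})"
      by (simp add: has_real_derivative_iff_has_vector_derivative)
    assume "f r < - K\<^sup>2"
    then have "K\<^sup>2 < (cmod (u r))\<^sup>2 * exp (- (4 * r))"
      by (simp add: f_def power2_norm_eq_inner)
    also have "\<dots> \<le> (cmod (u r))\<^sup>2"
      using r by (intro mult_left_le) auto
    finally have uK: "K < cmod (u r)"
      by (rule power_less_imp_less_base) simp
    have "\<bar>X r\<bar> \<le> M"
      using M r by auto
    then have "1 \<le> cmod (u r - of_real (X r))"
      using norm_triangle_ineq2[of "u r" "of_real (X r)"] uK K by simp
    then have "cmod (2 / (u r - of_real (X r))) \<le> 2"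
      by (simp add: norm_divide divide_le_eq)
    then have "u r \<bullet> (2 / (u r - of_real (X r))) \<le> cmod (u r) * 2"
      using norm_cauchy_schwarz[of "u r" "2 / (u r - of_real (X r))"]
      by (meson mult_left_mono norm_ge_zero order_trans)
    moreover have "cmod (u r) * 1 \<le> cmod (u r) * cmod (u r)"
      using uK K by (intro mult_left_mono) auto
    ultimately have "0 \<le> 4 * (u r \<bullet> u r) - 2 * (u r \<bullet> (2 / (u r - of_real (X r))))"
      by (simp add: power2_norm_eq_inner[symmetric] power2_eq_square)
    then show "0 \<le> f' r"
      by (simp add: f'_def)
  next
    show "- K\<^sup>2 \<le> f 0"
      using K by (simp add: f_def U(1) power2_norm_eq_inner[symmetric] power_mono)
  qed (use s in auto)
  then have "(cmod (u s))\<^sup>2 * exp (- (4 * s)) \<le> K\<^sup>2"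
    by (simp add: f_def power2_norm_eq_inner)
  then have "(cmod (u s))\<^sup>2 \<le> K\<^sup>2 * exp (4 * s)"
    by (simp add: exp_minus field_simps)
  also have "\<dots> = (K * exp (2 * s))\<^sup>2"
    by (simp add: power_mult_distrib mult_exp_exp power2_eq_square)
  finally show ?thesis
    unfolding K_def[symmetric] by (rule power2_le_imp_le) (use K in auto)
qed

lemma poly_lipschitz_on_cball:
  fixes q :: "complex poly"
  obtains L where "0 \<le> L"
    "\<And>x y. \<lbrakk>cmod x \<le> B; cmod y \<le> B\<rbrakk> \<Longrightarrow> cmod (poly q x - poly q y) \<le> L * cmod (x - y)"
proof -
  have "bounded (poly (pderiv q) ` cball 0 B)"
    by (intro compact_imp_bounded compact_continuous_image continuous_intros) auto
  then obtain L where L: "\<And>z. z \<in> cball 0 B \<Longrightarrow> cmod (poly (pderiv q) z) \<le> L"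
    by (force simp: bounded_iff)
  have "cmod (poly q x - poly q y) \<le> \<bar>L\<bar> * cmod (x - y)" if "cmod x \<le> B" "cmod y \<le> B" for x y
  proof (rule field_differentiable_bound[where S = "cball 0 B" and f' = "poly (pderiv q)"])
    show "(poly q has_field_derivative poly (pderiv q) z) (at z within cball 0 B)" for z
      by (rule has_field_derivative_at_within[OF poly_DERIV])
    show "cmod (poly (pderiv q) z) \<le> \<bar>L\<bar>" if "z \<in> cball 0 B" for z
      using L[OF that] by simp
  qed (use that in auto)
  then show thesis
    using that[of "\<bar>L\<bar>"] by auto
qed

lemma nonneg_deriv_mono:
  fixes f :: "real \<Rightarrow> real"
  assumes deriv: "\<And>s. s \<in> {0..<S} \<Longrightarrow> (f has_vector_derivative f' s) (at s within {0..})"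
    and nonneg: "\<And>s. s \<in> {0..<S} \<Longrightarrow> 0 \<le> f' s" and xy: "0 \<le> x" "x \<le> y" "y < S"
  shows "f x \<le> f y"
proof (cases "x = y")
  case False
  then have lt: "x < y"
    using xy by simp
  have "\<exists>r\<in>{x<..<y}. f y - f x = (\<lambda>h. h *\<^sub>R f' r) (y - x)"
  proof (rule mvt_simple[OF lt])
    fix r assume "x \<le> r" "r \<le> y"
    then have "(f has_vector_derivative f' r) (at r within {x..y})"
      using xy by (intro has_vector_derivative_within_subset[OF deriv]) auto
    then show "(f has_derivative (\<lambda>h. h *\<^sub>R f' r)) (at r within {x..y})"
      by (simp add: has_vector_derivative_def)
  qed
  then obtain r where r: "x < r" "r < y" "f y - f x = (y - x) * f' r"
    by auto
  have "0 \<le> (y - x) * f' r"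
    using nonneg[of r] r xy by (intro mult_nonneg_nonneg) auto
  then show ?thesis
    using r(3) by simp
qed simp

lemma mono_bounded_tendsto_at_left:
  fixes f :: "real \<Rightarrow> real"
  assumes S: "0 < S" and mono: "\<And>x y. \<lbrakk>0 \<le> x; x \<le> y; y < S\<rbrakk> \<Longrightarrow> f x \<le> f y"
    and M: "\<And>t. t \<in> {0..<S} \<Longrightarrow> f t \<le> M"
  obtains l where "(f \<longlongrightarrow> l) (at_left S)"
proof -
  have bdd: "bdd_above (f ` {0..<S})"
    using M by (rule bdd_aboveI2)
  have ev: "\<forall>\<^sub>F t in at_left S. 0 < t \<and> t < S"
    unfolding eventually_at_left[OF S] using S by blast
  have "(f \<longlongrightarrow> Sup (f ` {0..<S})) (at_left S)"
  proof (rule increasing_tendsto)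
    show "\<forall>\<^sub>F t in at_left S. f t \<le> Sup (f ` {0..<S})"
      using ev by eventually_elim (use bdd in \<open>auto intro!: cSup_upper\<close>)
    fix x assume "x < Sup (f ` {0..<S})"
    then obtain t where t: "0 \<le> t" "t < S" "x < f t"
      using less_cSup_iff[of "f ` {0..<S}" x] bdd S by auto
    have "x < f s" if "t < s" "s < S" for s
      using mono[of t s] t that by simp
    then show "\<forall>\<^sub>F s in at_left S. x < f s"
      using t(2) eventually_at_left[of t S] by blast
  qed
  then show thesis
    using that by blast
qed

text \<open>A real point is always pushed away from the driving point and never changes sides, so
  its trajectory is monotone; boundedness of the driving function bounds it. Nothing is assumed
  about convergence of the driving function itself.\<close>

lemma loewner_real_flow_converges:
  assumes S: "0 < S" and X: "continuous_on {0..<S} X"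
    and M: "\<And>t. t \<in> {0..<S} \<Longrightarrow> \<bar>X t\<bar> \<le> M"
    and sol: "\<And>t. \<lbrakk>0 \<le> t; t < S\<rbrakk> \<Longrightarrow> loewner_solution X t (of_real q) u"
  obtains l where "(u \<longlongrightarrow> l) (at_left S)"
proof -
  have contX: "continuous_on {0..t} X" if "t < S" for t
    by (rule continuous_on_subset[OF X]) (use that in auto)
  define K where "K = max (cmod (of_real q)) (M + 1) * exp (2 * S)"
  have real: "Im (u t) = 0" "0 < (Re (u t) - X t) * (q - X 0)" "\<bar>Re (u t)\<bar> \<le> K" if t: "t \<in> {0..<S}" for t
  proof -
    have t': "0 \<le> t" "t < S"
      using t by auto
    show "Im (u t) = 0" "0 < (Re (u t) - X t) * (q - X 0)"
      using loewner_real[OF contX[OF t'(2)] sol[OF t'], of t] t' by simp_all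
    have "cmod (u t) \<le> max (cmod (of_real q)) (M + 1) * exp (2 * t)"
      by (rule loewner_flow_bounded[OF sol[OF t']]) (use t' M in auto)
    also have "\<dots> \<le> K"
      unfolding K_def using t' by (intro mult_left_mono) (auto simp: le_max_iff_disj)
    finally show "\<bar>Re (u t)\<bar> \<le> K"
      using abs_Re_le_cmod[of "u t"] by linarith
  qed
  have deriv: "((\<lambda>s. Re (u s)) has_vector_derivative 2 / (Re (u t) - X t)) (at t within {0..})"
    if t: "t \<in> {0..<S}" for t
  proof -
    have "u t - of_real (X t) = of_real (Re (u t) - X t)"
      using real(1)[OF t] by (simp add: complex_eq_iff)
    then have "Re (2 / (u t - of_real (X t))) = 2 / (Re (u t) - X t)"
      by (metis Re_complex_of_real of_real_divide of_real_numeral)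
    then show ?thesis
      using bounded_linear.has_vector_derivative[OF bounded_linear_Re loewner_solution_deriv[OF sol]] t
      by fastforce
  qed
  have "\<exists>l. ((\<lambda>s. Re (u s)) \<longlongrightarrow> l) (at_left S)"
  proof (cases "X 0 < q")
    case True
    have "0 \<le> 2 / (Re (u t) - X t)" if "t \<in> {0..<S}" for t
      using real(2)[OF that] True by (auto simp: zero_less_mult_iff)
    then have "Re (u x) \<le> Re (u y)" if "0 \<le> x" "x \<le> y" "y < S" for x y
      using nonneg_deriv_mono[where f = "\<lambda>s. Re (u s)", OF deriv] that by blast
    then show ?thesis
      using mono_bounded_tendsto_at_left[OF S, of "\<lambda>s. Re (u s)" K] real(3) by (metis abs_le_D1)
  next
    case False
    have "0 \<le> - (2 / (Re (u t) - X t))" if "t \<in> {0..<S}" for t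
      using real(2)[OF that] False by (auto simp: zero_less_mult_iff divide_nonneg_neg)
    then have "- Re (u x) \<le> - Re (u y)" if "0 \<le> x" "x \<le> y" "y < S" for x y
      using nonneg_deriv_mono[where f = "\<lambda>s. - Re (u s)", OF has_vector_derivative_minus[OF deriv]] that
      by blast
    then obtain l where "((\<lambda>s. - Re (u s)) \<longlongrightarrow> l) (at_left S)"
      using mono_bounded_tendsto_at_left[OF S, of "\<lambda>s. - Re (u s)" K] real(3) by (metis abs_le_D2)
    from tendsto_minus[OF this] show ?thesis
      by auto
  qed
  then obtain l where "((\<lambda>s. Re (u s)) \<longlongrightarrow> l) (at_left S)"
    by blast
  then have "((\<lambda>s. complex_of_real (Re (u s))) \<longlongrightarrow> of_real l) (at_left S)"
    by (rule tendsto_of_real)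
  moreover have "\<forall>\<^sub>F s in at_left S. complex_of_real (Re (u s)) = u s"
    unfolding eventually_at_left[OF S]
  proof (intro exI[of _ 0] conjI allI impI S)
    fix s assume "0 < s" "s < S"
    then show "complex_of_real (Re (u s)) = u s"
      using real(1)[of s] by (simp add: complex_eq_iff)
  qed
  ultimately have "(u \<longlongrightarrow> of_real l) (at_left S)"
    by (rule Lim_transform_eventually)
  then show thesis
    by (rule that)
qed

section \<open>Limiting charges and convergence of the driving function\<close>

lemma sum_multiples_of_four:
  fixes \<rho> :: "'a \<Rightarrow> real"
  assumes "\<And>w. w \<in> A \<Longrightarrow> \<exists>k::int. \<rho> w = 4 * of_int k"
  shows "\<exists>k::int. sum \<rho> A = 4 * of_int k"
  using assms
proof (induction A rule: infinite_finite_induct)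
  case (insert x A)
  then obtain k k' :: int where "sum \<rho> A = 4 * of_int k" "\<rho> x = 4 * of_int k'"
    by (metis insertCI)
  then show ?case
    using insert.hyps by (intro exI[of _ "k + k'"]) simp
qed auto

text \<open>For every polynomial \<open>q\<close> the moment \<open>2 q(X) + \<Sum>w. \<rho> w q(g w)\<close> is Lipschitz in time, hence
  converges. If the driving function oscillated, two sequences of times along which it tends to
  different limits would give the same limiting atomic measure; comparing the masses of a point
  which is not a limit of real charges contradicts the divisibility of the other charges by 4.\<close>

lemma driving_converges:
  assumes S: "0 < S" and W: "finite W"
    and deriv: "\<And>t. t \<in> {0..<S} \<Longrightarrow> ((\<lambda>s. complex_of_real (X s)) has_vector_derivative
      (\<Sum>w\<in>W. of_real (\<rho> w) / (of_real (X t) - g t w))) (at t within {0..})"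
    and sol: "\<And>w t. \<lbrakk>w \<in> W; 0 \<le> t; t < S\<rbrakk> \<Longrightarrow> loewner_solution X t w (\<lambda>s. g s w)"
    and M: "\<And>t. t \<in> {0..<S} \<Longrightarrow> \<bar>X t\<bar> \<le> M"
    and four: "\<And>w. \<lbrakk>w \<in> W; Im w \<noteq> 0\<rbrakk> \<Longrightarrow> \<exists>k::int. \<rho> w = 4 * of_int k"
  obtains L where "(X \<longlongrightarrow> L) (at_left S)"
proof (rule ccontr)
  assume "\<not> thesis"
  then have div: "\<nexists>L. (X \<longlongrightarrow> L) (at_left S)"
    using that by blast
  have contcX: "continuous_on {0..<S} (\<lambda>s. complex_of_real (X s))"
    using continuous_on_deriv_atLeast[OF deriv] .
  have X: "continuous_on {0..<S} X"
    using continuous_on_Re[OF contcX] by simp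
  define B where "B = max \<bar>M\<bar> (Max (insert 0 ((\<lambda>w. max (cmod w) (M + 1) * exp (2 * S)) ` W)))"
  have XB: "cmod (of_real (X t)) \<le> B" if "t \<in> {0..<S}" for t
    using M[OF that] by (auto simp: B_def)
  have gB: "cmod (g t w) \<le> B" if w: "w \<in> W" and t: "t \<in> {0..<S}" for w t
  proof -
    have t': "0 \<le> t" "t < S"
      using t by auto
    have "0 \<le> max (cmod w) (M + 1)"
      by (simp add: le_max_iff_disj)
    have "cmod (g t w) \<le> max (cmod w) (M + 1) * exp (2 * t)"
      by (rule loewner_flow_bounded[OF sol[OF w t']]) (use t' M in auto)
    also have "\<dots> \<le> max (cmod w) (M + 1) * exp (2 * S)"
      using t' \<open>0 \<le> max (cmod w) (M + 1)\<close> by (intro mult_left_mono) auto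
    also have "\<dots> \<le> Max (insert 0 ((\<lambda>w. max (cmod w) (M + 1) * exp (2 * S)) ` W))"
      using W w by (intro Max_ge) auto
    also have "\<dots> \<le> B"
      by (simp add: B_def)
    finally show ?thesis .
  qed
  define \<Psi> where "\<Psi> q t = 2 * poly q (of_real (X t)) + (\<Sum>w\<in>W. of_real (\<rho> w) * poly q (g t w))" for q t
  have conv: "\<exists>l. (\<Psi> q \<longlongrightarrow> l) (at_left S)" for q
  proof -
    define D where "D t = (\<Sum>w\<in>W. of_real (\<rho> w) / (of_real (X t) - g t w))" for t
    define \<Psi>' where "\<Psi>' t = 2 * (D t * poly (pderiv q) (of_real (X t)))
      + (\<Sum>w\<in>W. of_real (\<rho> w) * (2 / (g t w - of_real (X t)) * poly (pderiv q) (g t w)))" for t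
    obtain L where L: "0 \<le> L"
      "\<And>x y. \<lbrakk>cmod x \<le> B; cmod y \<le> B\<rbrakk> \<Longrightarrow> cmod (poly (pderiv q) x - poly (pderiv q) y) \<le> L * cmod (x - y)"
      using poly_lipschitz_on_cball[of B "pderiv q"] by blast
    obtain l where "(\<Psi> q \<longlongrightarrow> l) (at_left S)"
    proof (rule tendsto_at_left_bounded_deriv[OF S])
      fix t assume t: "t \<in> {0..<S}"
      have chain: "((\<lambda>s. poly q (f s)) has_vector_derivative f' * poly (pderiv q) (f t)) (at t within {0..})"
        if "(f has_vector_derivative f') (at t within {0..})" for f f'
        using field_vector_diff_chain_within[OF that has_field_derivative_at_within[OF poly_DERIV]]
        by (simp add: o_def)
      have sol': "((\<lambda>s. g s w) has_vector_derivative 2 / (g t w - of_real (X t))) (at t within {0..})"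
        if "w \<in> W" for w
        using loewner_solution_deriv[OF sol[OF that]] t by auto
      show "(\<Psi> q has_vector_derivative \<Psi>' t) (at t within {0..})"
        unfolding \<Psi>_def [abs_def] \<Psi>'_def D_def
        by (intro has_vector_derivative_add has_vector_derivative_sum has_vector_derivative_mult_right
            chain deriv[OF t] sol')
      \<comment> \<open>The weight 2 of the driving point equals the numerator of the Loewner field,
        so action and reaction combine: each pair of singular terms becomes a difference quotient of
        \<open>pderiv q\<close>, bounded by a Lipschitz constant even if a charge comes close to the
        driving point.\<close>
      have "\<Psi>' t = (\<Sum>w\<in>W. 2 * of_real (\<rho> w) *
          ((poly (pderiv q) (g t w) - poly (pderiv q) (of_real (X t))) / (g t w - of_real (X t))))"
      proof -
        have "of_real (\<rho> w) / (of_real (X t) - g t w) = - (of_real (\<rho> w) / (g t w - of_real (X t)))" for w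
          by (metis minus_diff_eq minus_divide_right)
        then show ?thesis
          unfolding \<Psi>'_def D_def
          by (simp add: sum_distrib_left sum_distrib_right diff_divide_distrib right_diff_distrib
              sum_subtractf sum_negf mult_ac)
      qed
      also have "cmod \<dots> \<le> (\<Sum>w\<in>W. 2 * \<bar>\<rho> w\<bar> * L)"
      proof (rule sum_norm_le)
        fix w assume w: "w \<in> W"
        have nz: "g t w - of_real (X t) \<noteq> 0"
          using loewner_solutionD(2)[OF sol[OF w], of t] t by auto
        have "cmod (poly (pderiv q) (g t w) - poly (pderiv q) (of_real (X t))) / cmod (g t w - of_real (X t)) \<le> L"
          using L(2)[OF gB[OF w t] XB[OF t]] nz by (simp add: pos_divide_le_eq)
        then have "2 * \<bar>\<rho> w\<bar> * (cmod (poly (pderiv q) (g t w) - poly (pderiv q) (of_real (X t)))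
            / cmod (g t w - of_real (X t))) \<le> 2 * \<bar>\<rho> w\<bar> * L"
          by (intro mult_left_mono) auto
        then show "cmod (2 * of_real (\<rho> w) *
            ((poly (pderiv q) (g t w) - poly (pderiv q) (of_real (X t))) / (g t w - of_real (X t))))
            \<le> 2 * \<bar>\<rho> w\<bar> * L"
          by (simp only: norm_mult norm_divide) simp
      qed
      finally show "cmod (\<Psi>' t) \<le> (\<Sum>w\<in>W. 2 * \<bar>\<rho> w\<bar> * L)" .
    qed
    then show ?thesis
      by blast
  qed
  \<comment> \<open>Real charges have genuine limits, which do not depend on the sequence of times.
    Only nonreal charges can have different limits along the two sequences used below.\<close>
  have rconv: "\<exists>l. ((\<lambda>t. g t w) \<longlongrightarrow> l) (at_left S)" if w: "w \<in> W" "Im w = 0" for w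
  proof -
    have weq: "w = of_real (Re w)"
      using w(2) by (simp add: complex_eq_iff)
    show ?thesis
      using loewner_real_flow_converges[OF S X M, of "Re w" "\<lambda>t. g t w"] sol[OF w(1)] weq by metis
  qed
  then obtain lr where lr: "\<And>w. \<lbrakk>w \<in> W; Im w = 0\<rbrakk> \<Longrightarrow> ((\<lambda>t. g t w) \<longlongrightarrow> lr w) (at_left S)"
    by metis
  obtain a b where ab: "a < b" "\<And>c. \<lbrakk>a < c; c < b\<rbrakk> \<Longrightarrow>
    \<exists>\<tau>::nat \<Rightarrow> real. (\<forall>n. \<tau> n \<in> {0..<S}) \<and> \<tau> \<longlonglongrightarrow> S \<and> (\<forall>n. X (\<tau> n) = c)"
    using not_convergent_at_left_oscillates[OF S X M div] by blast
  have lims: "\<exists>l. (\<forall>q. \<forall>p. (\<Psi> q \<longlongrightarrow> p) (at_left S) \<longrightarrow>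
      p = 2 * poly q (of_real c) + (\<Sum>w\<in>W. of_real (\<rho> w) * poly q (l w))) \<and>
      (\<forall>w\<in>W. Im w = 0 \<longrightarrow> l w = lr w)" if c: "a < c" "c < b" for c
  proof -
    obtain \<tau> :: "nat \<Rightarrow> real" where \<tau>: "\<And>n. \<tau> n \<in> {0..<S}" "\<tau> \<longlonglongrightarrow> S" "\<And>n. X (\<tau> n) = c"
      using ab(2)[OF c] by blast
    have "bounded (range (\<lambda>n. g (\<tau> n) w))" if "w \<in> W" for w
      unfolding bounded_iff using gB[OF that \<tau>(1)] by auto
    then obtain r l where r: "strict_mono (r::nat \<Rightarrow> nat)"
      and l: "\<And>w. w \<in> W \<Longrightarrow> (\<lambda>n. g (\<tau> (r n)) w) \<longlonglongrightarrow> l w"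
      using joint_convergent_subsequence[OF W, of "\<lambda>w n. g (\<tau> n) w"] by blast
    have "(\<lambda>n. \<tau> (r n)) \<longlonglongrightarrow> S"
      using LIMSEQ_subseq_LIMSEQ[OF \<tau>(2) r] by (simp add: o_def)
    moreover have "\<forall>\<^sub>F n in sequentially. \<tau> (r n) \<in> {..<S} \<and> \<tau> (r n) \<noteq> S"
      using \<tau>(1) by (intro always_eventually allI) (metis atLeastLessThan_iff lessThan_iff less_irrefl)
    ultimately have fl: "filterlim (\<lambda>n. \<tau> (r n)) (at_left S) sequentially"
      unfolding filterlim_at by blast
    show ?thesis
    proof (intro exI[of _ l] conjI allI impI ballI)
      fix q p assume "(\<Psi> q \<longlongrightarrow> p) (at_left S)"
      then have "(\<lambda>n. \<Psi> q (\<tau> (r n))) \<longlonglongrightarrow> p"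
        using fl by (rule filterlim_compose)
      moreover have "(\<lambda>n. \<Psi> q (\<tau> (r n))) \<longlonglongrightarrow>
          2 * poly q (of_real c) + (\<Sum>w\<in>W. of_real (\<rho> w) * poly q (l w))"
        unfolding \<Psi>_def \<tau>(3)
        by (intro tendsto_intros tendsto_compose[OF poly_isCont[unfolded isCont_def] l])
      ultimately show "p = 2 * poly q (of_real c) + (\<Sum>w\<in>W. of_real (\<rho> w) * poly q (l w))"
        by (rule LIMSEQ_unique)
    next
      fix w assume w: "w \<in> W" "Im w = 0"
      have "(\<lambda>n. g (\<tau> (r n)) w) \<longlonglongrightarrow> lr w"
        using lr[OF w] fl by (rule filterlim_compose)
      then show "l w = lr w"
        using l[OF w(1)] LIMSEQ_unique by blast
    qed
  qed
  \<comment> \<open>The test value \<open>c\<close> is chosen in the oscillation interval away from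
    the limits of real charges, so that only charges of weight divisible by 4 can accumulate at
    \<open>c\<close>.\<close>
  have "finite {c. complex_of_real c \<in> lr ` W}"
    using finite_vimageI[of "lr ` W" complex_of_real] W by (simp add: inj_of_real vimage_def)
  then have "infinite ({a<..<b} - {c. complex_of_real c \<in> lr ` W})"
    using ab(1) by (simp add: Diff_infinite_finite infinite_Ioo)
  then have "{a<..<b} - {c. complex_of_real c \<in> lr ` W} \<noteq> {}"
    by (rule infinite_imp_nonempty)
  then obtain c where "c \<in> {a<..<b} - {c. complex_of_real c \<in> lr ` W}"
    by (meson ex_in_conv)
  then have c: "a < c" "c < b" "of_real c \<notin> lr ` W"
    by simp_all
  define c' where "c' = (a + c) / 2"
  have c': "a < c'" "c' < b" "c' \<noteq> c"
    using c by (auto simp: c'_def)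
  obtain l where l: "\<And>q p. (\<Psi> q \<longlongrightarrow> p) (at_left S) \<Longrightarrow>
      p = 2 * poly q (of_real c) + (\<Sum>w\<in>W. of_real (\<rho> w) * poly q (l w))"
      "\<And>w. \<lbrakk>w \<in> W; Im w = 0\<rbrakk> \<Longrightarrow> l w = lr w"
    using lims[OF c(1,2)] by blast
  obtain l' where l': "\<And>q p. (\<Psi> q \<longlongrightarrow> p) (at_left S) \<Longrightarrow>
      p = 2 * poly q (of_real c') + (\<Sum>w\<in>W. of_real (\<rho> w) * poly q (l' w))"
      "\<And>w. \<lbrakk>w \<in> W; Im w = 0\<rbrakk> \<Longrightarrow> l' w = lr w"
    using lims[OF c'(1,2)] by blast
  define E where "E = (l ` W \<union> l' ` W \<union> {of_real c'}) - {complex_of_real c}"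
  \<comment> \<open>\<open>q\<close> vanishes at every limiting atom other than \<open>c\<close>,
    for both sequences, and at \<open>c'\<close>; its moment therefore sees only the total mass at
    \<open>c\<close>.\<close>
  define q where "q = (\<Prod>e\<in>E. [:- e, 1:])"
  have E: "finite E"
    using W by (simp add: E_def)
  have q0: "poly q z = 0 \<longleftrightarrow> z \<in> E" for z
    using E by (simp add: q_def poly_prod)
  have qc: "poly q (of_real c) \<noteq> 0" "poly q (of_real c') = 0"
    using c' by (auto simp: q0 E_def)
  have sums: "(\<Sum>w\<in>W. of_real (\<rho> w) * poly q (m w))
      = of_real (sum \<rho> {w \<in> W. m w = of_real c}) * poly q (of_real c)"
    if "\<And>w. w \<in> W \<Longrightarrow> m w = of_real c \<or> m w \<in> E" for m
  proof -
    have "(\<Sum>w\<in>W. of_real (\<rho> w) * poly q (m w))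
        = (\<Sum>w\<in>W. if m w = of_real c then of_real (\<rho> w) * poly q (of_real c) else 0)"
      using that by (intro sum.cong) (auto simp: q0)
    then show ?thesis
      using W by (simp add: sum.If_cases sum_distrib_right Int_def conj_commute)
  qed
  obtain p where p: "(\<Psi> q \<longlongrightarrow> p) (at_left S)"
    using conv by blast
  \<comment> \<open>Along the first sequence the driving point itself sits at \<open>c\<close> and
    adds mass 2; along the second it sits at \<open>c'\<close>, a zero of \<open>q\<close>. The same
    limit \<open>p\<close> gives an equation \<open>2 + 4 * k = 4 * k'\<close> in integers.\<close>
  have "p = (2 + of_real (sum \<rho> {w \<in> W. l w = of_real c})) * poly q (of_real c)"
    using l(1)[OF p] sums[of l] by (auto simp: E_def algebra_simps)
  moreover have "p = of_real (sum \<rho> {w \<in> W. l' w = of_real c}) * poly q (of_real c)"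
    using l'(1)[OF p] sums[of l'] qc(2) by (auto simp: E_def)
  ultimately have "complex_of_real (2 + sum \<rho> {w \<in> W. l w = of_real c})
      = of_real (sum \<rho> {w \<in> W. l' w = of_real c})"
    using qc(1) by simp
  then have eq: "2 + sum \<rho> {w \<in> W. l w = of_real c} = sum \<rho> {w \<in> W. l' w = of_real c}"
    by (simp only: of_real_eq_iff)
  have "\<exists>k::int. sum \<rho> {w \<in> W. m w = of_real c} = 4 * of_int k"
    if "\<And>w. \<lbrakk>w \<in> W; Im w = 0\<rbrakk> \<Longrightarrow> m w = lr w" for m
  proof (rule sum_multiples_of_four)
    fix w assume w: "w \<in> {w \<in> W. m w = of_real c}"
    then have "Im w \<noteq> 0"
      using that[of w] c(3) by force
    then show "\<exists>k::int. \<rho> w = 4 * of_int k"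
      using four[of w] w by blast
  qed
  from this[of l, OF l(2)] this[of l', OF l'(2)] obtain k k' :: int
    where "sum \<rho> {w \<in> W. l w = of_real c} = 4 * of_int k" "sum \<rho> {w \<in> W. l' w = of_real c} = 4 * of_int k'"
    by blast
  with eq have "of_int (2 + 4 * k) = (of_int (4 * k') :: real)"
    by simp
  then have "2 + 4 * k = 4 * k'"
    by (simp only: of_int_eq_iff)
  then show False
    by presburger
qed

section \<open>Collision or separation at the final time\<close>

text \<open>If the trajectory does not tend to the limit \<open>L\<close> of the driving function,
  then arbitrarily close to \<open>S\<close> it is at distance at least \<open>4 * e\<close> from
  \<open>L\<close>, while the driving point is within \<open>e\<close>. As long as it stays outside
  radius \<open>3 * e\<close> its speed is at most \<open>1 / e\<close>, so it has no time left to
  come closer. On the remaining compact interval the distance has a positive minimum.\<close>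

lemma loewner_flow_hits_or_stays_away:
  assumes S: "0 < S" and X: "continuous_on {0..<S} X" and L: "(X \<longlongrightarrow> L) (at_left S)"
    and sol: "\<And>t. \<lbrakk>0 \<le> t; t < S\<rbrakk> \<Longrightarrow> loewner_solution X t z u"
  shows "((\<lambda>t. of_real (X t) - u t) \<longlongrightarrow> 0) (at_left S) \<or>
    (\<exists>\<epsilon>>0. \<forall>t\<in>{0..<S}. \<epsilon> \<le> cmod (of_real (X t) - u t))"
  unfolding disj_imp
proof (rule impI)
  assume no: "\<not> ((\<lambda>t. of_real (X t) - u t) \<longlongrightarrow> 0) (at_left S)"
  have Lc: "((\<lambda>t. complex_of_real (X t)) \<longlongrightarrow> of_real L) (at_left S)"
    using L by (rule tendsto_of_real)
  have "\<not> (u \<longlongrightarrow> of_real L) (at_left S)"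
    using tendsto_diff[OF Lc, of u "of_real L"] no by auto
  then obtain e0 where e0: "e0 > 0" "\<not> (\<forall>\<^sub>F t in at_left S. dist (u t) (of_real L) < e0)"
    by (auto simp: tendsto_iff)
  define e where "e = e0 / 4"
  have e: "e > 0" "e0 = 4 * e"
    using e0(1) by (auto simp: e_def)
  have "\<forall>\<^sub>F t in at_left S. dist (complex_of_real (X t)) (of_real L) < e"
    using Lc e(1) by (rule tendstoD)
  then obtain b where b: "b < S" "\<And>t. \<lbrakk>b < t; t < S\<rbrakk> \<Longrightarrow> cmod (of_real (X t) - of_real L) < e"
    unfolding eventually_at_left[OF S] dist_norm by blast
  \<comment> \<open>Remaining time less than \<open>e\<^sup>2\<close> at speed at most
    \<open>1 / e\<close> allows a displacement less than \<open>e\<close>, which is too short to get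
    from radius \<open>4 * e\<close> to \<open>3 * e\<close>.\<close>
  define b' where "b' = max (max b 0) (S - e\<^sup>2)"
  have "b' < S"
    using b(1) S e(1) by (simp add: b'_def)
  then have "\<not> (\<forall>t>b'. t < S \<longrightarrow> dist (u t) (of_real L) < e0)"
    using e0(2) unfolding eventually_at_left[OF S] by blast
  then obtain t1 where t1: "b < t1" "0 < t1" "S - e\<^sup>2 < t1" "t1 < S" "4 * e \<le> cmod (u t1 - of_real L)"
    unfolding e(2) dist_norm b'_def by (auto simp: not_less)
  have contu: "continuous_on {0..<S} u"
    using loewner_solution_deriv[OF sol] by (intro continuous_on_deriv_atLeast) auto
  define d where "d t = cmod (u t - of_real L)" for t
  have contd: "continuous_on {0..<S} d"
    unfolding d_def [abs_def] by (intro continuous_intros contu)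
  have stay: "3 * e \<le> d t" if t: "t1 \<le> t" "t < S" for t
  proof (rule ccontr)
    assume neg: "\<not> 3 * e \<le> d t"
    define A where "A = {t1..t} \<inter> d -` {..3 * e}"
    have "continuous_on {t1..t} d"
      by (rule continuous_on_subset[OF contd]) (use t1 t in auto)
    then have "closed A"
      unfolding A_def by (rule continuous_closed_preimage) auto
    moreover have "bounded A"
      unfolding A_def by (rule bounded_subset[OF bounded_closed_interval[of t1 t]]) auto
    ultimately have "compact A"
      by (simp add: compact_eq_bounded_closed)
    moreover have "t \<in> A"
      using neg t by (auto simp: A_def)
    ultimately obtain s where s: "s \<in> A" "\<And>r. r \<in> A \<Longrightarrow> s \<le> r"
      by (metis compact_attains_inf empty_iff)
    have st: "t1 \<le> s" "s \<le> t" "d s \<le> 3 * e"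
      using s(1) by (auto simp: A_def)
    have low: "3 * e \<le> d r" if r: "t1 \<le> r" "r \<le> s" for r
    proof (rule ccontr)
      assume neg: "\<not> 3 * e \<le> d r"
      have "connected (d ` {t1..r})"
        by (intro connected_continuous_image continuous_on_subset[OF contd]) (use t1 t r st in auto)
      then have "3 * e \<in> d ` {t1..r}"
        by (rule connectedD_interval[of _ "d r" "d t1"])
          (use neg r t1(5) e(1) in \<open>auto simp: d_def\<close>)
      then obtain r' where r': "t1 \<le> r'" "r' \<le> r" "d r' = 3 * e"
        by auto
      then have "r' \<in> A"
        using r st by (auto simp: A_def)
      then have "s \<le> r'"
        by (rule s(2))
      then have "r' = r"
        using r' r by linarith
      then show False
        using r' neg by simp
    qed
    have "cmod (u s - u t1) \<le> 1 / e * \<bar>s - t1\<bar>"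
    proof (rule vector_lipschitz[where I = "{t1..s}"])
      fix r assume r: "r \<in> {t1..s}"
      show "(u has_vector_derivative 2 / (u r - of_real (X r))) (at r within {t1..s})"
        by (rule has_vector_derivative_within_subset[OF loewner_solution_deriv[OF sol]])
          (use r st t t1 in auto)
      have "3 * e \<le> cmod (u r - of_real L)"
        using low[of r] r by (simp add: d_def)
      moreover have "cmod (of_real (X r) - complex_of_real L) < e"
        using b(2)[of r] r st t t1 by auto
      moreover have "cmod (u r - of_real L) \<le> cmod (u r - of_real (X r)) + cmod (of_real (X r) - complex_of_real L)"
        using norm_triangle_ineq[of "u r - of_real (X r)" "of_real (X r) - complex_of_real L"] by simp
      ultimately have "2 * e \<le> cmod (u r - of_real (X r))"
        by linarith
      then have "2 / cmod (u r - of_real (X r)) \<le> 2 / (2 * e)"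
        using e(1) by (intro frac_le) auto
      then show "cmod (2 / (u r - of_real (X r))) \<le> 1 / e"
        by (simp add: norm_divide)
    qed (use st in auto)
    also have "\<dots> < 1 / e * e\<^sup>2"
      using t1 st t e(1) by (intro mult_strict_left_mono) auto
    also have "\<dots> = e"
      using e(1) by (simp add: power2_eq_square)
    finally have "cmod (u s - u t1) < e" .
    moreover have "cmod (u t1 - of_real L) \<le> cmod (u s - u t1) + cmod (u s - of_real L)"
      using norm_triangle_ineq4[of "u s - of_real L" "u s - u t1"] by simp
    ultimately show False
      using t1(5) st(3) by (simp add: d_def)
  qed
  have contXu: "continuous_on {0..t1} (\<lambda>t. cmod (of_real (X t) - u t))"
    by (intro continuous_intros continuous_on_subset[OF X] continuous_on_subset[OF contu]) (use t1 in auto)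
  then obtain s0 where s0: "s0 \<in> {0..t1}"
    "\<And>s. s \<in> {0..t1} \<Longrightarrow> cmod (of_real (X s0) - u s0) \<le> cmod (of_real (X s) - u s)"
    using continuous_attains_inf[of "{0..t1}" "\<lambda>t. cmod (of_real (X t) - u t)"] t1 by auto
  define \<epsilon> where "\<epsilon> = min (2 * e) (cmod (of_real (X s0) - u s0))"
  have "0 < cmod (of_real (X s0) - u s0)"
    using loewner_solutionD(2)[OF sol, of t1 s0] s0(1) t1 by auto
  then have "\<epsilon> > 0"
    using e(1) by (simp add: \<epsilon>_def)
  moreover have "\<epsilon> \<le> cmod (of_real (X t) - u t)" if t: "t \<in> {0..<S}" for t
  proof (cases "t \<le> t1")
    case True
    then show ?thesis
      using s0(2)[of t] t by (simp add: \<epsilon>_def)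
  next
    case False
    have "3 * e \<le> cmod (u t - of_real L)"
      using stay[of t] t False by (simp add: d_def)
    moreover have "cmod (of_real (X t) - complex_of_real L) < e"
      using b(2)[of t] t t1 False by auto
    moreover have "cmod (u t - of_real L) \<le> cmod (of_real (X t) - complex_of_real L) + cmod (of_real (X t) - u t)"
      using norm_triangle_ineq4[of "of_real (X t) - complex_of_real L" "of_real (X t) - u t"] by simp
    ultimately show ?thesis
      by (simp add: \<epsilon>_def)
  qed
  ultimately show "\<exists>\<epsilon>>0. \<forall>t\<in>{0..<S}. \<epsilon> \<le> cmod (of_real (X t) - u t)"
    by blast
qed

text \<open>The same competition of speeds as in \<open>loewner_real_solution\<close>, now with a
  constant that is uniform up to \<open>S\<close>: within distance \<open>\<delta>\<close> the
  repulsion is faster than the driving point.\<close>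

lemma loewner_real_flow_stays_away:
  assumes X: "\<And>t. t \<in> {0..<S} \<Longrightarrow> (X has_vector_derivative X' t) (at t within {0..})"
    and C: "\<And>t. t \<in> {0..<S} \<Longrightarrow> \<bar>X' t\<bar> \<le> C"
    and sol: "\<And>t. \<lbrakk>0 \<le> t; t < S\<rbrakk> \<Longrightarrow> loewner_solution X t (of_real a) u" and S: "0 < S"
  obtains \<delta> where "\<delta> > 0" "\<And>t. t \<in> {0..<S} \<Longrightarrow> \<delta> \<le> cmod (of_real (X t) - u t)"
proof -
  have contX: "continuous_on {0..<S} X"
    using continuous_on_deriv_atLeast[OF X] .
  have aX: "a \<noteq> X 0"
    using loewner_solutionD(1,2)[OF sol[of 0]] S by auto
  define sg where "sg = sgn (a - X 0)"
  have sg: "sg = 1 \<or> sg = - 1" "sg * (a - X 0) = \<bar>a - X 0\<bar>"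
    using aX by (auto simp: sg_def sgn_if)
  define \<delta> where "\<delta> = min \<bar>a - X 0\<bar> (2 / (\<bar>C\<bar> + 1))"
  have \<delta>: "\<delta> > 0" "\<delta> \<le> \<bar>a - X 0\<bar>" "\<bar>C\<bar> \<le> 2 / \<delta>"
  proof -
    show 1: "\<delta> > 0" "\<delta> \<le> \<bar>a - X 0\<bar>"
      using aX by (auto simp: \<delta>_def)
    have "\<delta> \<le> 2 / (\<bar>C\<bar> + 1)"
      by (simp add: \<delta>_def)
    then have "\<delta> * (\<bar>C\<bar> + 1) \<le> 2"
      by (simp add: pos_le_divide_eq)
    then have "\<bar>C\<bar> + 1 \<le> 2 / \<delta>"
      using 1(1) by (simp add: pos_le_divide_eq mult.commute)
    then show "\<bar>C\<bar> \<le> 2 / \<delta>"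
      by simp
  qed
  have "\<delta> \<le> cmod (of_real (X t) - u t)" if t: "t \<in> {0..<S}" for t
  proof -
    have t': "0 \<le> t" "t < S"
      using t by auto
    have contXt: "continuous_on {0..t} X"
      by (rule continuous_on_subset[OF contX]) (use t' in auto)
    note U = loewner_solutionD[OF sol[OF t']] and R = loewner_real[OF contXt sol[OF t']]
    have pos: "0 < sg * (Re (u r) - X r)" if "r \<in> {0..t}" for r
      using R(2)[OF that] aX by (auto simp: sg_def sgn_if zero_less_mult_iff)
    have "\<delta> \<le> sg * (Re (u t) - X t)"
    proof (rule barrier[where f = "\<lambda>r. sg * (Re (u r) - X r)" and t = t and ?s1.0 = t
          and f' = "\<lambda>r. sg * (2 / (Re (u r) - X r) - X' r)"])
      fix r assume r: "r \<in> {0..t}"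
      have "u r - of_real (X r) = of_real (Re (u r) - X r)"
        using R(1)[OF r] by (simp add: complex_eq_iff)
      then have "Re (2 / (u r - of_real (X r))) = 2 / (Re (u r) - X r)"
        by (metis Re_complex_of_real of_real_divide of_real_numeral)
      then have 1: "((\<lambda>r. Re (u r)) has_vector_derivative 2 / (Re (u r) - X r)) (at r within {0..t})"
        using bounded_linear.has_vector_derivative[OF bounded_linear_Re U(3)[OF r]] by simp
      have 2: "(X has_vector_derivative X' r) (at r within {0..t})"
        by (rule has_vector_derivative_within_subset[OF X]) (use r t in auto)
      show "((\<lambda>r. sg * (Re (u r) - X r)) has_vector_derivative
          sg * (2 / (Re (u r) - X r) - X' r)) (at r within {0..t})"
        by (intro has_vector_derivative_mult_right has_vector_derivative_diff 1 2)
      assume less: "sg * (Re (u r) - X r) < \<delta>"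
      have "sg * (2 / (Re (u r) - X r)) = 2 / (sg * (Re (u r) - X r))"
        using sg(1) by (auto simp: divide_simps)
      moreover have "2 / \<delta> \<le> 2 / (sg * (Re (u r) - X r))"
        using less pos[OF r] \<delta>(1) by (intro frac_le) auto
      moreover have "sg * X' r \<le> \<bar>C\<bar>"
        using C[of r] r t sg(1) by (auto simp: abs_le_iff)
      ultimately show "0 \<le> sg * (2 / (Re (u r) - X r) - X' r)"
        using \<delta>(3) by (simp add: right_diff_distrib)
    qed (use \<delta> sg(2) t' U(1) in auto)
    also have "\<dots> \<le> \<bar>Re (of_real (X t) - u t)\<bar>"
      using sg(1) by auto
    also have "\<dots> \<le> cmod (of_real (X t) - u t)"
      by (rule abs_Re_le_cmod)
    finally show ?thesis .
  qed
  then show thesis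
    using that \<delta>(1) by blast
qed

text \<open>Convergence of the driving function turns the absence of collisions into a common lower
  bound on the distances to all charges. The driving equation then bounds the speed, and a bounded
  speed keeps every surviving real point away as well.\<close>

lemma loewner_charges_dichotomy:
  assumes S: "0 < S" and W: "finite W"
    and deriv: "\<And>t. t \<in> {0..<S} \<Longrightarrow> ((\<lambda>s. complex_of_real (X s)) has_vector_derivative
      (\<Sum>w\<in>W. of_real (\<rho> w) / (of_real (X t) - g t w))) (at t within {0..})"
    and sol: "\<And>w t. \<lbrakk>w \<in> W; 0 \<le> t; t < S\<rbrakk> \<Longrightarrow> loewner_solution X t w (\<lambda>s. g s w)"
    and M: "\<And>t. t \<in> {0..<S} \<Longrightarrow> \<bar>X t\<bar> \<le> M"
    and four: "\<And>w. \<lbrakk>w \<in> W; Im w \<noteq> 0\<rbrakk> \<Longrightarrow> \<exists>k::int. \<rho> w = 4 * of_int k"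
    and sola: "\<And>t. \<lbrakk>0 \<le> t; t < S\<rbrakk> \<Longrightarrow> loewner_solution X t (of_real a) u"
    and no_hit: "\<And>w. w \<in> W \<Longrightarrow> \<not> ((\<lambda>t. of_real (X t) - g t w) \<longlongrightarrow> 0) (at_left S)"
  obtains \<epsilon> where "\<epsilon> > 0" "\<And>t. t \<in> {0..<S} \<Longrightarrow> \<epsilon> \<le> cmod (of_real (X t) - u t)"
    "\<And>t w. \<lbrakk>t \<in> {0..<S}; w \<in> W\<rbrakk> \<Longrightarrow> \<epsilon> \<le> cmod (of_real (X t) - g t w)"
proof -
  obtain L where L: "(X \<longlongrightarrow> L) (at_left S)"
    using driving_converges[OF S W deriv sol M four] by blast
  have contcX: "continuous_on {0..<S} (\<lambda>s. complex_of_real (X s))"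
    using continuous_on_deriv_atLeast[OF deriv] .
  have X: "continuous_on {0..<S} X"
    using continuous_on_Re[OF contcX] by simp
  have "\<exists>\<epsilon>>0. \<forall>t\<in>{0..<S}. \<epsilon> \<le> cmod (of_real (X t) - g t w)" if "w \<in> W" for w
    using loewner_flow_hits_or_stays_away[OF S X L sol[OF that]] no_hit[OF that] by blast
  then obtain \<epsilon>w where \<epsilon>w: "\<And>w. w \<in> W \<Longrightarrow> \<epsilon>w w > 0"
    "\<And>w t. \<lbrakk>w \<in> W; t \<in> {0..<S}\<rbrakk> \<Longrightarrow> \<epsilon>w w \<le> cmod (of_real (X t) - g t w)"
    by metis
  define \<epsilon>1 where "\<epsilon>1 = Min (insert 1 (\<epsilon>w ` W))"
  have \<epsilon>1: "\<epsilon>1 > 0" "\<And>w t. \<lbrakk>w \<in> W; t \<in> {0..<S}\<rbrakk> \<Longrightarrow> \<epsilon>1 \<le> cmod (of_real (X t) - g t w)"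
  proof -
    show "\<epsilon>1 > 0"
      using W \<epsilon>w(1) by (simp add: \<epsilon>1_def)
    fix w t assume w: "w \<in> W" "t \<in> {0..<S}"
    have "\<epsilon>1 \<le> \<epsilon>w w"
      unfolding \<epsilon>1_def using W w by (intro Min_le) auto
    then show "\<epsilon>1 \<le> cmod (of_real (X t) - g t w)"
      using \<epsilon>w(2)[OF w] by simp
  qed
  define D where "D t = (\<Sum>w\<in>W. of_real (\<rho> w) / (of_real (X t) - g t w))" for t
  have Xd: "(X has_vector_derivative Re (D t)) (at t within {0..})" if "t \<in> {0..<S}" for t
    using bounded_linear.has_vector_derivative[OF bounded_linear_Re deriv[OF that]] by (simp add: D_def)
  have bd: "\<bar>Re (D t)\<bar> \<le> (\<Sum>w\<in>W. \<bar>\<rho> w\<bar> / \<epsilon>1)" if t: "t \<in> {0..<S}" for t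
  proof -
    have "\<bar>Re (D t)\<bar> \<le> cmod (D t)"
      by (rule abs_Re_le_cmod)
    also have "\<dots> \<le> (\<Sum>w\<in>W. \<bar>\<rho> w\<bar> / \<epsilon>1)"
      unfolding D_def
    proof (rule sum_norm_le)
      fix w assume w: "w \<in> W"
      show "cmod (of_real (\<rho> w) / (of_real (X t) - g t w)) \<le> \<bar>\<rho> w\<bar> / \<epsilon>1"
        unfolding norm_divide norm_of_real using \<epsilon>1(1) \<epsilon>1(2)[OF w t] by (intro frac_le) auto
    qed
    finally show ?thesis .
  qed
  obtain \<delta> where \<delta>: "\<delta> > 0" "\<And>t. t \<in> {0..<S} \<Longrightarrow> \<delta> \<le> cmod (of_real (X t) - u t)"
    using loewner_real_flow_stays_away[OF Xd bd sola S] by blast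
  show thesis
  proof (rule that[of "min \<epsilon>1 \<delta>"])
    show "min \<epsilon>1 \<delta> > 0"
      using \<epsilon>1(1) \<delta>(1) by simp
  qed (use \<epsilon>1(2) \<delta>(2) in \<open>auto simp: min_le_iff_disj\<close>)
qed

section \<open>Moebius changes of chart\<close>

lemma has_vector_derivative_quotient:
  fixes f g :: "real \<Rightarrow> 'a::real_normed_field"
  assumes f: "(f has_vector_derivative f') (at t within I)"
    and g: "(g has_vector_derivative g') (at t within I)" and nz: "g t \<noteq> 0"
  shows "((\<lambda>s. f s / g s) has_vector_derivative (f' * g t - f t * g') / (g t * g t)) (at t within I)"
  using has_derivative_divide'[OF f[unfolded has_vector_derivative_def] g[unfolded has_vector_derivative_def] nz]
  unfolding has_vector_derivative_def
  by (rule has_derivative_eq_rhs) (simp add: fun_eq_iff scaleR_diff_right scaleR_conv_of_real field_simps)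

lemma has_vector_derivative_complex_of_real:
  "(f has_vector_derivative f') F \<Longrightarrow> ((\<lambda>s. complex_of_real (f s)) has_vector_derivative of_real f') F"
  by (rule bounded_linear.has_vector_derivative[OF bounded_linear_of_real])

text \<open>The real Moebius map sending \<open>X\<close> to \<open>Y\<close> with matrix \<open>(a, b; c, d)\<close> of determinant 1 such
  that \<open>j = c X + d\<close>.\<close>

definition chart_map :: "real \<Rightarrow> real \<Rightarrow> real \<Rightarrow> real \<Rightarrow> complex \<Rightarrow> complex" where
  "chart_map X Y c j u = of_real Y +
    (u - of_real X) / ((of_real c * (u - of_real X) + of_real j) * of_real j)"

text \<open>The inverse matrix has lower row \<open>(- c, a)\<close>, and
  \<open>a - c * Y = 1 / j\<close>. So the inverse map has the same form with \<open>X\<close> and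
  \<open>Y\<close> exchanged and parameters \<open>- c\<close> and \<open>1 / j\<close>, and the two
  denominators are reciprocal.\<close>

lemma chart_map_denominator:
  assumes "j \<noteq> 0" "of_real c * (u - of_real X) + of_real j \<noteq> 0"
  shows "of_real (- c) * (chart_map X Y c j u - of_real Y) + of_real (1 / j)
    = 1 / (of_real c * (u - of_real X) + of_real j)"
proof -
  define K C J e where "K = of_real c * (u - of_real X) + of_real j" and "C = complex_of_real c"
    and "J = complex_of_real j" and "e = u - of_real X"
  have nz: "K \<noteq> 0" "J \<noteq> 0" and KJ: "K - C * e = J"
    using assms by (auto simp: K_def J_def C_def e_def)
  have "- C * (e / (K * J)) + 1 / J = (K - C * e) / (K * J)"
    using nz by (simp add: diff_divide_distrib)
  also have "\<dots> = 1 / K"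
    using nz by (simp add: KJ)
  finally show ?thesis
    by (simp add: chart_map_def K_def[symmetric] C_def J_def e_def)
qed

lemma chart_map_inverse:
  assumes "j \<noteq> 0" "of_real c * (u - of_real X) + of_real j \<noteq> 0"
  shows "chart_map Y X (- c) (1 / j) (chart_map X Y c j u) = u"
proof -
  have "chart_map X Y c j u - of_real Y
      = (u - of_real X) / ((of_real c * (u - of_real X) + of_real j) * of_real j)"
    by (simp add: chart_map_def)
  then show ?thesis
    unfolding chart_map_def[of Y X] chart_map_denominator[OF assms] using assms by simp
qed

text \<open>The first two derivatives of the chart \<open>H\<close> at \<open>X\<close> are
  \<open>1 / j ^ 2\<close> and \<open>- 2 * c / j ^ 3\<close>, so the equation for \<open>Y\<close>
  reads \<open>H'(X) * X' - 3 * \<nu> * H''(X)\<close> and the new speed is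
  \<open>\<nu> * H'(X) ^ 2\<close>. The speed \<open>\<nu>\<close> of the given flow is kept general
  so that the inverse change, which starts from a flow of speed \<open>1 / j ^ 4\<close>, is covered
  too.\<close>

lemma chart_flow_deriv:
  fixes u :: "real \<Rightarrow> complex"
  assumes X: "(X has_vector_derivative X') (at t within I)"
    and c: "(c has_vector_derivative \<nu> * c t ^ 3 / j t ^ 2) (at t within I)"
    and j: "(j has_vector_derivative c t * X' + 3 * \<nu> * c t ^ 2 / j t) (at t within I)"
    and Y: "(Y has_vector_derivative X' / j t ^ 2 + 6 * \<nu> * c t / j t ^ 3) (at t within I)"
    and u: "(u has_vector_derivative 2 * of_real \<nu> / (u t - of_real (X t))) (at t within I)"
    and nz: "u t \<noteq> of_real (X t)" "j t \<noteq> 0"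
      "of_real (c t) * (u t - of_real (X t)) + of_real (j t) \<noteq> 0"
  shows "((\<lambda>s. chart_map (X s) (Y s) (c s) (j s) (u s)) has_vector_derivative
     2 * of_real (\<nu> / j t ^ 4) / (chart_map (X t) (Y t) (c t) (j t) (u t) - of_real (Y t))) (at t within I)"
proof -
  define e where "e s = u s - of_real (X s)" for s
  define C J where "C = complex_of_real (c t)" and "J = complex_of_real (j t)"
  define l x where "l = complex_of_real \<nu>" and "x = complex_of_real X'"
  have nz': "e t \<noteq> 0" "J \<noteq> 0" "C * e t + J \<noteq> 0"
    using nz by (auto simp: e_def C_def J_def)
  note D = has_vector_derivative_complex_of_real[OF X] has_vector_derivative_complex_of_real[OF c]
    has_vector_derivative_complex_of_real[OF j] has_vector_derivative_complex_of_real[OF Y]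
  have e': "(e has_vector_derivative 2 * l / e t - x) (at t within I)"
    unfolding e_def [abs_def] l_def x_def by (intro has_vector_derivative_diff u D(1))
  have c': "((\<lambda>s. complex_of_real (c s)) has_vector_derivative l * C ^ 3 / J ^ 2) (at t within I)"
    using D(2) by (simp add: l_def C_def J_def)
  have j': "((\<lambda>s. complex_of_real (j s)) has_vector_derivative C * x + 3 * l * C ^ 2 / J) (at t within I)"
    using D(3) by (simp add: l_def C_def J_def x_def)
  have Y': "((\<lambda>s. complex_of_real (Y s)) has_vector_derivative x / J ^ 2 + 6 * l * C / J ^ 3) (at t within I)"
    using D(4) by (simp add: l_def C_def J_def x_def)
  define k' where "k' = (C * (2 * l / e t - x) + l * C ^ 3 / J ^ 2 * e t) + (C * x + 3 * l * C ^ 2 / J)"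
  have k: "((\<lambda>s. of_real (c s) * e s + of_real (j s)) has_vector_derivative k') (at t within I)"
    unfolding k'_def using has_vector_derivative_add[OF has_vector_derivative_mult[OF c' e'] j']
    by (simp add: C_def)
  have kj: "((\<lambda>s. (of_real (c s) * e s + of_real (j s)) * of_real (j s)) has_vector_derivative
      (C * e t + J) * (C * x + 3 * l * C ^ 2 / J) + k' * J) (at t within I)"
    using has_vector_derivative_mult[OF k j'] by (simp add: C_def J_def)
  define K where "K = C * e t + J"
  have "((\<lambda>s. of_real (Y s) + e s / ((of_real (c s) * e s + of_real (j s)) * of_real (j s)))
      has_vector_derivative (x / J ^ 2 + 6 * l * C / J ^ 3) +
      ((2 * l / e t - x) * (K * J) - e t * (K * (C * x + 3 * l * C ^ 2 / J) + k' * J)) / (K * J * (K * J)))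
      (at t within I)"
    using has_vector_derivative_add[OF Y' has_vector_derivative_quotient[OF e' kj]] nz'
    by (simp add: C_def J_def K_def)
  moreover have "(x / J ^ 2 + 6 * l * C / J ^ 3) +
      ((2 * l / e t - x) * (K * J) - e t * (K * (C * x + 3 * l * C ^ 2 / J) + k' * J)) / (K * J * (K * J))
      = 2 * (l / J ^ 4) / (e t / (K * J))"
  proof -
    have K: "K \<noteq> 0"
      using nz' by (simp add: K_def)
    \<comment> \<open>The derivative of the denominator is a multiple of the denominator itself;
      this factor cancels against the square produced by the quotient rule.\<close>
    have k'K: "k' = K * (l * C ^ 2 / J ^ 2 + 2 * l * C / (J * e t))"
      unfolding k'_def K_def using nz'(1,2) by (simp add: field_simps power2_eq_square power3_eq_cube)
define P D where "P = x / J ^ 2 + 6 * l * C / J ^ 3" and "D = (2 * l / e t - x) * J - e t *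
      ((C * x + 3 * l * C ^ 2 / J) + (l * C ^ 2 / J ^ 2 + 2 * l * C / (J * e t)) * J)"
    have "((2 * l / e t - x) * (K * J) - e t * (K * (C * x + 3 * l * C ^ 2 / J) + k' * J)) / (K * J * (K * J))
        = D / (K * J ^ 2)"
      unfolding k'K D_def using K nz'(2) by (simp add: field_simps power2_eq_square)
    then have "P + ((2 * l / e t - x) * (K * J) - e t * (K * (C * x + 3 * l * C ^ 2 / J) + k' * J))
        / (K * J * (K * J)) = P + D / (K * J ^ 2)"
      by simp
    also have "\<dots> = (P * (K * J ^ 2) + D) / (K * J ^ 2)"
      using K nz'(2) by (simp add: add_divide_distrib)
    also have "P * (K * J ^ 2) + D = 2 * l * K ^ 2 / (J * e t)"
      unfolding K_def P_def D_def using nz'(1,2) by (simp add: field_simps eval_nat_numeral)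
    also have "2 * l * K ^ 2 / (J * e t) / (K * J ^ 2) = 2 * (l / J ^ 4) / (e t / (K * J))"
      using K nz'(1,2) by (simp add: field_simps eval_nat_numeral)
    finally show ?thesis
      by (simp only: P_def)
  qed
  ultimately show ?thesis
    by (simp add: chart_map_def e_def C_def J_def K_def l_def)
qed

text \<open>The pole of the chart moves with the flow, so the denominator along a trajectory solves
  a linear equation: a point that does not start at the pole never reaches it.\<close>

lemma chart_denominator_nonzero:
  fixes u :: "real \<Rightarrow> complex"
  assumes X: "\<And>s. s \<in> {0..t} \<Longrightarrow> (X has_vector_derivative X' s) (at s within {0..t})"
    and c: "\<And>s. s \<in> {0..t} \<Longrightarrow> (c has_vector_derivative \<nu> s * c s ^ 3 / j s ^ 2) (at s within {0..t})"
    and j: "\<And>s. s \<in> {0..t} \<Longrightarrow>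
      (j has_vector_derivative c s * X' s + 3 * \<nu> s * c s ^ 2 / j s) (at s within {0..t})"
    and u: "\<And>s. s \<in> {0..t} \<Longrightarrow>
      (u has_vector_derivative 2 * of_real (\<nu> s) / (u s - of_real (X s))) (at s within {0..t})"
    and \<nu>: "continuous_on {0..t} \<nu>"
    and nz: "\<And>s. s \<in> {0..t} \<Longrightarrow> u s \<noteq> of_real (X s)" "\<And>s. s \<in> {0..t} \<Longrightarrow> j s \<noteq> 0"
      "of_real (c 0) * (u 0 - of_real (X 0)) + of_real (j 0) \<noteq> 0"
    and s: "s \<in> {0..t}"
  shows "of_real (c s) * (u s - of_real (X s)) + of_real (j s) \<noteq> 0"
proof -
  define \<kappa> where "\<kappa> s = of_real (c s) * (u s - of_real (X s)) + of_real (j s)" for s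
  define k where "k s = of_real (\<nu> s) * of_real (c s) ^ 2 / of_real (j s) ^ 2
    + 2 * of_real (\<nu> s) * of_real (c s) / (of_real (j s) * (u s - of_real (X s)))" for s
  have cont: "continuous_on {0..t} X" "continuous_on {0..t} c" "continuous_on {0..t} j" "continuous_on {0..t} u"
    using X c j u has_vector_derivative_continuous continuous_on_eq_continuous_within by blast+
  have "\<kappa> s = \<kappa> 0 * exp (integral {0..s} k)"
  proof (rule linear_ode[OF _ _ s])
    fix r assume r: "r \<in> {0..t}"
    note D = has_vector_derivative_complex_of_real[OF X[OF r]]
      has_vector_derivative_complex_of_real[OF c[OF r]] has_vector_derivative_complex_of_real[OF j[OF r]]
    have "(\<kappa> has_vector_derivative
        of_real (c r) * (2 * of_real (\<nu> r) / (u r - of_real (X r)) - of_real (X' r))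
        + of_real (\<nu> r * c r ^ 3 / j r ^ 2) * (u r - of_real (X r))
        + of_real (c r * X' r + 3 * \<nu> r * c r ^ 2 / j r)) (at r within {0..t})"
      unfolding \<kappa>_def [abs_def]
      by (intro has_vector_derivative_add has_vector_derivative_mult has_vector_derivative_diff D u r)
    moreover have "of_real (c r) * (2 * of_real (\<nu> r) / (u r - of_real (X r)) - of_real (X' r))
        + of_real (\<nu> r * c r ^ 3 / j r ^ 2) * (u r - of_real (X r))
        + of_real (c r * X' r + 3 * \<nu> r * c r ^ 2 / j r) = k r * \<kappa> r"
    proof -
      define C J l x e where "C = complex_of_real (c r)" and "J = complex_of_real (j r)"
        and "l = complex_of_real (\<nu> r)" and "x = complex_of_real (X' r)" and "e = u r - of_real (X r)"
      have "J \<noteq> 0" "e \<noteq> 0"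
        using nz(1,2)[OF r] by (auto simp: J_def e_def)
      then have "C * (2 * l / e - x) + l * C ^ 3 / J ^ 2 * e + (C * x + 3 * l * C ^ 2 / J)
          = (l * C ^ 2 / J ^ 2 + 2 * l * C / (J * e)) * (C * e + J)"
        by (simp add: field_simps power2_eq_square power3_eq_cube)
      then show ?thesis
        by (simp add: C_def J_def l_def x_def e_def k_def \<kappa>_def)
    qed
    ultimately show "(\<kappa> has_vector_derivative k r * \<kappa> r) (at r within {0..t})"
      by simp
  next
    show "continuous_on {0..t} k"
      unfolding k_def [abs_def] using nz(1,2) by (intro continuous_intros cont \<nu>) auto
  qed
  then show ?thesis
    using nz(3) by (simp add: \<kappa>_def)
qed

section \<open>Half-open time intervals and the change of clock\<close>

lemma time_interval_mono: "t \<in> time_interval T \<Longrightarrow> s \<in> {0..t} \<Longrightarrow> s \<in> time_interval T"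
  by (auto simp: time_interval_def) (metis ereal_less_eq(3) le_less_trans)

lemma time_interval_dense:
  assumes "t \<in> time_interval T"
  obtains t' where "t < t'" "t' \<in> time_interval T"
proof -
  have "ereal t < T" "0 \<le> t"
    using assms by (auto simp: time_interval_def)
  then obtain y where "ereal t < ereal y" "ereal y < T"
    using ereal_dense2 by blast
  then show thesis
    using that[of y] \<open>0 \<le> t\<close> by (simp add: time_interval_def)
qed

lemma zero_in_time_interval: "0 < T \<Longrightarrow> 0 \<in> time_interval T"
  by (simp add: time_interval_def zero_ereal_def)

lemma time_interval_ereal: "time_interval (ereal T) = {0..<T}"
  by (auto simp: time_interval_def)

text \<open>These equations keep the pole \<open>X - j / c\<close> of the chart on a trajectory of the flow driven by
  \<open>X\<close>, and turn that flow into the one driven by \<open>Y\<close>, run at speed \<open>1 / j ^ 4\<close>.\<close>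

locale chart_change =
  fixes T :: ereal and X X' c j Y :: "real \<Rightarrow> real"
  assumes T: "0 < T"
    and X: "t \<in> time_interval T \<Longrightarrow> (X has_vector_derivative X' t) (at t within {0..})"
    and c: "t \<in> time_interval T \<Longrightarrow> (c has_vector_derivative c t ^ 3 / j t ^ 2) (at t within {0..})"
    and j: "t \<in> time_interval T \<Longrightarrow>
      (j has_vector_derivative c t * X' t + 3 * c t ^ 2 / j t) (at t within {0..})"
    and Y: "t \<in> time_interval T \<Longrightarrow>
      (Y has_vector_derivative X' t / j t ^ 2 + 6 * c t / j t ^ 3) (at t within {0..})"
    and j_nz: "t \<in> time_interval T \<Longrightarrow> j t \<noteq> 0"
begin

definition "\<sigma> t = integral {0..t} (\<lambda>s. 1 / j s ^ 4)"
text \<open>An extended real because \<open>T\<close> and the new lifetime may be finite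
  independently of each other. The supremum is not attained, which makes the image of the half-open
  interval half-open again.\<close>

definition "S = (SUP t\<in>time_interval T. ereal (\<sigma> t))"
definition "\<tau> = inv_into (time_interval T) \<sigma>"
definition "H t = chart_map (X t) (Y t) (c t) (j t)"
definition "Hinv t = chart_map (Y t) (X t) (- c t) (1 / j t)"

lemma subset_deriv:
  assumes "(f has_vector_derivative f') (at t within {0..})"
  shows "(f has_vector_derivative f') (at t within {0..b})"
  by (rule has_vector_derivative_within_subset[OF assms]) auto

lemma continuous:
  assumes "t \<in> time_interval T"
  shows "continuous_on {0..t} X" "continuous_on {0..t} c" "continuous_on {0..t} j" "continuous_on {0..t} Y"
proof -
  have *: "continuous_on {0..t} f"
    if "\<And>s. s \<in> time_interval T \<Longrightarrow> (f has_vector_derivative f' s) (at s within {0..})" for f f' :: "real \<Rightarrow> real"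
    unfolding continuous_on_eq_continuous_within
    using has_vector_derivative_continuous[OF subset_deriv[OF that[OF time_interval_mono[OF assms]]]] by blast
  show "continuous_on {0..t} X" "continuous_on {0..t} c" "continuous_on {0..t} j" "continuous_on {0..t} Y"
    by (rule *, erule X c j Y)+
qed

lemma continuous_rate: "t \<in> time_interval T \<Longrightarrow> continuous_on {0..t} (\<lambda>s. 1 / j s ^ 4)"
  using j_nz time_interval_mono by (intro continuous_intros continuous) auto

lemma \<sigma>_deriv_within:
  assumes "t \<in> time_interval T" "s \<in> {0..t}"
  shows "(\<sigma> has_vector_derivative 1 / j s ^ 4) (at s within {0..t})"
  unfolding \<sigma>_def [abs_def] by (rule integral_has_vector_derivative[OF continuous_rate[OF assms(1)] assms(2)])

lemma \<sigma>_0 [simp]: "\<sigma> 0 = 0"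
  by (simp add: \<sigma>_def)

lemma \<sigma>_continuous: "t \<in> time_interval T \<Longrightarrow> continuous_on {0..t} \<sigma>"
  unfolding continuous_on_eq_continuous_within
  using has_vector_derivative_continuous[OF \<sigma>_deriv_within] by blast

lemma \<sigma>_less:
  assumes "s \<in> time_interval T" "t \<in> time_interval T" "s < t"
  shows "\<sigma> s < \<sigma> t"
proof -
  have s: "0 \<le> s"
    using assms(1) by (simp add: time_interval_def)
  have "\<exists>r\<in>{s<..<t}. \<sigma> t - \<sigma> s = (\<lambda>h. h *\<^sub>R (1 / j r ^ 4)) (t - s)"
  proof (rule mvt_simple[OF assms(3)])
    fix r assume r: "s \<le> r" "r \<le> t"
    have "(\<sigma> has_vector_derivative 1 / j r ^ 4) (at r within {s..t})"
      by (rule has_vector_derivative_within_subset[OF \<sigma>_deriv_within[OF assms(2)]]) (use r s in auto)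
    then show "(\<sigma> has_derivative (\<lambda>h. h *\<^sub>R (1 / j r ^ 4))) (at r within {s..t})"
      by (simp add: has_vector_derivative_def)
  qed
  then obtain r where r: "s < r" "r < t" "\<sigma> t - \<sigma> s = (t - s) * (1 / j r ^ 4)"
    by auto
  have "j r \<noteq> 0"
    using j_nz[OF time_interval_mono[OF assms(2), of r]] r s by auto
  then have "0 < j r ^ 4"
    by (simp add: zero_less_power_eq)
  then have "0 < (t - s) * (1 / j r ^ 4)"
    using assms(3) by simp
  then show ?thesis
    using r(3) by linarith
qed

lemma \<sigma>_strict_mono: "strict_mono_on (time_interval T) \<sigma>"
  using \<sigma>_less by (simp add: strict_mono_on_def)

lemma \<sigma>_inj: "inj_on \<sigma> (time_interval T)"
  using \<sigma>_strict_mono strict_mono_on_imp_inj_on by blast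

lemma \<sigma>_le:
  assumes "s \<in> time_interval T" "t \<in> time_interval T" "s \<le> t"
  shows "\<sigma> s \<le> \<sigma> t"
  using \<sigma>_less[OF assms(1,2)] assms(3) by (cases "s = t") auto

lemma \<sigma>_image: "t \<in> time_interval T \<Longrightarrow> \<sigma> ` {0..t} = {0..\<sigma> t}"
proof (intro equalityI subsetI)
  assume t: "t \<in> time_interval T"
  fix s assume "s \<in> \<sigma> ` {0..t}"
  then obtain r where r: "r \<in> {0..t}" "s = \<sigma> r"
    by blast
  then show "s \<in> {0..\<sigma> t}"
    using \<sigma>_le[OF time_interval_mono[OF t r(1)] t] \<sigma>_le[OF zero_in_time_interval[OF T] time_interval_mono[OF t r(1)]]
    by auto
next
  assume t: "t \<in> time_interval T"
  then have t0: "0 \<le> t"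
    by (simp add: time_interval_def)
  fix s assume s: "s \<in> {0..\<sigma> t}"
  show "s \<in> \<sigma> ` {0..t}"
    using IVT'[OF _ _ t0 \<sigma>_continuous[OF t], of s] s by auto
qed

lemma \<sigma>_range: "\<sigma> ` time_interval T = time_interval S"
proof (intro equalityI subsetI)
  fix s assume "s \<in> \<sigma> ` time_interval T"
  then obtain t where t: "t \<in> time_interval T" "s = \<sigma> t"
    by blast
  obtain t' where t': "t < t'" "t' \<in> time_interval T"
    using time_interval_dense[OF t(1)] by blast
  have "0 \<le> s"
    using \<sigma>_le[OF zero_in_time_interval[OF T] t(1)] t by (auto simp: time_interval_def)
  moreover have "ereal (\<sigma> t') \<le> S"
    unfolding S_def by (rule SUP_upper[OF t'(2)])
  then have "ereal s < S"
    using \<sigma>_less[OF t(1) t'(2,1)] t(2) by (metis ereal_less(3) less_ereal.simps(1) less_le_trans)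
  ultimately show "s \<in> time_interval S"
    by (simp add: time_interval_def)
next
  fix s assume s: "s \<in> time_interval S"
  then obtain t where t: "t \<in> time_interval T" "s < \<sigma> t"
    unfolding time_interval_def S_def by (auto simp: less_SUP_iff)
  have "s \<in> \<sigma> ` {0..t}"
    using s t by (simp add: \<sigma>_image time_interval_def)
  then show "s \<in> \<sigma> ` time_interval T"
    using time_interval_mono[OF t(1)] by blast
qed

lemma time_change_\<sigma>: "time_change T S \<sigma>"
proof -
  have "continuous_on (time_interval T) \<sigma>"
    unfolding continuous_on_eq_continuous_within
  proof
    fix t assume t: "t \<in> time_interval T"
    obtain t' where t': "t < t'" "t' \<in> time_interval T"
      using time_interval_dense[OF t] by blast
    have "continuous (at t within {0..t'}) \<sigma>"
      using \<sigma>_continuous[OF t'(2)] t t' by (auto simp: continuous_on_eq_continuous_within time_interval_def)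
    moreover have "at t within {0..t'} = at t within time_interval T"
      by (rule at_within_nhd[of t "{..<t'}"])
        (use t' time_interval_mono[OF t'(2)] in \<open>auto simp: time_interval_def\<close>)
    ultimately show "continuous (at t within time_interval T) \<sigma>"
      by simp
  qed
  then show ?thesis
    using \<sigma>_strict_mono \<sigma>_inj \<sigma>_range by (simp add: time_change_def bij_betw_def)
qed

lemma \<tau>_\<sigma> [simp]: "t \<in> time_interval T \<Longrightarrow> \<tau> (\<sigma> t) = t"
  unfolding \<tau>_def using \<sigma>_inj by simp

lemma \<tau>_mem: "s \<in> time_interval S \<Longrightarrow> \<tau> s \<in> time_interval T"
  unfolding \<tau>_def \<sigma>_range[symmetric] by (rule inv_into_into)

lemma \<sigma>_\<tau> [simp]: "s \<in> time_interval S \<Longrightarrow> \<sigma> (\<tau> s) = s"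
  unfolding \<tau>_def \<sigma>_range[symmetric] by (rule f_inv_into_f)

lemma \<sigma>_mem: "t \<in> time_interval T \<Longrightarrow> \<sigma> t \<in> time_interval S"
  using \<sigma>_range by blast

lemma S_pos: "0 < S"
  using \<sigma>_mem[OF zero_in_time_interval[OF T]] by (simp add: time_interval_def zero_ereal_def)

lemma \<tau>_0 [simp]: "\<tau> 0 = 0"
  using \<tau>_\<sigma>[OF zero_in_time_interval[OF T]] by simp

lemma \<tau>_image: "t \<in> time_interval T \<Longrightarrow> \<tau> ` {0..\<sigma> t} = {0..t}"
  using \<sigma>_image[of t] \<tau>_\<sigma> time_interval_mono by (force simp flip: \<sigma>_image)

lemma \<tau>_deriv_within:
  assumes t: "t \<in> time_interval T" and s: "s \<in> {0..\<sigma> t}"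
  shows "(\<tau> has_vector_derivative j (\<tau> s) ^ 4) (at s within {0..\<sigma> t})"
proof -
  define r where "r = \<tau> s"
  have r: "r \<in> {0..t}"
    unfolding r_def using \<tau>_image[OF t] s by blast
  have rT: "r \<in> time_interval T" "j r \<noteq> 0"
    using time_interval_mono[OF t r] j_nz by auto
  have sr: "\<sigma> r = s"
    unfolding r_def using time_interval_mono[OF \<sigma>_mem[OF t] s] by simp
  have "continuous_on (\<sigma> ` {0..t}) \<tau>"
    by (rule continuous_on_inv[OF \<sigma>_continuous[OF t]]) (use time_interval_mono[OF t] in auto)
  then have cont: "continuous (at (\<sigma> r) within \<sigma> ` {0..t}) \<tau>"
    using r by (simp add: continuous_on_eq_continuous_within)
  have "(\<tau> has_derivative (\<lambda>h. h *\<^sub>R (j r ^ 4))) (at (\<sigma> r) within \<sigma> ` {0..t})"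
  proof (rule has_derivative_inverse_within[OF _ cont r])
    show "(\<sigma> has_derivative (\<lambda>h. h *\<^sub>R (1 / j r ^ 4))) (at r within {0..t})"
      using \<sigma>_deriv_within[OF t r] by (simp add: has_vector_derivative_def)
    show "linear (\<lambda>h. h *\<^sub>R (j r ^ 4))"
      by (rule linear_scale_left)
    show "(\<lambda>h. h *\<^sub>R (j r ^ 4)) \<circ> (\<lambda>h. h *\<^sub>R (1 / j r ^ 4)) = id"
      using rT(2) by (simp add: fun_eq_iff)
    show "\<tau> (\<sigma> x) = x" if "x \<in> {0..t}" for x
      using time_interval_mono[OF t that] by simp
  qed
  then show ?thesis
    unfolding sr \<sigma>_image[OF t] by (simp add: has_vector_derivative_def r_def)
qed

lemma new_time_deriv:
  assumes t: "t \<in> time_interval T" and s: "s \<in> {0..\<sigma> t}"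
    and f: "(f has_vector_derivative f') (at (\<tau> s) within {0..t})"
  shows "((\<lambda>s. f (\<tau> s)) has_vector_derivative j (\<tau> s) ^ 4 *\<^sub>R f') (at s within {0..\<sigma> t})"
proof -
  have "(f has_vector_derivative f') (at (\<tau> s) within \<tau> ` {0..\<sigma> t})"
    using f by (simp add: \<tau>_image[OF t])
  from vector_diff_chain_within[OF \<tau>_deriv_within[OF t s] this] show ?thesis
    by (simp add: o_def)
qed

lemma old_time_deriv:
  assumes t: "t \<in> time_interval T" and r: "r \<in> {0..t}"
    and f: "(f has_vector_derivative f') (at (\<sigma> r) within {0..\<sigma> t})"
  shows "((\<lambda>r. f (\<sigma> r)) has_vector_derivative (1 / j r ^ 4) *\<^sub>R f') (at r within {0..t})"
proof -
  have "(f has_vector_derivative f') (at (\<sigma> r) within \<sigma> ` {0..t})"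
    using f by (simp add: \<sigma>_image[OF t])
  from vector_diff_chain_within[OF \<sigma>_deriv_within[OF t r] this] show ?thesis
    by (simp add: o_def)
qed

lemma denominator_nonzero:
  assumes t: "t \<in> time_interval T" and u: "loewner_solution X t z u"
    and z: "of_real (c 0) * (z - of_real (X 0)) + of_real (j 0) \<noteq> 0" and s: "s \<in> {0..t}"
  shows "of_real (c s) * (u s - of_real (X s)) + of_real (j s) \<noteq> 0"
proof (rule chart_denominator_nonzero[where t = t and X = X and c = c and j = j and u = u and s = s
      and X' = X' and \<nu> = "\<lambda>_. 1"])
  note U = loewner_solutionD[OF u]
  fix s assume s: "s \<in> {0..t}"
  note sT = time_interval_mono[OF t s]
  show "(X has_vector_derivative X' s) (at s within {0..t})"
    by (rule subset_deriv[OF X[OF sT]])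
  show "(c has_vector_derivative 1 * c s ^ 3 / j s ^ 2) (at s within {0..t})"
    using subset_deriv[OF c[OF sT]] by simp
  show "(j has_vector_derivative c s * X' s + 3 * 1 * c s ^ 2 / j s) (at s within {0..t})"
    using subset_deriv[OF j[OF sT]] by simp
  show "(u has_vector_derivative 2 * of_real 1 / (u s - of_real (X s))) (at s within {0..t})"
    using U(3)[OF s] by simp
  show "u s \<noteq> of_real (X s)" "j s \<noteq> 0"
    using U(2)[OF s] j_nz[OF sT] by auto
qed (use s z loewner_solutionD(1)[OF u] in auto)

lemma solution_forward:
  assumes t: "t \<in> time_interval T" and u: "loewner_solution X t z u"
    and z: "of_real (c 0) * (z - of_real (X 0)) + of_real (j 0) \<noteq> 0"
  shows "loewner_solution (\<lambda>s. Y (\<tau> s)) (\<sigma> t) (H 0 z) (\<lambda>s. H (\<tau> s) (u (\<tau> s)))"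
  unfolding loewner_solution_def
proof (intro conjI ballI)
  note U = loewner_solutionD[OF u]
  show "H (\<tau> 0) (u (\<tau> 0)) = H 0 z"
    by (simp add: U(1))
  fix s assume s: "s \<in> {0..\<sigma> t}"
  define r where "r = \<tau> s"
  have r: "r \<in> {0..t}"
    unfolding r_def using \<tau>_image[OF t] s by blast
  note rT = time_interval_mono[OF t r]
  note nz = U(2)[OF r] j_nz[OF rT] denominator_nonzero[OF t u z r]
  show "H (\<tau> s) (u (\<tau> s)) \<noteq> of_real (Y (\<tau> s))"
    using nz by (simp add: H_def chart_map_def r_def[symmetric])
  have "((\<lambda>s. chart_map (X s) (Y s) (c s) (j s) (u s)) has_vector_derivative
     2 * of_real (1 / j r ^ 4) / (chart_map (X r) (Y r) (c r) (j r) (u r) - of_real (Y r))) (at r within {0..t})"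
    by (rule chart_flow_deriv[where X' = "X' r"])
      (use nz U(3)[OF r] subset_deriv[OF X[OF rT]] subset_deriv[OF Y[OF rT]]
        subset_deriv[OF c[OF rT]] subset_deriv[OF j[OF rT]] in simp_all)
  then have "((\<lambda>r. H r (u r)) has_vector_derivative
     2 * of_real (1 / j r ^ 4) / (H r (u r) - of_real (Y r))) (at (\<tau> s) within {0..t})"
    by (simp add: H_def r_def)
  from new_time_deriv[OF t s this]
  have "((\<lambda>s. H (\<tau> s) (u (\<tau> s))) has_vector_derivative
      j r ^ 4 *\<^sub>R (2 * of_real (1 / j r ^ 4) / (H r (u r) - of_real (Y r)))) (at s within {0..\<sigma> t})"
    by (simp add: r_def)
  \<comment> \<open>The speed \<open>1 / j ^ 4\<close> of the image flow is exactly undone by the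
    derivative \<open>j ^ 4\<close> of the inverse clock.\<close>
  moreover have "j r ^ 4 *\<^sub>R (2 * of_real (1 / j r ^ 4) / (H r (u r) - of_real (Y r)))
      = 2 / (H r (u r) - of_real (Y r))"
    using nz(2) by (simp add: scaleR_conv_of_real)
  ultimately show "((\<lambda>s. H (\<tau> s) (u (\<tau> s))) has_vector_derivative
      2 / (H (\<tau> s) (u (\<tau> s)) - of_real (Y (\<tau> s)))) (at s within {0..\<sigma> t})"
    by (simp add: r_def)
qed

text \<open>The inverse chart change is of the same kind, with \<open>X\<close> and \<open>Y\<close> interchanged, \<open>c\<close> and \<open>j\<close>
  replaced by \<open>- c\<close> and \<open>1 / j\<close>, and speed \<open>1 / j ^ 4\<close>.\<close>

lemma inverse_derivs:
  assumes t: "t \<in> time_interval T" and s: "s \<in> {0..t}"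
  defines "Y' \<equiv> X' s / j s ^ 2 + 6 * c s / j s ^ 3" and "\<mu> \<equiv> 1 / j s ^ 4"
  shows "(Y has_vector_derivative Y') (at s within {0..t})"
    "((\<lambda>s. - c s) has_vector_derivative \<mu> * (- c s) ^ 3 / (1 / j s) ^ 2) (at s within {0..t})"
    "((\<lambda>s. 1 / j s) has_vector_derivative - c s * Y' + 3 * \<mu> * (- c s) ^ 2 / (1 / j s)) (at s within {0..t})"
    "(X has_vector_derivative Y' / (1 / j s) ^ 2 + 6 * \<mu> * (- c s) / (1 / j s) ^ 3) (at s within {0..t})"
proof -
  note sT = time_interval_mono[OF t s]
  have nz: "j s \<noteq> 0"
    by (rule j_nz[OF sT])
  show "(Y has_vector_derivative Y') (at s within {0..t})"
    unfolding Y'_def by (rule subset_deriv[OF Y[OF sT]])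
  have 1: "- (c s ^ 3 / j s ^ 2) = \<mu> * (- c s) ^ 3 / (1 / j s) ^ 2"
    using nz by (simp add: \<mu>_def field_simps eval_nat_numeral)
  show "((\<lambda>s. - c s) has_vector_derivative \<mu> * (- c s) ^ 3 / (1 / j s) ^ 2) (at s within {0..t})"
    unfolding 1[symmetric] by (rule has_vector_derivative_minus[OF subset_deriv[OF c[OF sT]]])
  have 2: "(0 * j s - 1 * (c s * X' s + 3 * c s ^ 2 / j s)) / (j s * j s)
      = - c s * Y' + 3 * \<mu> * (- c s) ^ 2 / (1 / j s)"
    using nz by (simp add: \<mu>_def Y'_def field_simps eval_nat_numeral)
  show "((\<lambda>s. 1 / j s) has_vector_derivative - c s * Y' + 3 * \<mu> * (- c s) ^ 2 / (1 / j s)) (at s within {0..t})"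
    unfolding 2[symmetric]
    by (rule has_vector_derivative_quotient[OF has_vector_derivative_const subset_deriv[OF j[OF sT]] nz])
  have 3: "X' s = Y' / (1 / j s) ^ 2 + 6 * \<mu> * (- c s) / (1 / j s) ^ 3"
    using nz by (simp add: \<mu>_def Y'_def field_simps eval_nat_numeral)
  show "(X has_vector_derivative Y' / (1 / j s) ^ 2 + 6 * \<mu> * (- c s) / (1 / j s) ^ 3) (at s within {0..t})"
    unfolding 3[symmetric] by (rule subset_deriv[OF X[OF sT]])
qed

text \<open>Being swallowed means that no solution exists. Transporting solutions forward only shows
  that survival is inherited by the image; equality of the swallowed sets requires pulling solutions
  back.\<close>

lemma solution_backward:
  assumes t: "t \<in> time_interval T" and v: "loewner_solution (\<lambda>s. Y (\<tau> s)) (\<sigma> t) z v"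
    and z: "of_real (- c 0) * (z - of_real (Y 0)) + of_real (1 / j 0) \<noteq> 0"
  shows "loewner_solution X t (Hinv 0 z) (\<lambda>r. Hinv r (v (\<sigma> r)))"
  unfolding loewner_solution_def
proof (intro conjI ballI)
  note V = loewner_solutionD[OF v]
  show "Hinv 0 (v (\<sigma> 0)) = Hinv 0 z"
    by (simp add: V(1))
  define w where "w r = v (\<sigma> r)" for r
  have mem: "\<sigma> r \<in> {0..\<sigma> t}" if "r \<in> {0..t}" for r
    using that \<sigma>_image[OF t] by blast
  have wY: "w r \<noteq> of_real (Y r)" if "r \<in> {0..t}" for r
    using V(2)[OF mem[OF that]] time_interval_mono[OF t that] by (simp add: w_def)
  have wd: "(w has_vector_derivative 2 * of_real (1 / j r ^ 4) / (w r - of_real (Y r))) (at r within {0..t})"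
    if r: "r \<in> {0..t}" for r
    using old_time_deriv[OF t r V(3)[OF mem[OF r]]] time_interval_mono[OF t r]
    by (simp add: w_def [abs_def] scaleR_conv_of_real)
  have jnz: "1 / j r \<noteq> 0" if "r \<in> {0..t}" for r
    using j_nz[OF time_interval_mono[OF t that]] by simp
  have den: "of_real (- c r) * (w r - of_real (Y r)) + of_real (1 / j r) \<noteq> 0" if r: "r \<in> {0..t}" for r
    by (rule chart_denominator_nonzero[where t = t and c = "\<lambda>r. - c r" and j = "\<lambda>r. 1 / j r",
          OF inverse_derivs(1-3)[OF t] wd continuous_rate[OF t] wY jnz _ r])
      (use z V(1) in \<open>simp_all add: w_def\<close>)
  fix r assume r: "r \<in> {0..t}"
  note rT = time_interval_mono[OF t r]
  show "Hinv r (v (\<sigma> r)) \<noteq> of_real (X r)"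
    using wY[OF r] den[OF r] jnz[OF r] by (simp add: Hinv_def chart_map_def w_def)
  have "((\<lambda>s. chart_map (Y s) (X s) (- c s) (1 / j s) (w s)) has_vector_derivative
     2 * of_real (1 / j r ^ 4 / (1 / j r) ^ 4) / (chart_map (Y r) (X r) (- c r) (1 / j r) (w r) - of_real (X r)))
     (at r within {0..t})"
    by (rule chart_flow_deriv[where c = "\<lambda>r. - c r" and j = "\<lambda>r. 1 / j r",
          OF inverse_derivs[OF t r] wd[OF r] wY[OF r] jnz[OF r] den[OF r]])
  moreover have *: "1 / j r ^ 4 / (1 / j r) ^ 4 = 1"
    using j_nz[OF rT] by (simp add: power_one_over)
  ultimately show "((\<lambda>r. Hinv r (v (\<sigma> r))) has_vector_derivative
      2 / (Hinv r (v (\<sigma> r)) - of_real (X r))) (at r within {0..t})"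
    by (simp only: Hinv_def w_def * of_real_1 mult_1_right)
qed

text \<open>The image of infinity is \<open>a / c = Y + 1 / (c j)\<close>.\<close>

lemma solution_of_infinity:
  assumes t: "t \<in> time_interval T" and cnz: "\<And>r. r \<in> {0..t} \<Longrightarrow> c r \<noteq> 0"
  shows "loewner_solution (\<lambda>s. Y (\<tau> s)) (\<sigma> t) (of_real (Y 0 + 1 / (c 0 * j 0)))
    (\<lambda>s. of_real (Y (\<tau> s) + 1 / (c (\<tau> s) * j (\<tau> s))))"
  unfolding loewner_solution_def
proof (intro conjI ballI)
  fix s assume s: "s \<in> {0..\<sigma> t}"
  define r where "r = \<tau> s"
  have r: "r \<in> {0..t}"
    unfolding r_def using \<tau>_image[OF t] s by blast
  note rT = time_interval_mono[OF t r]
  note nz = j_nz[OF rT] cnz[OF r]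
  show "complex_of_real (Y (\<tau> s) + 1 / (c (\<tau> s) * j (\<tau> s))) \<noteq> of_real (Y (\<tau> s))"
    using nz by (simp add: r_def[symmetric])
  have "((\<lambda>r. Y r + 1 / (c r * j r)) has_vector_derivative 2 * c r / j r ^ 3) (at r within {0..t})"
  proof -
    define D where "D = (X' r / j r ^ 2 + 6 * c r / j r ^ 3) + (0 * (c r * j r) - 1 *
        (c r * (c r * X' r + 3 * c r ^ 2 / j r) + c r ^ 3 / j r ^ 2 * j r)) / (c r * j r * (c r * j r))"
    have "D = 2 * c r / j r ^ 3"
      unfolding D_def using nz by (simp add: field_simps eval_nat_numeral)
    moreover have "((\<lambda>r. Y r + 1 / (c r * j r)) has_vector_derivative D) (at r within {0..t})"
      unfolding D_def using nz
      by (intro has_vector_derivative_add has_vector_derivative_quotient has_vector_derivative_mult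
          has_vector_derivative_const subset_deriv[OF Y[OF rT]] subset_deriv[OF c[OF rT]]
          subset_deriv[OF j[OF rT]]) auto
    ultimately show ?thesis
      by simp
  qed
  from new_time_deriv[OF t s this[unfolded r_def]]
  have "((\<lambda>s. Y (\<tau> s) + 1 / (c (\<tau> s) * j (\<tau> s))) has_vector_derivative
      j r ^ 4 *\<^sub>R (2 * c r / j r ^ 3)) (at s within {0..\<sigma> t})"
    by (simp add: r_def)
  from has_vector_derivative_complex_of_real[OF this]
  have "((\<lambda>s. complex_of_real (Y (\<tau> s) + 1 / (c (\<tau> s) * j (\<tau> s)))) has_vector_derivative
      of_real (j r ^ 4 *\<^sub>R (2 * c r / j r ^ 3))) (at s within {0..\<sigma> t})" .
  moreover have "complex_of_real (j r ^ 4 *\<^sub>R (2 * c r / j r ^ 3))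
      = 2 / (of_real (Y r + 1 / (c r * j r)) - of_real (Y r))"
  proof -
    have "j r ^ 4 *\<^sub>R (2 * c r / j r ^ 3) = 2 / (Y r + 1 / (c r * j r) - Y r)"
      using nz by (simp add: field_simps eval_nat_numeral)
    then show ?thesis
      by (metis of_real_diff of_real_divide of_real_numeral)
  qed
  ultimately show "((\<lambda>s. complex_of_real (Y (\<tau> s) + 1 / (c (\<tau> s) * j (\<tau> s)))) has_vector_derivative
      2 / (complex_of_real (Y (\<tau> s) + 1 / (c (\<tau> s) * j (\<tau> s))) - of_real (Y (\<tau> s)))) (at s within {0..\<sigma> t})"
    by (simp add: r_def)
qed simp

end

section \<open>Solving the equations of the chart by quadratures\<close>

lemma integral_deriv_atLeast:
  fixes f :: "real \<Rightarrow> real"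
  assumes f: "\<And>t. t \<in> time_interval T \<Longrightarrow> continuous_on {0..t} f" and t: "t \<in> time_interval T"
  shows "((\<lambda>t. integral {0..t} f) has_vector_derivative f t) (at t within {0..})"
proof -
  obtain t' where t': "t < t'" "t' \<in> time_interval T"
    using time_interval_dense[OF t] by blast
  have "((\<lambda>t. integral {0..t} f) has_vector_derivative f t) (at t within {0..t'})"
    by (rule integral_has_vector_derivative[OF f[OF t'(2)]]) (use t t' in \<open>auto simp: time_interval_def\<close>)
  then show ?thesis
    by (simp add: at_within_atLeastAtMost_eq[OF t'(1)])
qed

lemma continuous_on_time_interval:
  assumes "\<And>s. s \<in> time_interval T \<Longrightarrow> (f has_vector_derivative f' s) (at s within {0..})"
    and t: "t \<in> time_interval T"
  shows "continuous_on {0..t} f"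
  unfolding continuous_on_eq_continuous_within
proof
  fix s assume "s \<in> {0..t}"
  then have "(f has_vector_derivative f' s) (at s within {0..})"
    using assms time_interval_mono by blast
  then have "(f has_vector_derivative f' s) (at s within {0..t})"
    by (rule has_vector_derivative_within_subset) auto
  then show "continuous (at s within {0..t}) f"
    by (rule has_vector_derivative_continuous)
qed

text \<open>The system for \<open>c\<close> and \<open>j\<close> is solved from its pole. If the
  pole is the flow line \<open>u\<close> and \<open>D = X - u\<close>, then \<open>j = c * D\<close>
  and \<open>c' = c / D\<^sup>2\<close>, whence \<open>c\<close> is \<open>c0\<close> times the
  exponential of an integral. Existence on all of \<open>[0, T)\<close> thus follows from the
  survival of the pole, and the positive integrand gives the monotonicity of
  \<open>\<bar>c\<bar>\<close>. For \<open>c0 = 0\<close> the chart stays affine with constant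
  coefficients. \<open>Y\<close> is one further integral.\<close>

lemma chart_change_exists:
  assumes T: "0 < T"
    and X: "\<And>t. t \<in> time_interval T \<Longrightarrow> (X has_vector_derivative X' t) (at t within {0..})"
    and X': "\<And>t. t \<in> time_interval T \<Longrightarrow> continuous_on {0..t} X'"
    and j0: "j0 \<noteq> 0"
    and p: "\<And>t. c0 \<noteq> 0 \<Longrightarrow> t \<in> time_interval T \<Longrightarrow> loewner_solution X t (of_real (X 0 - j0 / c0)) u"
  obtains c j Y where "chart_change T X X' c j Y" "c 0 = c0" "j 0 = j0" "Y 0 = y"
    "\<And>t. c0 = 0 \<Longrightarrow> c t = 0 \<and> j t = j0"
    "\<And>t. \<lbrakk>c0 \<noteq> 0; t \<in> time_interval T\<rbrakk> \<Longrightarrow> \<bar>c0\<bar> \<le> \<bar>c t\<bar> \<and> u t = of_real (X t - j t / c t)"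
proof -
  have Xc: "continuous_on {0..t} X" if "t \<in> time_interval T" for t
    by (rule continuous_on_time_interval[OF X that])
  have *: "\<exists>c j. (\<forall>t\<in>time_interval T.
      (c has_vector_derivative c t ^ 3 / j t ^ 2) (at t within {0..}) \<and>
      (j has_vector_derivative c t * X' t + 3 * c t ^ 2 / j t) (at t within {0..}) \<and> j t \<noteq> 0) \<and>
      c 0 = c0 \<and> j 0 = j0 \<and> (c0 = 0 \<longrightarrow> (\<forall>t. c t = 0 \<and> j t = j0)) \<and>
      (c0 \<noteq> 0 \<longrightarrow> (\<forall>t\<in>time_interval T. \<bar>c0\<bar> \<le> \<bar>c t\<bar> \<and> u t = of_real (X t - j t / c t)))"
  proof (cases "c0 = 0")
    case True
    then show ?thesis
      using j0 by (intro exI[of _ "\<lambda>_. 0"] exI[of _ "\<lambda>_. j0"]) (auto intro: has_vector_derivative_const)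
  next
    case False
    note sol = p[OF False]
    have mem0: "t \<in> {0..t}" if "t \<in> time_interval T" for t
      using that by (simp add: time_interval_def)
    have ur: "u t = of_real (Re (u t))" "Re (u t) \<noteq> X t" if t: "t \<in> time_interval T" for t
    proof -
      have "Im (u t) = 0"
        by (rule loewner_real(1)[OF Xc[OF t] sol[OF t] mem0[OF t]])
      then show *: "u t = of_real (Re (u t))"
        by (simp add: complex_eq_iff)
      show "Re (u t) \<noteq> X t"
        using loewner_solutionD(2)[OF sol[OF t] mem0[OF t]] * by metis
    qed
    define D where "D t = X t - Re (u t)" for t
    have Dnz: "D t \<noteq> 0" if "t \<in> time_interval T" for t
      using ur(2)[OF that] by (simp add: D_def)
    have Dd: "(D has_vector_derivative X' t + 2 / D t) (at t within {0..})" if t: "t \<in> time_interval T" for t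
    proof -
      obtain t' where t': "t < t'" "t' \<in> time_interval T"
        using time_interval_dense[OF t] by blast
      have "(u has_vector_derivative 2 / (u t - of_real (X t))) (at t within {0..t'})"
        by (rule loewner_solutionD(3)[OF sol[OF t'(2)]]) (use t t' in \<open>auto simp: time_interval_def\<close>)
      then have "(u has_vector_derivative 2 / (u t - of_real (X t))) (at t within {0..})"
        by (simp add: at_within_atLeastAtMost_eq[OF t'(1)])
      then have "((\<lambda>t. Re (u t)) has_vector_derivative Re (2 / (u t - of_real (X t)))) (at t within {0..})"
        by (rule bounded_linear.has_vector_derivative[OF bounded_linear_Re])
      moreover have "u t - of_real (X t) = of_real (- D t)"
        using ur(1)[OF t] by (simp add: D_def complex_eq_iff)
      then have "Re (2 / (u t - of_real (X t))) = - (2 / D t)"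
        by (metis Re_complex_of_real of_real_divide of_real_numeral minus_divide_right)
      ultimately show ?thesis
        unfolding D_def [abs_def] using has_vector_derivative_diff[OF X[OF t]] by fastforce
    qed
    have Dc: "continuous_on {0..t} D" if "t \<in> time_interval T" for t
      by (rule continuous_on_time_interval[OF Dd that])
    define E where "E t = 1 / (D t)\<^sup>2" for t
    have Ec: "continuous_on {0..t} E" if t: "t \<in> time_interval T" for t
      unfolding E_def [abs_def] using Dnz time_interval_mono[OF t]
      by (intro continuous_intros Dc t) auto
    define c where "c t = c0 * exp (integral {0..t} E)" for t
    have cnz: "c t \<noteq> 0" for t
      using False by (simp add: c_def)
    have cd: "(c has_vector_derivative c t * E t) (at t within {0..})" if t: "t \<in> time_interval T" for t
    proof -
      have I: "((\<lambda>t. integral {0..t} E) has_real_derivative E t) (at t within {0..})"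
        using integral_deriv_atLeast[OF Ec t] by (simp add: has_real_derivative_iff_has_vector_derivative)
      have "(c has_real_derivative c0 * (exp (integral {0..t} E) * E t)) (at t within {0..})"
        unfolding c_def [abs_def] by (intro DERIV_cmult DERIV_chain2[OF DERIV_exp] I)
      then show ?thesis
        by (simp add: has_real_derivative_iff_has_vector_derivative c_def mult.assoc)
    qed
    define j where "j t = c t * D t" for t
    show ?thesis
    proof (rule exI[of _ c], rule exI[of _ j], intro conjI ballI impI allI)
      have X0: "u 0 = of_real (X 0 - j0 / c0)"
        using loewner_solutionD(1)[OF sol[OF zero_in_time_interval[OF T]]] .
      show "c 0 = c0" "j 0 = j0"
        using False by (auto simp: c_def j_def D_def X0)
      fix t assume t: "t \<in> time_interval T"
      note nz = Dnz[OF t] cnz[of t]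
      have "c t * E t = c t ^ 3 / j t ^ 2"
        using nz by (simp add: E_def j_def field_simps eval_nat_numeral)
      then show "(c has_vector_derivative c t ^ 3 / j t ^ 2) (at t within {0..})"
        using cd[OF t] by simp
      have "c t * (X' t + 2 / D t) + c t * E t * D t = c t * X' t + 3 * c t ^ 2 / j t"
        using nz by (simp add: E_def j_def field_simps eval_nat_numeral)
      then show "(j has_vector_derivative c t * X' t + 3 * c t ^ 2 / j t) (at t within {0..})"
        unfolding j_def [abs_def] using has_vector_derivative_mult[OF cd[OF t] Dd[OF t]] by simp
      show "j t \<noteq> 0"
        using nz by (simp add: j_def)
      show "u t = of_real (X t - j t / c t)"
        using nz ur(1)[OF t] by (simp add: j_def D_def complex_eq_iff)
      have "0 \<le> integral {0..t} E"
        by (rule integral_nonneg[OF integrable_continuous_real[OF Ec[OF t]]]) (simp add: E_def)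
      then show "\<bar>c0\<bar> \<le> \<bar>c t\<bar>"
        by (simp add: c_def abs_mult mult_le_cancel_left1)
    qed (use False in auto)
  qed
  then obtain c j where cj: "\<And>t. t \<in> time_interval T \<Longrightarrow> (c has_vector_derivative c t ^ 3 / j t ^ 2) (at t within {0..})"
    "\<And>t. t \<in> time_interval T \<Longrightarrow> (j has_vector_derivative c t * X' t + 3 * c t ^ 2 / j t) (at t within {0..})"
    "\<And>t. t \<in> time_interval T \<Longrightarrow> j t \<noteq> 0" "c 0 = c0" "j 0 = j0"
    "\<And>t. c0 = 0 \<Longrightarrow> c t = 0 \<and> j t = j0"
    "\<And>t. \<lbrakk>c0 \<noteq> 0; t \<in> time_interval T\<rbrakk> \<Longrightarrow> \<bar>c0\<bar> \<le> \<bar>c t\<bar> \<and> u t = of_real (X t - j t / c t)"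
    by blast
  define Y where "Y t = y + integral {0..t} (\<lambda>t. X' t / j t ^ 2 + 6 * c t / j t ^ 3)" for t
  have "(Y has_vector_derivative X' t / j t ^ 2 + 6 * c t / j t ^ 3) (at t within {0..})"
    if t: "t \<in> time_interval T" for t
  proof -
    have cont: "continuous_on {0..t} (\<lambda>t. X' t / j t ^ 2 + 6 * c t / j t ^ 3)" if t: "t \<in> time_interval T" for t
      using cj(3)[OF time_interval_mono[OF t]]
      by (intro continuous_intros X' t continuous_on_time_interval[OF cj(1) t]
          continuous_on_time_interval[OF cj(2) t]) auto
    have "((\<lambda>t. integral {0..t} (\<lambda>t. X' t / j t ^ 2 + 6 * c t / j t ^ 3)) has_vector_derivative
        X' t / j t ^ 2 + 6 * c t / j t ^ 3) (at t within {0..})"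
      by (rule integral_deriv_atLeast[OF cont t])
    from has_vector_derivative_add[OF has_vector_derivative_const this]
    show ?thesis
      by (simp add: Y_def [abs_def])
  qed
  then have "chart_change T X X' c j Y"
    by unfold_locales (use T X cj in auto)
  then show thesis
    by (rule that) (use cj in \<open>auto simp: Y_def\<close>)
qed

section \<open>Moebius maps of the sphere and pushforward of charges\<close>

text \<open>\<open>chart_map\<close> is a total function on the plane whose value at the pole is
  \<open>Y\<close> by the convention for division by zero. Here the pole goes to infinity, and
  infinity goes to the limit \<open>Y + 1 / (c * j)\<close> of the chart.\<close>

definition sphere_map :: "real \<Rightarrow> real \<Rightarrow> real \<Rightarrow> real \<Rightarrow> sphere \<Rightarrow> sphere" where
  "sphere_map X Y c j z = (case z of
      Some u \<Rightarrow> if of_real c * (u - of_real X) + of_real j = 0 then None else Some (chart_map X Y c j u)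
    | None \<Rightarrow> if c = 0 then None else Some (of_real (Y + 1 / (c * j))))"

lemma sphere_map_inverse:
  assumes j: "j \<noteq> 0"
  shows "sphere_map Y X (- c) (1 / j) (sphere_map X Y c j z) = z"
proof (cases z)
  case None
  show ?thesis
    using j None by (cases "c = 0") (auto simp: sphere_map_def)
next
  case (Some u)
  show ?thesis
  proof (cases "of_real c * (u - of_real X) + of_real j = 0")
    case True
    then have c: "c \<noteq> 0"
      using j by auto
    have "u - of_real X = - (of_real j / of_real c)"
      using True c by (simp add: field_simps eq_neg_iff_add_eq_0)
    then have "u = of_real (X + 1 / (- c * (1 / j)))"
      using c j by (simp add: algebra_simps)
    then show ?thesis
      using True Some c by (simp add: sphere_map_def)
  next
    case False
    then show ?thesis
      using Some chart_map_denominator[OF j False, of Y] chart_map_inverse[OF j False, of Y]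
      by (simp add: sphere_map_def)
  qed
qed

lemma sphere_map_inverse':
  assumes j: "j \<noteq> 0"
  shows "sphere_map X Y c j (sphere_map Y X (- c) (1 / j) z) = z"
  using sphere_map_inverse[of "1 / j" X Y "- c" z] j by simp

lemma sphere_map_cnj:
  "sphere_map X Y c j (map_option cnj z) = map_option cnj (sphere_map X Y c j z)"
proof (cases z)
  case (Some u)
  have "of_real c * (cnj u - of_real X) + of_real j = cnj (of_real c * (u - of_real X) + of_real j)"
    by simp
  then have "of_real c * (cnj u - of_real X) + of_real j = 0 \<longleftrightarrow> of_real c * (u - of_real X) + of_real j = 0"
    by (metis complex_cnj_zero_iff)
  then show ?thesis
    using Some by (simp add: sphere_map_def chart_map_def)
qed (simp add: sphere_map_def)

lemma Im_chart_map:
  assumes "j \<noteq> 0"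
  shows "Im (chart_map X Y c j u) = Im u / (cmod (of_real c * (u - of_real X) + of_real j))\<^sup>2"
proof -
  define e K where "e = u - of_real X" and "K = of_real c * e + of_real j"
  have "e / (K * of_real j) = of_real (1 / j) * (e / K)"
    by simp
  then have "Im (e / (K * of_real j)) = 1 / j * Im (e / K)"
    by (metis Im_complex_of_real Re_complex_of_real add_0 mult_zero_left times_complex.sel(2) add.right_neutral)
  moreover have "Im e * Re K - Re e * Im K = j * Im e"
    by (simp add: K_def algebra_simps)
  then have "Im (e / K) = j * Im e / (cmod K)\<^sup>2"
    by (simp add: Im_divide cmod_power2)
  ultimately show ?thesis
    using assms by (simp add: chart_map_def K_def e_def)
qed

text \<open>Recentring at \<open>x\<close>: the coefficients \<open>a\<close> and \<open>b\<close>
  are traded for the image point \<open>y\<close>, and \<open>d\<close> for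
  \<open>j = c * x + d\<close>, which is nonzero because the image of \<open>x\<close> is
  finite.\<close>

lemma PSL2R_sphere_map:
  assumes "\<phi> \<in> PSL2R" and "\<phi> (Some (of_real x)) \<noteq> None"
  obtains y c j where "j \<noteq> 0" "\<phi> = sphere_map x y c j" "\<phi> (Some (of_real x)) = Some (of_real y)"
proof -
  obtain a b c d where det: "a * d - b * c = 1" and \<phi>: "\<phi> = rat_map [:b, a:] [:d, c:]"
    using assms(1) by (auto simp: PSL2R_def)
  define j where "j = c * x + d"
  define y where "y = (a * x + b) / j"
  have deg: "max (degree [:b, a:]) (degree [:d, c:]) = 1"
    using det by auto
  have \<phi>_Some: "\<phi> (Some u) = sphere_quot (of_real a * u + of_real b) (of_real c * u + of_real d)" for u
    by (simp add: \<phi> rat_map_def map_poly_pCons algebra_simps)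
  have \<phi>_None: "\<phi> None = sphere_quot (of_real a) (of_real c)"
    unfolding \<phi> rat_map_def deg by simp
  have j: "j \<noteq> 0"
    using assms(2) unfolding \<phi>_Some sphere_quot_def j_def
    by (metis of_real_0 of_real_add of_real_mult)
  have detc: "of_real a * of_real d - of_real b * of_real c = (1 :: complex)"
    using det by (metis of_real_1 of_real_diff of_real_mult)
  have "\<phi> z = sphere_map x y c j z" for z
  proof (cases z)
    case None
    have "a / c = y + 1 / (c * j)" if "c \<noteq> 0"
    proof -
      have "a * j = c * (a * x + b) + 1"
        using det by (simp add: j_def algebra_simps)
      then show ?thesis
        using that j by (simp add: y_def field_simps)
    qed
    then show ?thesis
      unfolding None \<phi>_None by (auto simp: sphere_map_def sphere_quot_def simp flip: of_real_divide)
  next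
    case (Some u)
    define K where "K = of_real c * u + complex_of_real d"
    have K: "of_real c * (u - of_real x) + of_real j = K"
      by (simp add: K_def j_def algebra_simps)
    have "(of_real a * u + of_real b) / K = chart_map x y c j u" if "K \<noteq> 0"
    proof -
      define J where "J = complex_of_real j"
      have J: "J = of_real c * of_real x + of_real d" "J \<noteq> 0"
        using j unfolding J_def by (simp add: j_def, simp)
      have "(of_real a * u + of_real b) * J
          = (of_real a * of_real x + of_real b) * K + (u - of_real x) * (of_real a * of_real d - of_real b * of_real c)"
        unfolding J(1) K_def by (simp add: algebra_simps)
      then have e: "(of_real a * u + of_real b) * J = (of_real a * of_real x + of_real b) * K + (u - of_real x)"
        by (simp add: detc)
      have "chart_map x y c j u = (of_real a * of_real x + of_real b) / J + (u - of_real x) / (K * J)"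
        by (simp add: chart_map_def K y_def J_def)
      also have "\<dots> = ((of_real a * of_real x + of_real b) * K + (u - of_real x)) / (K * J)"
        using J(2) that by (simp add: add_divide_distrib)
      also have "\<dots> = (of_real a * u + of_real b) / K"
        unfolding e[symmetric] using J(2) that by simp
      finally show ?thesis
        by simp
    qed
    then show ?thesis
      unfolding Some \<phi>_Some by (simp add: sphere_map_def sphere_quot_def K K_def[symmetric])
  qed
  then have eq: "\<phi> = sphere_map x y c j"
    by blast
  show thesis
    by (rule that[OF j eq]) (use j in \<open>simp add: eq sphere_map_def chart_map_def\<close>)
qed

text \<open>For a bijection no two atoms merge, so the sum defining the pushforward has at most one
  term at each point.\<close>

lemma lookup_pushforward:
  assumes "\<And>w. \<psi> (\<phi> w) = w" "\<And>v. \<phi> (\<psi> v) = v"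
  shows "Poly_Mapping.lookup (pushforward \<phi> \<rho>) v = Poly_Mapping.lookup \<rho> (\<psi> v)"
proof -
  have "Poly_Mapping.lookup (pushforward \<phi> \<rho>) v
      = (\<Sum>w\<in>Poly_Mapping.keys \<rho>. if w = \<psi> v then Poly_Mapping.lookup \<rho> w else 0)"
    unfolding pushforward_def lookup_sum lookup_single
    by (rule sum.cong) (use assms in \<open>auto simp: when_def\<close>)
  also have "\<dots> = Poly_Mapping.lookup \<rho> (\<psi> v)"
    by (simp add: in_keys_iff)
  finally show ?thesis .
qed

lemma sum_lookup_superset:
  assumes "finite F" "Poly_Mapping.keys \<rho> \<subseteq> F"
  shows "(\<Sum>v\<in>F. Poly_Mapping.lookup \<rho> v) = (\<Sum>v\<in>Poly_Mapping.keys \<rho>. Poly_Mapping.lookup \<rho> v)"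
  by (rule sum.mono_neutral_right) (use assms in \<open>auto simp: in_keys_iff\<close>)

lemma lookup_ensemble_charge:
  "Poly_Mapping.lookup (ensemble_charge n x \<zeta> j) v
    = (\<Sum>k\<in>{1..2*n} - {j}. if Some (of_real (x k)) = v then 2 else 0) - (\<Sum>k\<in>{1..n+1}. if \<zeta> k = v then 4 else 0)"
  unfolding ensemble_charge_def lookup_minus lookup_sum lookup_single when_def ..

text \<open>The count is \<open>2 * (2 * n - 1) - 4 * (n + 1) = - 6\<close>. It is taken over the
  summands rather than over the support, by exchanging sums, so that coincidences among the points
  do not matter.\<close>

lemma total_ensemble_charge:
  assumes "j \<in> {1..2*n}"
  shows "(\<Sum>v\<in>Poly_Mapping.keys (ensemble_charge n x \<zeta> j). Poly_Mapping.lookup (ensemble_charge n x \<zeta> j) v) = - 6"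
proof -
  define \<rho> where "\<rho> = ensemble_charge n x \<zeta> j"
  \<comment> \<open>The support can be smaller than the set of listed points, since weights at a
    common point may cancel; summing over a finite superset makes each single Dirac mass count in
    full.\<close>
  define F where "F = Poly_Mapping.keys \<rho> \<union> (\<lambda>k. Some (complex_of_real (x k))) ` ({1..2*n} - {j}) \<union> \<zeta> ` {1..n+1}"
  have F: "finite F"
    by (simp add: F_def)
  have "(\<Sum>v\<in>Poly_Mapping.keys \<rho>. Poly_Mapping.lookup \<rho> v) = (\<Sum>v\<in>F. Poly_Mapping.lookup \<rho> v)"
    by (rule sum_lookup_superset[OF F, symmetric]) (auto simp: F_def)
  also have "\<dots> = (\<Sum>v\<in>F. \<Sum>k\<in>{1..2*n} - {j}. if Some (of_real (x k)) = v then 2 else 0)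
      - (\<Sum>v\<in>F. \<Sum>k\<in>{1..n+1}. if \<zeta> k = v then 4 else 0)"
    unfolding \<rho>_def lookup_ensemble_charge by (rule sum_subtractf)
  also have "(\<Sum>v\<in>F. \<Sum>k\<in>{1..2*n} - {j}. if Some (complex_of_real (x k)) = v then 2 else 0)
      = (\<Sum>k\<in>{1..2*n} - {j}. \<Sum>v\<in>F. if Some (complex_of_real (x k)) = v then 2 else (0::real))"
    by (rule sum.swap)
  also have "\<dots> = (\<Sum>k\<in>{1..2*n} - {j}. 2)"
    by (rule sum.cong) (use F in \<open>auto simp: F_def\<close>)
  also have "\<dots> = 2 * (2 * real n - 1)"
    using assms by (simp add: of_nat_diff)
  also have "(\<Sum>v\<in>F. \<Sum>k\<in>{1..n+1}. if \<zeta> k = v then 4 else 0)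
      = (\<Sum>k\<in>{1..n+1}. \<Sum>v\<in>F. if \<zeta> k = v then 4 else (0::real))"
    by (rule sum.swap)
  also have "\<dots> = (\<Sum>k\<in>{1..n+1}. 4)"
    by (rule sum.cong) (use F in \<open>auto simp: F_def\<close>)
  also have "\<dots> = 4 * (real n + 1)"
    by simp
  finally show ?thesis
    by (simp add: \<rho>_def)
qed

lemma nonreal_ensemble_charge:
  assumes "Im w \<noteq> 0"
  shows "\<exists>k::int. Poly_Mapping.lookup (ensemble_charge n x \<zeta> j) (Some w) = 4 * of_int k"
proof -
  have "(\<Sum>k\<in>{1..2*n} - {j}. if Some (complex_of_real (x k)) = Some w then 2 else 0) = (0::real)"
    by (rule sum.neutral) (use assms in auto)
  moreover obtain k :: int where "(\<Sum>k\<in>{1..n+1}. if \<zeta> k = Some w then 4 else 0) = (4 * of_int k :: real)"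
    using sum_multiples_of_four[of "{1..n+1}" "\<lambda>k. if \<zeta> k = Some w then 4 else 0"]
    by (metis mult_1_right mult_zero_right of_int_0 of_int_1)
  ultimately show ?thesis
    unfolding lookup_ensemble_charge by (intro exI[of _ "- k"]) simp
qed

section \<open>The real locus near the real axis\<close>

lemma poly_map_poly_of_real:
  "poly (map_poly of_real p) (of_real x) = complex_of_real (poly p x)"
  by (induction p) (auto simp: map_poly_pCons)

lemma pderiv_map_poly_of_real:
  "pderiv (map_poly of_real p) = (map_poly of_real (pderiv p) :: complex poly)"
  by (rule poly_eqI) (simp add: coeff_pderiv coeff_map_poly)

lemma poly_bounded_on_cball:
  fixes q :: "complex poly"
  obtains M where "0 \<le> M" "\<And>z. cmod z \<le> B \<Longrightarrow> cmod (poly q z) \<le> M"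
proof -
  have "bounded (poly q ` cball 0 B)"
    by (intro compact_imp_bounded compact_continuous_image continuous_intros) auto
  then obtain M where "\<And>z. z \<in> cball 0 B \<Longrightarrow> cmod (poly q z) \<le> M"
    by (force simp: bounded_iff)
  then show thesis
    using that[of "\<bar>M\<bar>"] by (force intro: order_trans)
qed

lemma poly_second_order:
  fixes q :: "complex poly"
  assumes B: "0 \<le> B"
  obtains C where "0 \<le> C" "\<And>a h. \<lbrakk>cmod a \<le> B; cmod h \<le> B\<rbrakk> \<Longrightarrow>
    cmod (poly q (a + h) - poly q a - h * poly (pderiv q) a) \<le> C * (cmod h)\<^sup>2"
proof -
  have "\<exists>C\<ge>0. \<forall>a h. cmod a \<le> B \<longrightarrow> cmod h \<le> B \<longrightarrow>
    cmod (poly q (a + h) - poly q a - h * poly (pderiv q) a) \<le> C * (cmod h)\<^sup>2"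
  proof (induction q)
    case 0
    show ?case
      by (rule exI[of _ 0]) simp
  next
    case (pCons k q)
    then obtain C where C: "C \<ge> 0" "\<And>a h. \<lbrakk>cmod a \<le> B; cmod h \<le> B\<rbrakk> \<Longrightarrow>
        cmod (poly q (a + h) - poly q a - h * poly (pderiv q) a) \<le> C * (cmod h)\<^sup>2"
      by blast
    obtain M where M: "0 \<le> M" "\<And>z. cmod z \<le> B \<Longrightarrow> cmod (poly (pderiv q) z) \<le> M"
      using poly_bounded_on_cball[of B "pderiv q"] by blast
    have "cmod (poly (pCons k q) (a + h) - poly (pCons k q) a - h * poly (pderiv (pCons k q)) a)
        \<le> (2 * B * C + M) * (cmod h)\<^sup>2" if ah: "cmod a \<le> B" "cmod h \<le> B" for a h
    proof -
      define \<Delta> where "\<Delta> = poly q (a + h) - poly q a - h * poly (pderiv q) a"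
      have "poly (pCons k q) (a + h) - poly (pCons k q) a - h * poly (pderiv (pCons k q)) a
          = (a + h) * \<Delta> + h\<^sup>2 * poly (pderiv q) a"
        by (simp add: \<Delta>_def pderiv_pCons algebra_simps power2_eq_square)
      also have "cmod \<dots> \<le> cmod (a + h) * cmod \<Delta> + (cmod h)\<^sup>2 * cmod (poly (pderiv q) a)"
        by (metis norm_mult norm_power norm_triangle_ineq)
      also have "\<dots> \<le> 2 * B * (C * (cmod h)\<^sup>2) + (cmod h)\<^sup>2 * M"
      proof (intro add_mono mult_mono)
        show "cmod (a + h) \<le> 2 * B"
          using norm_triangle_ineq[of a h] ah by linarith
        show "cmod \<Delta> \<le> C * (cmod h)\<^sup>2"
          unfolding \<Delta>_def by (rule C(2)[OF ah])
      qed (use M B ah in auto)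
      finally show ?thesis
        by (simp add: algebra_simps)
    qed
    moreover have "0 \<le> 2 * B * C + M"
      using B C(1) M(1) by simp
    ultimately show ?case
      by blast
  qed
  then show thesis
    using that by blast
qed

text \<open>Numerator of the derivative of \<open>P / Q\<close>. Exchanging \<open>P\<close> and
  \<open>Q\<close> only changes its sign, so it detects critical points at poles as well as
  elsewhere in the plane.\<close>

definition wronskian :: "real poly \<Rightarrow> real poly \<Rightarrow> real poly" where
  "wronskian P Q = pderiv P * Q - P * pderiv Q"

text \<open>Expansion in \<open>y\<close> at a real point: the value there is real, and the linear
  coefficient is the Wronskian. Working with \<open>P * cnj Q\<close> in place of
  \<open>P / Q\<close> avoids denominators and makes the estimate uniform across the poles.\<close>

lemma Im_quotient_near_reals:
  fixes P Q :: "real poly"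
  defines "P' \<equiv> map_poly complex_of_real P" and "Q' \<equiv> map_poly complex_of_real Q"
  assumes B: "0 \<le> B"
  obtains C where "0 \<le> C" "\<And>x y. \<lbrakk>\<bar>x\<bar> \<le> B; \<bar>y\<bar> \<le> B\<rbrakk> \<Longrightarrow>
    \<bar>Im (poly P' (Complex x y) * cnj (poly Q' (Complex x y))) - y * poly (wronskian P Q) x\<bar> \<le> C * y\<^sup>2"
proof -
  obtain C1 where C1: "0 \<le> C1" "\<And>a h. \<lbrakk>cmod a \<le> B; cmod h \<le> B\<rbrakk> \<Longrightarrow>
    cmod (poly P' (a + h) - poly P' a - h * poly (pderiv P') a) \<le> C1 * (cmod h)\<^sup>2"
    using poly_second_order[OF B] by blast
  obtain C2 where C2: "0 \<le> C2" "\<And>a h. \<lbrakk>cmod a \<le> B; cmod h \<le> B\<rbrakk> \<Longrightarrow>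
    cmod (poly Q' (a + h) - poly Q' a - h * poly (pderiv Q') a) \<le> C2 * (cmod h)\<^sup>2"
    using poly_second_order[OF B] by blast
  obtain M where M: "0 \<le> M" "\<And>z. cmod z \<le> 2 * B \<Longrightarrow> cmod (poly Q' z) \<le> M"
    using poly_bounded_on_cball[of "2 * B" Q'] by blast
  obtain M0 where M0: "0 \<le> M0" "\<And>z. cmod z \<le> B \<Longrightarrow> cmod (poly P' z) \<le> M0"
    using poly_bounded_on_cball[of B P'] by blast
  obtain M1 where M1: "0 \<le> M1" "\<And>z. cmod z \<le> B \<Longrightarrow> cmod (poly (pderiv P') z) \<le> M1"
    using poly_bounded_on_cball[of B "pderiv P'"] by blast
  define C where "C = C1 * M + (M0 + B * M1) * C2"
  show thesis
  proof (rule that[of C])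
    show "0 \<le> C"
      using C1 C2 M M0 M1 B by (simp add: C_def)
    fix x y :: real assume xy: "\<bar>x\<bar> \<le> B" "\<bar>y\<bar> \<le> B"
    define a h where "a = complex_of_real x" and "h = \<i> * complex_of_real y"
    have ah: "cmod a \<le> B" "cmod h \<le> B" "cmod h = \<bar>y\<bar>"
      using xy by (auto simp: a_def h_def norm_mult)
    have z: "Complex x y = a + h"
      by (simp add: a_def h_def complex_eq_iff)
    have real: "poly P' a = of_real (poly P x)" "poly (pderiv P') a = of_real (poly (pderiv P) x)"
      "poly Q' a = of_real (poly Q x)" "poly (pderiv Q') a = of_real (poly (pderiv Q) x)"
      by (simp_all add: P'_def Q'_def a_def pderiv_map_poly_of_real poly_map_poly_of_real)
    define E1 E2 where "E1 = poly P' (a + h) - poly P' a - h * poly (pderiv P') a"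
      and "E2 = poly Q' (a + h) - poly Q' a - h * poly (pderiv Q') a"
    define P1 Q1 where "P1 = poly P' a + h * poly (pderiv P') a" and "Q1 = poly Q' a + h * poly (pderiv Q') a"
    have PQ: "poly P' (a + h) = P1 + E1" "poly Q' (a + h) = Q1 + E2"
      by (simp_all add: P1_def Q1_def E1_def E2_def)
    \<comment> \<open>Exact, with no error term: for real coefficients the product of the two linear
      parts at height \<open>y\<close> is real except for \<open>y\<close> times the
      Wronskian.\<close>
    have "Im (P1 * cnj Q1) = y * poly (wronskian P Q) x"
      by (simp add: P1_def Q1_def real h_def wronskian_def algebra_simps)
    then have "Im (poly P' (Complex x y) * cnj (poly Q' (Complex x y))) - y * poly (wronskian P Q) x
        = Im (E1 * cnj (poly Q' (a + h)) + P1 * cnj E2)"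
      unfolding z PQ by (simp add: algebra_simps)
    also have "\<bar>\<dots>\<bar> \<le> cmod (E1 * cnj (poly Q' (a + h)) + P1 * cnj E2)"
      by (rule abs_Im_le_cmod)
    also have "\<dots> \<le> cmod E1 * cmod (poly Q' (a + h)) + cmod P1 * cmod E2"
      by (metis complex_mod_cnj norm_mult norm_triangle_ineq)
    also have "\<dots> \<le> (C1 * y\<^sup>2) * M + (M0 + B * M1) * (C2 * y\<^sup>2)"
    proof (intro add_mono mult_mono)
      show "cmod E1 \<le> C1 * y\<^sup>2" "cmod E2 \<le> C2 * y\<^sup>2"
        using C1(2)[OF ah(1,2)] C2(2)[OF ah(1,2)] by (simp_all add: E1_def E2_def ah(3))
      show "cmod (poly Q' (a + h)) \<le> M"
        by (rule M(2)) (use norm_triangle_ineq[of a h] ah in linarith)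
      have "cmod P1 \<le> cmod (poly P' a) + cmod h * cmod (poly (pderiv P') a)"
        unfolding P1_def by (metis norm_mult norm_triangle_ineq)
      also have "\<dots> \<le> M0 + B * M1"
        by (intro add_mono mult_mono M0(2) M1(2) ah B) auto
      finally show "cmod P1 \<le> M0 + B * M1" .
    qed (use C1 C2 M M0 M1 B in auto)
    also have "\<dots> = C * y\<^sup>2"
      by (simp add: C_def algebra_simps)
    finally show "\<bar>Im (poly P' (Complex x y) * cnj (poly Q' (Complex x y))) - y * poly (wronskian P Q) x\<bar>
        \<le> C * y\<^sup>2" .
  qed
qed

lemma real_locusD:
  assumes "Some z \<in> real_locus (rat_map P Q)"
  shows "Im (poly (map_poly complex_of_real P) z * cnj (poly (map_poly complex_of_real Q) z)) = 0"
proof (cases "poly (map_poly complex_of_real Q) z = 0")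
  case False
  define a b where "a = poly (map_poly complex_of_real P) z" and "b = poly (map_poly complex_of_real Q) z"
  have "a / b \<in> \<real>"
    using assms False by (auto simp: real_locus_def extended_reals_def rat_map_def sphere_quot_def a_def b_def)
  then obtain r where "a / b = of_real r"
    by (auto simp: Reals_def)
  then have "a = of_real r * b"
    using False by (simp add: b_def field_simps)
  then show ?thesis
    by (simp add: a_def[symmetric] b_def[symmetric])
qed simp

text \<open>At a simple zero one linear factor splits off and the cofactor is nonzero nearby. Where
  \<open>W\<close> does not vanish at all the bound is weaker than continuity, as
  \<open>\<bar>x - p\<bar> < 1\<close>.\<close>

lemma poly_linear_lower_bound:
  fixes W :: "real poly"
  assumes "\<not> (poly W p = 0 \<and> poly (pderiv W) p = 0)"
  obtains m \<epsilon> where "m > 0" "\<epsilon> > 0" "\<And>x. \<bar>x - p\<bar> < \<epsilon> \<Longrightarrow> m * \<bar>x - p\<bar> \<le> \<bar>poly W x\<bar>"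
proof -
  have near: "\<exists>\<epsilon>>0. \<forall>x. \<bar>x - p\<bar> < \<epsilon> \<longrightarrow> \<bar>poly V p\<bar> / 2 \<le> \<bar>poly V x\<bar>" if "poly V p \<noteq> 0" for V :: "real poly"
  proof -
    have "isCont (poly V) p"
      by (rule poly_isCont)
    moreover have "0 < \<bar>poly V p\<bar> / 2"
      using that by simp
    ultimately have "\<exists>\<epsilon>>0. \<forall>x. \<bar>x - p\<bar> < \<epsilon> \<longrightarrow> \<bar>poly V x - poly V p\<bar> < \<bar>poly V p\<bar> / 2"
      unfolding continuous_at_eps_delta dist_real_def by blast
    then obtain \<epsilon> where \<epsilon>: "\<epsilon> > 0" "\<And>x. \<bar>x - p\<bar> < \<epsilon> \<Longrightarrow> \<bar>poly V x - poly V p\<bar> < \<bar>poly V p\<bar> / 2"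
      by blast
    have "\<bar>poly V p\<bar> / 2 \<le> \<bar>poly V x\<bar>" if "\<bar>x - p\<bar> < \<epsilon>" for x
      using \<epsilon>(2)[OF that] by linarith
    then show ?thesis
      using \<epsilon>(1) by blast
  qed
  show thesis
  proof (cases "poly W p = 0")
    case False
    obtain \<epsilon> where \<epsilon>: "\<epsilon> > 0" "\<And>x. \<bar>x - p\<bar> < \<epsilon> \<Longrightarrow> \<bar>poly W p\<bar> / 2 \<le> \<bar>poly W x\<bar>"
      using near[OF False] by blast
    show thesis
    proof (rule that[of "\<bar>poly W p\<bar> / 2" "min \<epsilon> 1"])
      fix x assume x: "\<bar>x - p\<bar> < min \<epsilon> 1"
      have "\<bar>poly W p\<bar> / 2 * \<bar>x - p\<bar> \<le> \<bar>poly W p\<bar> / 2 * 1"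
        using x by (intro mult_left_mono) auto
      then show "\<bar>poly W p\<bar> / 2 * \<bar>x - p\<bar> \<le> \<bar>poly W x\<bar>"
        using \<epsilon>(2)[of x] x by linarith
    qed (use \<epsilon> False in auto)
  next
    case True
    then obtain V where V: "W = [:- p, 1:] * V"
      using poly_eq_0_iff_dvd by (metis dvdE)
    have "poly (pderiv W) p = poly V p"
      unfolding V pderiv_mult poly_add poly_mult by (simp add: pderiv_pCons)
    then have "poly V p \<noteq> 0"
      using assms True by simp
    then obtain \<epsilon> where \<epsilon>: "\<epsilon> > 0" "\<And>x. \<bar>x - p\<bar> < \<epsilon> \<Longrightarrow> \<bar>poly V p\<bar> / 2 \<le> \<bar>poly V x\<bar>"
      using near by blast
    show thesis
    proof (rule that[of "\<bar>poly V p\<bar> / 2" \<epsilon>])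
      fix x assume x: "\<bar>x - p\<bar> < \<epsilon>"
      have "poly W x = (x - p) * poly V x"
        by (simp add: V algebra_simps)
      then show "\<bar>poly V p\<bar> / 2 * \<bar>x - p\<bar> \<le> \<bar>poly W x\<bar>"
        using mult_left_mono[OF \<epsilon>(2)[OF x], of "\<bar>x - p\<bar>"] by (simp add: abs_mult mult.commute)
    qed (use \<epsilon> \<open>poly V p \<noteq> 0\<close> in auto)
  qed
qed

text \<open>On the locus the expansion gives
  \<open>\<bar>poly (wronskian P Q) x\<bar> \<le> C * y\<close>. A point at distance
  \<open>d\<close> from \<open>p\<close> with height below \<open>K * d\<^sup>2\<close> would have a
  Wronskian of order \<open>d\<close> by simplicity of the zero, but of order
  \<open>d\<^sup>2\<close> by this inequality.\<close>

lemma real_locus_not_tangential: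
  assumes simple: "\<not> (poly (wronskian P Q) p = 0 \<and> poly (pderiv (wronskian P Q)) p = 0)" and K: "0 < K"
  obtains \<epsilon> where "\<epsilon> > 0" "\<And>z. \<lbrakk>0 < Im z; cmod (z - of_real p) < \<epsilon>; Some z \<in> real_locus (rat_map P Q)\<rbrakk>
    \<Longrightarrow> K * (cmod (z - of_real p))\<^sup>2 \<le> Im z"
proof -
  obtain m \<epsilon>1 where m: "m > 0" "\<epsilon>1 > 0" "\<And>x. \<bar>x - p\<bar> < \<epsilon>1 \<Longrightarrow> m * \<bar>x - p\<bar> \<le> \<bar>poly (wronskian P Q) x\<bar>"
    using poly_linear_lower_bound[OF simple] by blast
  define B where "B = \<bar>p\<bar> + 1"
  obtain C where C: "0 \<le> C" "\<And>x y. \<lbrakk>\<bar>x\<bar> \<le> B; \<bar>y\<bar> \<le> B\<rbrakk> \<Longrightarrow>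
    \<bar>Im (poly (map_poly complex_of_real P) (Complex x y) * cnj (poly (map_poly complex_of_real Q) (Complex x y)))
      - y * poly (wronskian P Q) x\<bar> \<le> C * y\<^sup>2"
    using Im_quotient_near_reals[of B P Q] by (auto simp: B_def)
  \<comment> \<open>The bound \<open>1 / (2 * K)\<close> forces a low point to have
    \<open>y < d / 2\<close>, hence \<open>\<bar>x - p\<bar> \<ge> d / 2\<close>. The bound with
    \<open>m\<close> makes \<open>C * K * d\<^sup>2\<close> smaller than \<open>m * d / 2\<close>.
    The bound 1 keeps the coordinates within \<open>B\<close>.\<close>
  define \<epsilon> where "\<epsilon> = min (min 1 \<epsilon>1) (min (1 / (2 * K)) (m / (2 * (C * K + 1))))"
  have CK: "0 < C * K + 1"
    using C(1) K by (simp add: add_nonneg_pos)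
  show thesis
  proof (rule that[of \<epsilon>])
    show "\<epsilon> > 0"
      using m K CK by (simp add: \<epsilon>_def)
    fix z assume z: "0 < Im z" "cmod (z - of_real p) < \<epsilon>" "Some z \<in> real_locus (rat_map P Q)"
    define x y d where "x = Re z" and "y = Im z" and "d = cmod (z - of_real p)"
    have d: "d < 1" "d < \<epsilon>1" "d < 1 / (2 * K)" "d < m / (2 * (C * K + 1))" "0 \<le> d"
      using z(2) by (auto simp: d_def \<epsilon>_def)
    have xd: "\<bar>x - p\<bar> \<le> d" "y \<le> d" "d \<le> \<bar>x - p\<bar> + y"
      using abs_Re_le_cmod[of "z - of_real p"] abs_Im_le_cmod[of "z - of_real p"]
        cmod_le[of "z - of_real p"] z(1) by (auto simp: x_def y_def d_def)
    show "K * d\<^sup>2 \<le> Im z"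
    proof (rule ccontr)
      assume "\<not> K * d\<^sup>2 \<le> Im z"
      then have y: "y < K * d\<^sup>2" "0 < y"
        using z(1) by (auto simp: y_def)
      then have d0: "0 < d"
        using d(5) by (cases "d = 0") auto
      have "K * d \<le> 1 / 2"
        using d(3) K by (simp add: field_simps)
      then have "K * d * d \<le> 1 / 2 * d"
        using d0 by (intro mult_right_mono) auto
      then have y2: "y < d / 2"
        using y(1) by (simp add: power2_eq_square mult.assoc)
      have "m * (d / 2) \<le> m * \<bar>x - p\<bar>"
        using xd(3) y2 m(1) by (intro mult_left_mono) linarith+
      also have "\<dots> \<le> \<bar>poly (wronskian P Q) x\<bar>"
        using m(3)[of x] xd(1) d(2) by simp
      finally have W: "m * (d / 2) \<le> \<bar>poly (wronskian P Q) x\<bar>" .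
      have "\<bar>y * poly (wronskian P Q) x\<bar> \<le> C * y\<^sup>2"
      proof -
        have "\<bar>x\<bar> \<le> B" "\<bar>y\<bar> \<le> B"
          using xd d(1) y(2) by (auto simp: B_def)
        moreover have "Complex x y = z"
          by (simp add: x_def y_def)
        ultimately show ?thesis
          using C(2)[of x y] real_locusD[OF z(3)] by simp
      qed
      then have "y * \<bar>poly (wronskian P Q) x\<bar> \<le> y * (C * y)"
        using y(2) by (simp add: abs_mult power2_eq_square algebra_simps)
      then have "\<bar>poly (wronskian P Q) x\<bar> \<le> C * y"
        using y(2) by (simp add: mult_le_cancel_left)
      also have "\<dots> \<le> C * (K * d\<^sup>2)"
        using C(1) y(1) by (intro mult_left_mono) auto
      also have "\<dots> \<le> (C * K + 1) * d * d"
        by (simp add: power2_eq_square algebra_simps)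
      also have "\<dots> < m / 2 * d"
      proof (rule mult_strict_right_mono[OF _ d0])
        show "(C * K + 1) * d < m / 2"
          using d(4) CK by (simp add: field_simps)
      qed
      finally show False
        using W by simp
    qed
  qed
qed

section \<open>Degree of the Wronskian and simplicity of critical points\<close>

text \<open>The naive bound is \<open>2 * n + 1\<close>. The Wronskian does not change when a
  multiple of \<open>P\<close> is subtracted from \<open>Q\<close>, so one polynomial may be taken
  of degree at most \<open>n\<close>. The result is the Riemann-Hurwitz count
  \<open>2 * (n + 1) - 2\<close>.\<close>

lemma wronskian_degree:
  assumes "degree P \<le> Suc n" "degree Q \<le> Suc n"
  shows "degree (wronskian P Q) \<le> 2 * n"
proof -
  have low: "degree (wronskian P Q) \<le> 2 * n"
    if P: "degree P \<le> n" and Q: "degree Q \<le> Suc n" for P Q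
  proof -
    have "degree (P * pderiv Q) \<le> n + n"
      using degree_mult_le[of P "pderiv Q"] P Q by (simp add: degree_pderiv)
    moreover have "degree (pderiv P * Q) \<le> n + n"
    proof (cases "degree P = 0")
      case True
      then show ?thesis
        by (simp add: pderiv_eq_0_iff[THEN iffD2])
    next
      case False
      then show ?thesis
        using degree_mult_le[of "pderiv P" Q] P Q by (simp add: degree_pderiv)
    qed
    ultimately show ?thesis
      unfolding wronskian_def using degree_diff_le_max[of "pderiv P * Q" "P * pderiv Q"] by simp
  qed
  show ?thesis
  proof (cases "degree P \<le> n")
    case True
    then show ?thesis
      using low assms(2) by blast
  next
    case False
    then have P: "degree P = Suc n" "coeff P (Suc n) \<noteq> 0"
      using assms(1) by (auto simp: le_Suc_eq) (metis leading_coeff_neq_0 degree_0 old.nat.distinct(1))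
    define k where "k = coeff Q (Suc n) / coeff P (Suc n)"
    define Q' where "Q' = Q - smult k P"
    have "degree Q' \<le> Suc n"
      unfolding Q'_def using degree_diff_le[OF assms(2), of "smult k P"] assms(1) degree_smult_le[of k P] by simp
    moreover have "coeff Q' (Suc n) = 0"
      using P(2) by (simp add: Q'_def k_def)
    ultimately have "degree Q' \<le> n"
      by (metis eq_zero_or_degree_less le_0_eq degree_0 less_Suc_eq_le le_SucE leading_coeff_0_iff zero_le)
    then have "degree (wronskian Q' P) \<le> 2 * n"
      using low assms(1) by blast
    moreover have "wronskian P Q = - wronskian Q' P"
      by (simp add: wronskian_def Q'_def pderiv_diff pderiv_smult algebra_simps)
    ultimately show ?thesis
      by simp
  qed
qed

text \<open>If the Wronskian vanished, \<open>P / Q\<close> would be constant beyond the last real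
  root of \<open>Q\<close>, so \<open>P\<close> would be a multiple of \<open>Q\<close>; coprimality
  then makes both constant.\<close>

lemma wronskian_nonzero:
  assumes cop: "coprime P Q" and Q: "Q \<noteq> 0" and deg: "0 < max (degree P) (degree Q)"
  shows "wronskian P Q \<noteq> 0"
proof
  assume "wronskian P Q = 0"
  then have eq: "poly (pderiv P) x * poly Q x - poly P x * poly (pderiv Q) x = 0" for x
    by (metis poly_0 poly_diff poly_mult wronskian_def)
  obtain M where M: "\<And>x. poly Q x = 0 \<Longrightarrow> x < M"
  proof -
    have "bdd_above {x. poly Q x = 0}"
      using poly_roots_finite[OF Q] by (rule bdd_above_finite)
    then obtain B where "\<And>x. poly Q x = 0 \<Longrightarrow> x \<le> B"
      by (auto simp: bdd_above_def)
    then show thesis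
      using that[of "B + 1"] by force
  qed
  have "\<exists>k. \<forall>x\<in>{M..}. poly P x / poly Q x = k"
  proof (rule has_field_derivative_zero_constant)
    fix x assume "x \<in> {M..}"
    then have "poly Q x \<noteq> 0"
      using M[of x] by auto
    then have "((\<lambda>x. poly P x / poly Q x) has_field_derivative
        (poly (pderiv P) x * poly Q x - poly P x * poly (pderiv Q) x) / (poly Q x * poly Q x)) (at x)"
      by (intro DERIV_divide poly_DERIV)
    then show "((\<lambda>x. poly P x / poly Q x) has_field_derivative 0) (at x within {M..})"
      unfolding eq by (simp add: has_field_derivative_at_within)
  qed simp
  then obtain k where k: "\<And>x. M \<le> x \<Longrightarrow> poly P x / poly Q x = k"
    by auto
  have "poly (P - smult k Q) x = 0" if "M \<le> x" for x
    using k[OF that] M[of x] that by (auto simp: field_simps)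
  then have "{M..} \<subseteq> {x. poly (P - smult k Q) x = 0}"
    by auto
  then have "infinite {x. poly (P - smult k Q) x = 0}"
    using infinite_Ici infinite_super by blast
  then have "P - smult k Q = 0"
    using poly_roots_finite by blast
  then have P: "P = smult k Q"
    by simp
  then have "is_unit Q"
    using cop coprime_common_divisor[of P Q Q] by (simp add: dvd_smult)
  then have "degree Q = 0"
    by (auto simp: is_unit_poly_iff)
  then show False
    using deg P degree_smult_le[of k Q] by simp
qed

lemma critical_point_wronskian:
  assumes crit: "Some (complex_of_real a) \<in> critical_points (rat_map P Q)" and cop: "coprime P Q"
  shows "poly (wronskian P Q) a = 0"
proof -
  define P' Q' where "P' = map_poly complex_of_real P" and "Q' = map_poly complex_of_real Q"
  define R where "R = rat_map P Q"
  define F where "F u = sphere_chart (R (Some (of_real a))) (R (Some u))" for u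
  have F: "(F has_field_derivative 0) (at (of_real a))"
    using crit unfolding critical_points_def F_def [abs_def] R_def
    by (simp add: sphere_chart_inv_def sphere_chart_def[of "Some _" "Some _"])
  have R: "R (Some u) = sphere_quot (poly P' u) (poly Q' u)" for u
    by (simp add: R_def rat_map_def P'_def Q'_def)
  have real: "poly P' (of_real a) = of_real (poly P a)" "poly (pderiv P') (of_real a) = of_real (poly (pderiv P) a)"
      "poly Q' (of_real a) = of_real (poly Q a)" "poly (pderiv Q') (of_real a) = of_real (poly (pderiv Q) a)"
    by (simp_all add: P'_def Q'_def pderiv_map_poly_of_real poly_map_poly_of_real)
  show ?thesis
  proof (cases "poly Q a = 0")
    case False
    define U where "U = {u. poly Q' u \<noteq> 0}"
    have "open U"
      unfolding U_def by (intro open_Collect_neq continuous_intros)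
    have aU: "of_real a \<in> U"
      using False by (simp add: U_def real)
    have "F u = poly P' u / poly Q' u" if "u \<in> U" for u
      using that aU by (simp add: F_def R sphere_quot_def sphere_chart_def U_def)
    then have "((\<lambda>u. poly P' u / poly Q' u) has_field_derivative 0) (at (of_real a))"
      using has_field_derivative_transform_within_open[OF F \<open>open U\<close> aU] by simp
    moreover have "((\<lambda>u. poly P' u / poly Q' u) has_field_derivative
        (poly (pderiv P') (of_real a) * poly Q' (of_real a) - poly P' (of_real a) * poly (pderiv Q') (of_real a))
        / (poly Q' (of_real a) * poly Q' (of_real a))) (at (of_real a))"
      using aU by (intro DERIV_divide poly_DERIV) (simp add: U_def)
    ultimately have "poly (pderiv P') (of_real a) * poly Q' (of_real a) - poly P' (of_real a) * poly (pderiv Q') (of_real a) = 0"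
      using DERIV_unique aU by (fastforce simp: U_def)
    then have "complex_of_real (poly (wronskian P Q) a) = 0"
      by (simp add: wronskian_def real)
    then show ?thesis
      by simp
  next
    case True
    have Pa: "poly P a \<noteq> 0"
    proof
      assume "poly P a = 0"
      then have "[:- a, 1:] dvd P" "[:- a, 1:] dvd Q"
        using True by (simp_all add: poly_eq_0_iff_dvd)
      then have "is_unit [:- a, 1:]"
        using cop coprime_common_divisor by blast
      then show False
        by (simp add: is_unit_poly_iff)
    qed
    \<comment> \<open>At a pole the target chart is \<open>1 / z\<close>. The equation holds for
      every \<open>u\<close>: the chart value 0 at infinity agrees with the quotient at zeros of
      \<open>Q'\<close>, and at zeros of \<open>P'\<close> both sides are 0 by the convention for
      division.\<close>
    have "F = (\<lambda>u. poly Q' u / poly P' u)"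
      using True by (auto simp: F_def R sphere_quot_def sphere_chart_def real)
    moreover have "((\<lambda>u. poly Q' u / poly P' u) has_field_derivative
        (poly (pderiv Q') (of_real a) * poly P' (of_real a) - poly Q' (of_real a) * poly (pderiv P') (of_real a))
        / (poly P' (of_real a) * poly P' (of_real a))) (at (of_real a))"
      using Pa by (intro DERIV_divide poly_DERIV) (simp add: real)
    ultimately have "poly (pderiv Q') (of_real a) * poly P' (of_real a) - poly Q' (of_real a) * poly (pderiv P') (of_real a) = 0"
      using DERIV_unique F Pa by (fastforce simp: real)
    then have "complex_of_real (poly (wronskian P Q) a) = 0"
      by (simp add: wronskian_def real mult.commute)
    then show ?thesis
      by simp
  qed
qed

text \<open>The degree bound forces all critical points to be simple.\<close>

lemma CRR_not_tangential:
  assumes R: "R \<in> CRR (n + 1) A" and A: "finite A" "card A = 2 * n" and K: "0 < K"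
  obtains \<epsilon> where "\<epsilon> > 0" "\<And>z. \<lbrakk>0 < Im z; cmod (z - of_real p) < \<epsilon>; Some z \<in> real_locus R\<rbrakk>
    \<Longrightarrow> K * (cmod (z - of_real p))\<^sup>2 \<le> Im z"
proof -
  obtain P Q where PQ: "coprime P Q" "max (degree P) (degree Q) = n + 1" "R = rat_map P Q" "Q \<noteq> 0"
    and crit: "critical_points R = (\<lambda>r. Some (complex_of_real r)) ` A"
    using R by (auto simp: CRR_def)
  define W where "W = wronskian P Q"
  have W0: "W \<noteq> 0"
    unfolding W_def by (rule wronskian_nonzero[OF PQ(1,4)]) (simp add: PQ(2))
  have degW: "degree W \<le> 2 * n"
    unfolding W_def by (rule wronskian_degree) (use PQ(2) in auto)
  have root: "poly W a = 0" if "a \<in> A" for a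
    unfolding W_def by (rule critical_point_wronskian[OF _ PQ(1)]) (use crit that PQ(3) in auto)
  have "\<not> (poly W p = 0 \<and> poly (pderiv W) p = 0)"
  proof
    assume p: "poly W p = 0 \<and> poly (pderiv W) p = 0"
    have dW: "pderiv W \<noteq> 0"
    proof
      assume "pderiv W = 0"
      then have "degree W = 0"
        by (simp add: pderiv_eq_0_iff)
      then obtain k where "W = [:k:]"
        by (rule degree_eq_zeroE)
      then show False
        using p W0 by simp
    qed
    have fin: "finite {x. poly W x = 0}"
      using poly_roots_finite[OF W0] .
    have "order p W = Suc (order p (pderiv W))"
      using order_pderiv W0 p by blast
    moreover have "order p (pderiv W) \<noteq> 0"
      using order_root[of "pderiv W" p] p dW by blast
    ultimately have o2: "2 \<le> order p W"
      by linarith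
    have o1: "1 \<le> order a W" if "a \<in> A" for a
      using order_root[of W a] root[OF that] W0 by simp
    \<comment> \<open>Whether or not \<open>p\<close> belongs to \<open>A\<close>, the simple count
      of the other points together with order at least 2 at \<open>p\<close> exceeds the degree
      bound \<open>2 * n\<close>.\<close>
    have "2 * n + 1 \<le> card (A - {p}) + 2"
      using A by (cases "p \<in> A") (auto simp: card_Diff_singleton)
    also have "\<dots> \<le> (\<Sum>a\<in>A - {p}. order a W) + order p W"
      using sum_mono[of "A - {p}" "\<lambda>_. 1" "\<lambda>a. order a W"] o1 o2 by simp
    also have "\<dots> = (\<Sum>a\<in>insert p (A - {p}). order a W)"
      using A(1) by (subst sum.insert) simp_all
    also have "\<dots> \<le> (\<Sum>a | poly W a = 0. order a W)"
      by (rule sum_mono2[OF fin]) (use p root in auto)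
    also have "\<dots> \<le> degree W"
      by (rule sum_order_le_degree[OF W0])
    finally show False
      using degW by simp
  qed
  then show thesis
    using real_locus_not_tangential[OF _ K, of P Q p] that unfolding PQ(3) W_def by blast
qed

section \<open>The image chain\<close>

lemma finite_finite_support: "finite (finite_support \<rho>)"
proof -
  have "finite_support \<rho> = Some -` Poly_Mapping.keys \<rho>"
    by (auto simp: finite_support_def)
  then show ?thesis
    by (simp add: finite_vimageI)
qed

text \<open>Everything in an \<open>SLE0_chain\<close> except symmetry and the condition at the end
  of the lifetime. This part transfers directly to the new chart, so its consequences are available
  for the image chain before anything is known about how that chain ends.\<close>

locale loewner_charges =
  fixes x :: real and \<rho> :: charge and T :: ereal and X :: "real \<Rightarrow> real" and g :: "real \<Rightarrow> complex \<Rightarrow> complex"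
  assumes T_pos: "0 < T" and X_0: "X 0 = x" and chain: "loewner_chain T X g"
    and alive: "t \<in> time_interval T \<Longrightarrow> finite_support \<rho> \<inter> swallowed X t = {}"
    and driving: "t \<in> time_interval T \<Longrightarrow> ((\<lambda>s. complex_of_real (X s)) has_vector_derivative
      (\<Sum>w\<in>finite_support \<rho>. of_real (Poly_Mapping.lookup \<rho> (Some w)) / (of_real (X t) - g t w)))
      (at t within {0..})"
begin

definition "speed t = Re (\<Sum>w\<in>finite_support \<rho>.
  of_real (Poly_Mapping.lookup \<rho> (Some w)) / (of_real (X t) - g t w))"

lemma flow: "\<lbrakk>t \<in> time_interval T; z \<notin> swallowed X t\<rbrakk> \<Longrightarrow> loewner_solution X t z (\<lambda>s. g s z)"
  using chain by (auto simp: loewner_chain_def)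

lemma not_swallowedI: "loewner_solution X t z u \<Longrightarrow> z \<notin> swallowed X t"
  by (auto simp: swallowed_def)

lemma charge_flow:
  "\<lbrakk>t \<in> time_interval T; w \<in> finite_support \<rho>\<rbrakk> \<Longrightarrow> loewner_solution X t w (\<lambda>s. g s w)"
  using flow alive by blast

lemma X_deriv: "t \<in> time_interval T \<Longrightarrow> (X has_vector_derivative speed t) (at t within {0..})"
  using bounded_linear.has_vector_derivative[OF bounded_linear_Re driving] by (simp add: speed_def)

lemma X_continuous: "t \<in> time_interval T \<Longrightarrow> continuous_on {0..t} X"
  by (rule continuous_on_time_interval[OF X_deriv])

text \<open>The sum is the derivative of a real-valued function, hence real by uniqueness of
  derivatives on a nondegenerate interval.\<close>

lemma of_real_speed:
  assumes t: "t \<in> time_interval T"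
  shows "(\<Sum>w\<in>finite_support \<rho>. of_real (Poly_Mapping.lookup \<rho> (Some w)) / (of_real (X t) - g t w))
    = complex_of_real (speed t)"
proof (rule vector_derivative_unique_within_closed_interval[where a = 0 and b = "t + 1" and x = t])
  show "0 < t + 1" "t \<in> cbox 0 (t + 1)"
    using t by (auto simp: time_interval_def)
  show "((\<lambda>s. complex_of_real (X s)) has_vector_derivative (\<Sum>w\<in>finite_support \<rho>.
      of_real (Poly_Mapping.lookup \<rho> (Some w)) / (of_real (X t) - g t w))) (at t within cbox 0 (t + 1))"
    by (rule has_vector_derivative_within_subset[OF driving[OF t]]) auto
  show "((\<lambda>s. complex_of_real (X s)) has_vector_derivative of_real (speed t)) (at t within cbox 0 (t + 1))"
    by (rule has_vector_derivative_within_subset[OF has_vector_derivative_complex_of_real[OF X_deriv[OF t]]]) auto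
qed

lemma speed_continuous:
  assumes t: "t \<in> time_interval T"
  shows "continuous_on {0..t} speed"
  unfolding speed_def [abs_def]
proof (intro continuous_intros X_continuous[OF t])
  fix w assume w: "w \<in> finite_support \<rho>"
  note W = loewner_solutionD[OF charge_flow[OF t w]]
  show "continuous_on {0..t} (\<lambda>s. g s w)"
    by (rule W(4))
  show "\<forall>s\<in>{0..t}. complex_of_real (X s) - g s w \<noteq> 0"
    using W(2) by (metis right_minus_eq)
qed

text \<open>On \<open>[0, t]\<close> with \<open>t\<close> before the lifetime the driving speed is
  continuous, hence bounded, and the repulsion argument applies. In particular the pole of the chart
  survives.\<close>

lemma real_alive:
  assumes t: "t \<in> time_interval T" and p: "p \<noteq> x"
  shows "loewner_solution X t (of_real p) (\<lambda>s. g s (of_real p))"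
proof -
  have "bounded (speed ` {0..t})"
    by (intro compact_imp_bounded compact_continuous_image speed_continuous t) auto
  then obtain C where C: "\<And>s. s \<in> {0..t} \<Longrightarrow> \<bar>speed s\<bar> \<le> C"
    by (force simp: bounded_iff)
  obtain u where "loewner_solution X t (of_real p) u"
  proof (rule loewner_real_solution[where X' = speed])
    show "(X has_vector_derivative speed s) (at s within {0..t})" if "s \<in> {0..t}" for s
      by (rule has_vector_derivative_within_subset[OF X_deriv[OF time_interval_mono[OF t that]]]) auto
    show "p \<noteq> X 0"
      using p by (simp add: X_0)
  qed (use C in auto)
  then show ?thesis
    using flow[OF t] not_swallowedI by blast
qed

text \<open>Openness of survival around a real point yields surviving points of the half-plane just
  above it. They decide which component of the complement of the curve reaches the real axis
  there.\<close>

lemma alive_near: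
  assumes t: "t \<in> time_interval T" and p: "p \<noteq> x" and r: "0 < r"
  obtains \<epsilon> where "0 < \<epsilon>" "\<epsilon> < r" "Complex p \<epsilon> \<in> upper_half_plane - swallowed X t"
proof -
  obtain \<delta> K where \<delta>: "\<delta> > 0" "\<And>z'. cmod (z' - of_real p) < \<delta> \<Longrightarrow> \<exists>v. loewner_solution X t z' v \<and>
       (\<forall>s\<in>{0..t}. cmod (v s - g s (of_real p)) \<le> K * cmod (z' - of_real p))"
    using loewner_stable[OF X_continuous[OF t] real_alive[OF t p]] by blast
  define \<epsilon> where "\<epsilon> = min \<delta> r / 2"
  have \<epsilon>: "0 < \<epsilon>" "\<epsilon> < \<delta>" "\<epsilon> < r"
    using \<delta>(1) r by (auto simp: \<epsilon>_def min_def)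
  have "cmod (Complex p \<epsilon> - of_real p) < \<delta>"
    using \<epsilon> by (simp add: cmod_def)
  then have "Complex p \<epsilon> \<notin> swallowed X t"
    using \<delta>(2) not_swallowedI by blast
  then show thesis
    using that[of \<epsilon>] \<epsilon> by (simp add: upper_half_plane_def)
qed

text \<open>A half-disc that avoids the curve lies in one component of its complement, and it contains
  points that survive, since its centre does.\<close>

lemma ball_alive:
  assumes t: "t \<in> time_interval T" and r: "0 < r"
    and comp: "upper_half_plane - swallowed X t \<in> components (upper_half_plane - \<Gamma>)"
    and disj: "ball (of_real q) r \<inter> upper_half_plane \<inter> \<Gamma> = {}" and x: "of_real x \<notin> ball (complex_of_real q) r"
    and z: "z \<in> ball (of_real q) r"
  shows "loewner_solution X t z (\<lambda>s. g s z)"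
proof -
  have q: "q \<noteq> x"
    using x r by auto
  define D where "D = ball (complex_of_real q) r \<inter> upper_half_plane"
  have "convex upper_half_plane"
    unfolding upper_half_plane_def by (rule convex_halfspace_Im_gt)
  then have "connected D"
    unfolding D_def by (intro convex_connected convex_Int convex_ball)
  moreover obtain \<epsilon> where \<epsilon>: "0 < \<epsilon>" "\<epsilon> < r" "Complex q \<epsilon> \<in> upper_half_plane - swallowed X t"
    using alive_near[OF t q r] .
  moreover have "Complex q \<epsilon> \<in> D"
    using \<epsilon> by (auto simp: D_def dist_norm cmod_def)
  moreover have "D \<subseteq> upper_half_plane - \<Gamma>"
    using disj by (auto simp: D_def)
  ultimately have D: "D \<subseteq> upper_half_plane - swallowed X t"
    using components_maximal[OF comp] by blast
  have "z \<notin> swallowed X t"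
  proof (cases "Im z" "0 :: real" rule: linorder_cases)
    case less
    have "cnj z \<in> D"
      using z less by (auto simp: D_def upper_half_plane_def dist_norm)
        (metis complex_cnj_complex_of_real complex_cnj_diff complex_mod_cnj)
    then have "cnj z \<notin> swallowed X t"
      using D by blast
    from loewner_solution_cnj[OF flow[OF t this]] show ?thesis
      using not_swallowedI by simp
  next
    case equal
    then have zr: "z = of_real (Re z)"
      by (simp add: complex_eq_iff)
    have "Re z \<noteq> x"
      using x z zr by metis
    then show ?thesis
      using not_swallowedI[OF real_alive[OF t]] zr by metis
  next
    case greater
    then have "z \<in> D"
      using z by (simp add: D_def upper_half_plane_def)
    then show ?thesis
      using D by blast
  qed
  then show ?thesis
    by (rule flow[OF t])
qed

end

lemma SLE0_chain_iff:
  "SLE0_chain x \<rho> T X g \<longleftrightarrow> conj_symmetric \<rho> \<and> loewner_charges x \<rho> T X g \<and>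
    (\<forall>T'. T = ereal T' \<longrightarrow> (\<exists>w\<in>finite_support \<rho>. ((\<lambda>t. of_real (X t) - g t w) \<longlongrightarrow> 0) (at_left T')))"
  unfolding SLE0_chain_def loewner_charges_def by blast

text \<open>\<open>c_zero\<close> and \<open>c_nonzero\<close> record how the chart was built: it
  stays affine, or its pole is the flow line of the point sent to infinity and
  \<open>\<bar>c\<bar>\<close> never drops below its initial value.\<close>

locale charged_chart = loewner_charges x \<rho> T X g + chart_change T X X' c j Y
  for x \<rho> T X g X' c j Y +
  assumes total: "(\<Sum>v\<in>Poly_Mapping.keys \<rho>. Poly_Mapping.lookup \<rho> v) = - 6"
    and c_zero: "c 0 = 0 \<Longrightarrow> c t = 0 \<and> j t = j 0"
    and c_nonzero: "\<lbrakk>c 0 \<noteq> 0; t \<in> time_interval T\<rbrakk> \<Longrightarrow>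
      \<bar>c 0\<bar> \<le> \<bar>c t\<bar> \<and> g t (of_real (X 0 - j 0 / c 0)) = of_real (X t - j t / c t)"
begin

definition "\<phi> = sphere_map (X 0) (Y 0) (c 0) (j 0)"
definition "\<psi> = sphere_map (Y 0) (X 0) (- c 0) (1 / j 0)"
definition "new_Y s = Y (\<tau> s)"
text \<open>The image of infinity has no preimage in the plane, so its trajectory is prescribed
  separately as the image of infinity under \<open>H\<close>.\<close>

definition "new_g s z = (case \<psi> (Some z) of
    None \<Rightarrow> of_real (Y (\<tau> s) + 1 / (c (\<tau> s) * j (\<tau> s)))
  | Some w \<Rightarrow> H (\<tau> s) (g (\<tau> s) w))"
definition "new_\<rho> = pushforward \<phi> \<rho>"

lemma zero_mem: "0 \<in> time_interval T"
  by (rule zero_in_time_interval[OF T])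

lemma j0: "j 0 \<noteq> 0"
  by (rule j_nz[OF zero_mem])

lemma \<psi>_\<phi>: "\<psi> (\<phi> v) = v" and \<phi>_\<psi>: "\<phi> (\<psi> v) = v"
  unfolding \<phi>_def \<psi>_def using sphere_map_inverse sphere_map_inverse' j0 by auto

lemma \<phi>_Some: "\<phi> (Some w) = (if of_real (c 0) * (w - of_real (X 0)) + of_real (j 0) = 0 then None else Some (H 0 w))"
  by (simp add: \<phi>_def sphere_map_def H_def)

lemma \<phi>_None: "\<phi> None = (if c 0 = 0 then None else Some (of_real (Y 0 + 1 / (c 0 * j 0))))"
  by (simp add: \<phi>_def sphere_map_def)

lemma \<psi>_Some: "\<psi> (Some z) = (if of_real (- c 0) * (z - of_real (Y 0)) + of_real (1 / j 0) = 0 then None else Some (Hinv 0 z))"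
  by (simp add: \<psi>_def sphere_map_def Hinv_def)

lemma \<psi>_SomeD:
  assumes "\<psi> (Some z) = Some w"
  shows "of_real (c 0) * (w - of_real (X 0)) + of_real (j 0) \<noteq> 0" "H 0 w = z"
    "of_real (- c 0) * (z - of_real (Y 0)) + of_real (1 / j 0) \<noteq> 0" "Hinv 0 z = w"
proof -
  have "\<phi> (Some w) = Some z"
    using \<phi>_\<psi>[of "Some z"] assms by simp
  then show "of_real (c 0) * (w - of_real (X 0)) + of_real (j 0) \<noteq> 0" "H 0 w = z"
    unfolding \<phi>_Some by (simp_all split: if_splits)
  show "of_real (- c 0) * (z - of_real (Y 0)) + of_real (1 / j 0) \<noteq> 0" "Hinv 0 z = w"
    using assms unfolding \<psi>_Some by (simp_all split: if_splits)
qed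

lemma \<psi>_NoneD:
  assumes "\<psi> (Some z) = None"
  shows "c 0 \<noteq> 0" "z = of_real (Y 0 + 1 / (c 0 * j 0))"
proof -
  have "\<phi> None = Some z"
    using \<phi>_\<psi>[of "Some z"] assms by simp
  then show "c 0 \<noteq> 0" "z = of_real (Y 0 + 1 / (c 0 * j 0))"
    unfolding \<phi>_None by (simp_all split: if_splits)
qed

lemma new_flow_infinity:
  assumes "c 0 \<noteq> 0" and t: "t \<in> time_interval T"
  shows "loewner_solution new_Y (\<sigma> t) (of_real (Y 0 + 1 / (c 0 * j 0)))
    (\<lambda>s. of_real (new_Y s + 1 / (c (\<tau> s) * j (\<tau> s))))"
proof -
  have "c r \<noteq> 0" if "r \<in> {0..t}" for r
    using c_nonzero[OF assms(1) time_interval_mono[OF t that]] assms(1) by auto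
  from solution_of_infinity[OF t this] show ?thesis
    by (simp add: new_Y_def [abs_def])
qed

lemma new_flow_None:
  assumes z: "\<psi> (Some z) = None" and t: "t \<in> time_interval T"
  shows "loewner_solution new_Y (\<sigma> t) z (\<lambda>s. new_g s z)"
  using new_flow_infinity[OF \<psi>_NoneD(1)[OF z] t] unfolding \<psi>_NoneD(2)[OF z, symmetric]
  by (simp add: new_g_def z new_Y_def)

lemma new_flow_Some:
  assumes z: "\<psi> (Some z) = Some w" and t: "t \<in> time_interval T" and w: "w \<notin> swallowed X t"
  shows "loewner_solution new_Y (\<sigma> t) z (\<lambda>s. new_g s z)"
  using solution_forward[OF t flow[OF t w] \<psi>_SomeD(1)[OF z]]
  by (simp add: new_g_def z new_Y_def [abs_def] \<psi>_SomeD(2)[OF z])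

text \<open>The image of infinity is never swallowed, as its trajectory is explicit. For every other
  point, solutions are transported in both directions.\<close>

lemma new_swallowed:
  assumes t: "t \<in> time_interval T"
  shows "z \<in> swallowed new_Y (\<sigma> t) \<longleftrightarrow> (\<exists>w\<in>swallowed X t. \<psi> (Some z) = Some w)"
proof (cases "\<psi> (Some z)")
  case None
  then show ?thesis
    using new_flow_None[OF None t] by (auto simp: swallowed_def)
next
  case (Some w)
  have "w \<notin> swallowed X t" if "loewner_solution new_Y (\<sigma> t) z v" for v
    using solution_backward[OF t _ \<psi>_SomeD(3)[OF Some], of v] that
    by (auto simp: swallowed_def new_Y_def [abs_def] \<psi>_SomeD(4)[OF Some])
  then show ?thesis
    using Some new_flow_Some[OF Some t] by (auto simp: swallowed_def)
qed

lemma new_chain: "loewner_chain S new_Y new_g"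
  unfolding loewner_chain_def
proof (intro ballI allI impI)
  fix s z assume s: "s \<in> time_interval S" and z: "z \<notin> swallowed new_Y s"
  note t = \<tau>_mem[OF s]
  have s': "\<sigma> (\<tau> s) = s"
    using s by simp
  show "loewner_solution new_Y s z (\<lambda>s. new_g s z)"
  proof (cases "\<psi> (Some z)")
    case None
    from new_flow_None[OF this t] show ?thesis
      by (simp add: s')
  next
    case (Some w)
    then have "w \<notin> swallowed X (\<tau> s)"
      using z new_swallowed[OF t, of z] by (simp add: s')
    from new_flow_Some[OF Some t this] show ?thesis
      by (simp add: s')
  qed
qed

lemma lookup_new_\<rho>: "Poly_Mapping.lookup new_\<rho> v = Poly_Mapping.lookup \<rho> (\<psi> v)"
  unfolding new_\<rho>_def by (rule lookup_pushforward) (simp_all add: \<psi>_\<phi> \<phi>_\<psi>)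

lemma new_conj_symmetric: "conj_symmetric \<rho> \<Longrightarrow> conj_symmetric new_\<rho>"
  unfolding conj_symmetric_def lookup_new_\<rho> by (simp add: \<psi>_def sphere_map_cnj)

lemma new_support: "z \<in> finite_support new_\<rho> \<longleftrightarrow> \<psi> (Some z) \<in> Poly_Mapping.keys \<rho>"
  by (simp add: finite_support_def in_keys_iff lookup_new_\<rho>)

lemma new_alive:
  assumes s: "s \<in> time_interval S"
  shows "finite_support new_\<rho> \<inter> swallowed new_Y s = {}"
proof -
  have "\<psi> (Some z) \<noteq> Some w" if "z \<in> finite_support new_\<rho>" "w \<in> swallowed X (\<tau> s)" for z w
  proof
    assume "\<psi> (Some z) = Some w"
    then have "w \<in> finite_support \<rho>"
      using that(1) unfolding new_support by (simp add: finite_support_def)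
    then show False
      using that(2) alive[OF \<tau>_mem[OF s]] by blast
  qed
  then show ?thesis
    using new_swallowed[OF \<tau>_mem[OF s]] s by auto
qed

text \<open>The force of a charge \<open>w\<close> on the driving point is \<open>j\<^sup>2 / (X - w) - c j\<close> in the new chart,
  with the right value \<open>0\<close> at the point that is sent to infinity; the constant part is
  multiplied by the total charge.\<close>

lemma new_force:
  assumes t: "t \<in> time_interval T"
  shows "(\<Sum>z\<in>finite_support new_\<rho>.
      of_real (Poly_Mapping.lookup new_\<rho> (Some z)) / (of_real (Y t) - new_g (\<sigma> t) z))
    = of_real ((j t)\<^sup>2 * speed t + 6 * c t * j t)"
proof -
  define K where "K = Poly_Mapping.keys \<rho>"
  have mem: "t \<in> {0..t}"
    using t by (simp add: time_interval_def)
  \<comment> \<open>The value at \<open>None\<close> is the limit of the other branch as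
    \<open>g t w\<close> tends to infinity: a charge at infinity exerts no force in the old chart
    but does so in the new one.\<close>
  define F where "F v = (case v of
      None \<Rightarrow> - of_real (c t * j t)
    | Some w \<Rightarrow> of_real ((j t)\<^sup>2) / (of_real (X t) - g t w) - of_real (c t * j t))" for v
  have inj: "inj_on (\<lambda>z. \<psi> (Some z)) (finite_support new_\<rho>)"
    by (rule inj_onI) (metis \<phi>_\<psi> option.inject)
  \<comment> \<open>The charge moved to infinity is missing from the new sum. Because
    \<open>F\<close> vanishes there it can be put back, after which the total charge can be
    used.\<close>
  have img: "(\<lambda>z. \<psi> (Some z)) ` finite_support new_\<rho> = K - {\<psi> None}"
  proof (intro equalityI subsetI)
    fix v assume v: "v \<in> K - {\<psi> None}"
    then have "\<phi> v \<noteq> None"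
      using \<psi>_\<phi>[of v] by force
    then obtain z where "\<phi> v = Some z"
      by auto
    then have z: "\<psi> (Some z) = v"
      using \<psi>_\<phi>[of v] by simp
    then have "z \<in> finite_support new_\<rho>"
      using v by (simp add: new_support K_def)
    with z show "v \<in> (\<lambda>z. \<psi> (Some z)) ` finite_support new_\<rho>"
      by blast
  next
    fix v assume "v \<in> (\<lambda>z. \<psi> (Some z)) ` finite_support new_\<rho>"
    then show "v \<in> K - {\<psi> None}"
      by (auto simp: new_support K_def) (metis \<phi>_\<psi> option.distinct(1))
  qed
  have term_eq: "1 / (of_real (Y t) - new_g (\<sigma> t) z) = F (\<psi> (Some z))" if z: "z \<in> finite_support new_\<rho>" for z
  proof (cases "\<psi> (Some z)")
    case None
    have "c t \<noteq> 0"
      using c_nonzero[OF \<psi>_NoneD(1)[OF None] t] \<psi>_NoneD(1)[OF None] by auto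
    then show ?thesis
      using t by (simp add: new_g_def None F_def)
  next
    case (Some w)
    have w: "w \<in> finite_support \<rho>"
      using z Some unfolding new_support by (simp add: finite_support_def)
    note u = charge_flow[OF t w]
    define e where "e = g t w - of_real (X t)"
    define cc jj where "cc = complex_of_real (c t)" and "jj = complex_of_real (j t)"
    have nz: "e \<noteq> 0" "jj \<noteq> 0" "cc * e + jj \<noteq> 0"
      using loewner_solutionD(2)[OF u mem] j_nz[OF t] denominator_nonzero[OF t u \<psi>_SomeD(1)[OF Some] mem]
      by (auto simp: e_def cc_def jj_def)
    have "of_real (Y t) - new_g (\<sigma> t) z = - (e / ((cc * e + jj) * jj))"
      using t by (simp add: new_g_def Some H_def chart_map_def e_def cc_def jj_def)
    then have "1 / (of_real (Y t) - new_g (\<sigma> t) z) = - ((cc * e + jj) * jj / e)"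
      by simp
    also have "\<dots> = jj\<^sup>2 / (- e) - cc * jj"
      using nz(1) by (simp add: field_simps power2_eq_square)
    finally show ?thesis
      by (simp add: F_def Some e_def cc_def jj_def)
  qed
  have F0: "F (\<psi> None) = 0"
  proof (cases "c 0 = 0")
    case True
    then show ?thesis
      using c_zero[OF True, of t] by (simp add: F_def \<psi>_def sphere_map_def)
  next
    case False
    have ct: "c t \<noteq> 0"
      using c_nonzero[OF False t] False by auto
    have "\<psi> None = Some (of_real (X 0 - j 0 / c 0))"
      using False by (simp add: \<psi>_def sphere_map_def)
    moreover have "of_real (X t) - g t (of_real (X 0 - j 0 / c 0)) = complex_of_real (j t / c t)"
      using c_nonzero[OF False t] by simp
    ultimately have "F (\<psi> None) = of_real ((j t)\<^sup>2) / complex_of_real (j t / c t) - of_real (c t * j t)"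
      by (simp only: F_def option.case)
    also have "\<dots> = of_real ((j t)\<^sup>2 / (j t / c t) - c t * j t)"
      by (simp only: of_real_diff of_real_divide)
    also have "(j t)\<^sup>2 / (j t / c t) - c t * j t = 0"
      using ct j_nz[OF t] by (simp add: power2_eq_square)
    finally show ?thesis
      by simp
  qed
  have "(\<Sum>z\<in>finite_support new_\<rho>.
      of_real (Poly_Mapping.lookup new_\<rho> (Some z)) / (of_real (Y t) - new_g (\<sigma> t) z))
      = (\<Sum>z\<in>finite_support new_\<rho>. of_real (Poly_Mapping.lookup \<rho> (\<psi> (Some z))) * F (\<psi> (Some z)))"
  proof (rule sum.cong)
    fix z assume "z \<in> finite_support new_\<rho>"
    from term_eq[OF this] show "of_real (Poly_Mapping.lookup new_\<rho> (Some z)) / (of_real (Y t) - new_g (\<sigma> t) z)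
        = of_real (Poly_Mapping.lookup \<rho> (\<psi> (Some z))) * F (\<psi> (Some z))"
      by (simp only: lookup_new_\<rho> divide_inverse mult_1_left)
  qed simp
  also have "\<dots> = (\<Sum>v\<in>K - {\<psi> None}. of_real (Poly_Mapping.lookup \<rho> v) * F v)"
    unfolding img[symmetric] by (simp add: sum.reindex[OF inj])
  also have "\<dots> = (\<Sum>v\<in>K. of_real (Poly_Mapping.lookup \<rho> v) * F v)"
    by (rule sum.mono_neutral_left) (use F0 in \<open>auto simp: K_def\<close>)
  also have "\<dots> = (\<Sum>v\<in>K. of_real (Poly_Mapping.lookup \<rho> v) *
      (case v of None \<Rightarrow> 0 | Some w \<Rightarrow> of_real ((j t)\<^sup>2) / (of_real (X t) - g t w)))
      - (\<Sum>v\<in>K. of_real (Poly_Mapping.lookup \<rho> v) * of_real (c t * j t))"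
    unfolding sum_subtractf[symmetric]
    by (rule sum.cong) (auto simp: F_def algebra_simps split: option.splits)
  also have "(\<Sum>v\<in>K. of_real (Poly_Mapping.lookup \<rho> v) * complex_of_real (c t * j t)) = - 6 * of_real (c t * j t)"
    unfolding sum_distrib_right[symmetric] of_real_sum[symmetric] K_def total by simp
  also have "(\<Sum>v\<in>K. of_real (Poly_Mapping.lookup \<rho> v) *
      (case v of None \<Rightarrow> 0 | Some w \<Rightarrow> of_real ((j t)\<^sup>2) / (of_real (X t) - g t w)))
      = (\<Sum>v\<in>Some ` finite_support \<rho>. of_real (Poly_Mapping.lookup \<rho> v) *
      (case v of None \<Rightarrow> 0 | Some w \<Rightarrow> of_real ((j t)\<^sup>2) / (of_real (X t) - g t w)))"
  proof (rule sum.mono_neutral_right)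
    show "\<forall>v\<in>K - Some ` finite_support \<rho>. of_real (Poly_Mapping.lookup \<rho> v) *
      (case v of None \<Rightarrow> 0 | Some w \<Rightarrow> of_real ((j t)\<^sup>2) / (of_real (X t) - g t w)) = 0"
      by (auto simp: finite_support_def K_def split: option.splits)
  qed (auto simp: K_def finite_support_def)
  also have "\<dots> = (\<Sum>w\<in>finite_support \<rho>. of_real ((j t)\<^sup>2) *
      (of_real (Poly_Mapping.lookup \<rho> (Some w)) / (of_real (X t) - g t w)))"
    by (subst sum.reindex) (auto simp: mult.commute intro!: sum.cong)
  also have "\<dots> = of_real ((j t)\<^sup>2) * of_real (speed t)"
    unfolding sum_distrib_left[symmetric] of_real_speed[OF t] ..
  finally show ?thesis
    by (simp add: mult.assoc)
qed

lemma new_Y_deriv: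
  assumes s: "s \<in> time_interval S" and X': "X' (\<tau> s) = speed (\<tau> s)"
  shows "(new_Y has_vector_derivative (j (\<tau> s))\<^sup>2 * speed (\<tau> s) + 6 * c (\<tau> s) * j (\<tau> s)) (at s within {0..})"
proof -
  define t where "t = \<tau> s"
  have t: "t \<in> time_interval T" "\<sigma> t = s"
    using s by (auto simp: t_def \<tau>_mem)
  obtain t' where t': "t < t'" "t' \<in> time_interval T"
    using time_interval_dense[OF t(1)] by blast
  have ss: "s < \<sigma> t'" "s \<in> {0..\<sigma> t'}"
    using \<sigma>_less[OF t(1) t'(2,1)] t(2) s by (auto simp: time_interval_def)
  have "((\<lambda>s. Y (\<tau> s)) has_vector_derivative j (\<tau> s) ^ 4 *\<^sub>R
      (X' (\<tau> s) / j (\<tau> s) ^ 2 + 6 * c (\<tau> s) / j (\<tau> s) ^ 3)) (at s within {0..\<sigma> t'})"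
    by (rule new_time_deriv[OF t'(2) ss(2)]) (rule subset_deriv[OF Y[OF \<tau>_mem[OF s]]])
  then have "(new_Y has_vector_derivative j t ^ 4 * (speed t / j t ^ 2 + 6 * c t / j t ^ 3)) (at s within {0..})"
    unfolding X' at_within_atLeastAtMost_eq[OF ss(1)] by (simp add: new_Y_def [abs_def] t_def)
  moreover have "j t ^ 4 * (speed t / j t ^ 2 + 6 * c t / j t ^ 3) = (j t)\<^sup>2 * speed t + 6 * c t * j t"
    using j_nz[OF t(1)] by (simp add: field_simps eval_nat_numeral)
  ultimately show ?thesis
    by (simp add: t_def)
qed

lemma new_charges:
  assumes X': "\<And>t. t \<in> time_interval T \<Longrightarrow> X' t = speed t"
  shows "loewner_charges (Y 0) new_\<rho> S new_Y new_g"
proof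
  show "0 < S"
    by (rule S_pos)
  show "new_Y 0 = Y 0"
    by (simp add: new_Y_def)
  show "loewner_chain S new_Y new_g"
    by (rule new_chain)
  fix s assume s: "s \<in> time_interval S"
  show "finite_support new_\<rho> \<inter> swallowed new_Y s = {}"
    by (rule new_alive[OF s])
  note t = \<tau>_mem[OF s]
  show "((\<lambda>s. complex_of_real (new_Y s)) has_vector_derivative (\<Sum>w\<in>finite_support new_\<rho>.
      of_real (Poly_Mapping.lookup new_\<rho> (Some w)) / (of_real (new_Y s) - new_g s w))) (at s within {0..})"
    using has_vector_derivative_complex_of_real[OF new_Y_deriv[OF s X'[OF t]]] new_force[OF t] s
    by (simp add: new_Y_def)
qed

end

section \<open>Transport of hulls and of the curve\<close>

lemma components_image:
  assumes f: "continuous_on U f" "f ` U \<subseteq> V" and h: "continuous_on V h" "h ` V \<subseteq> U"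
    and hf: "\<And>z. z \<in> U \<Longrightarrow> h (f z) = z" and fh: "\<And>z. z \<in> V \<Longrightarrow> f (h z) = z"
    and C: "C \<in> components U"
  shows "f ` C \<in> components V"
proof -
  have max: "C \<noteq> {} \<and> C \<subseteq> U \<and> connected C \<and>
      (\<forall>d. d \<noteq> {} \<and> C \<subseteq> d \<and> d \<subseteq> U \<and> connected d \<longrightarrow> d = C)"
    by (rule in_components_maximal[THEN iffD1, OF C])
  then have C': "C \<noteq> {}" "C \<subseteq> U" "connected C"
    by simp_all
  show ?thesis
    unfolding in_components_maximal
  proof (intro conjI allI impI)
    show "f ` C \<noteq> {}" "f ` C \<subseteq> V"
      using C'(1,2) f(2) by auto
    show "connected (f ` C)"
      by (rule connected_continuous_image[OF continuous_on_subset[OF f(1) C'(2)] C'(3)])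
    fix d assume d: "d \<noteq> {} \<and> f ` C \<subseteq> d \<and> d \<subseteq> V \<and> connected d"
    have "h ` d = C"
    proof (rule max[THEN conjunct2, THEN conjunct2, THEN conjunct2, rule_format], intro conjI)
      show "C \<subseteq> h ` d"
      proof
        fix z assume "z \<in> C"
        then have "h (f z) = z" "f z \<in> d"
          using C'(2) hf d by auto
        then show "z \<in> h ` d"
          by (metis image_eqI)
      qed
      show "connected (h ` d)"
        by (rule connected_continuous_image[OF continuous_on_subset[OF h(1)]]) (use d in auto)
      show "h ` d \<noteq> {}"
        using d by simp
      show "h ` d \<subseteq> U"
        by (rule order_trans[OF image_mono h(2)]) (use d in simp)
    qed
    moreover have "f ` h ` d = d"
    proof -
      have "f (h z) = z" if "z \<in> d" for z
        using d fh that by blast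
      then show ?thesis
        by (simp add: image_image)
    qed
    ultimately show "d = f ` C"
      by simp
  qed
qed

context charged_chart
begin

abbreviation (input) "den z \<equiv> of_real (c 0) * (z - of_real (X 0)) + of_real (j 0) :: complex"
abbreviation (input) "inv_den z \<equiv> of_real (- c 0) * (z - of_real (Y 0)) + of_real (1 / j 0) :: complex"

lemma den_upper: "0 < Im z \<Longrightarrow> den z \<noteq> 0"
  using j0 by (auto simp: complex_eq_iff)

lemma inv_den_upper: "0 < Im z \<Longrightarrow> inv_den z \<noteq> 0"
  using j0 by (auto simp: complex_eq_iff)

lemma Hinv_H: "den z \<noteq> 0 \<Longrightarrow> Hinv 0 (H 0 z) = z"
  unfolding H_def Hinv_def using chart_map_inverse[OF j0] .

lemma H_Hinv: "inv_den z \<noteq> 0 \<Longrightarrow> H 0 (Hinv 0 z) = z"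
  unfolding H_def Hinv_def using chart_map_inverse[of "1 / j 0" "- c 0" z "Y 0" "X 0"] j0 by simp

lemma Im_H: "Im (H 0 z) = Im z / (cmod (den z))\<^sup>2"
  unfolding H_def by (rule Im_chart_map[OF j0])

lemma H_upper: "z \<in> upper_half_plane \<Longrightarrow> H 0 z \<in> upper_half_plane"
  using den_upper by (simp add: upper_half_plane_def Im_H)

lemma Hinv_upper: "z \<in> upper_half_plane \<Longrightarrow> Hinv 0 z \<in> upper_half_plane"
  using inv_den_upper Im_chart_map[of "1 / j 0" "Y 0" "X 0" "- c 0" z] j0
  by (simp add: upper_half_plane_def Hinv_def)

lemma H_continuous: "continuous_on {z. den z \<noteq> 0} (H 0)"
  unfolding H_def chart_map_def [abs_def] using j0 by (intro continuous_intros) auto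

lemma Hinv_continuous: "continuous_on {z. inv_den z \<noteq> 0} (Hinv 0)"
  unfolding Hinv_def chart_map_def [abs_def] using j0 by (intro continuous_intros) auto

lemma \<psi>_upper: "z \<in> upper_half_plane \<Longrightarrow> \<psi> (Some z) = Some (Hinv 0 z)"
  using inv_den_upper[of z] unfolding \<psi>_Some upper_half_plane_def by simp

lemma new_surviving:
  assumes t: "t \<in> time_interval T"
  shows "upper_half_plane - swallowed new_Y (\<sigma> t) = H 0 ` (upper_half_plane - swallowed X t)"
proof (intro equalityI subsetI)
  fix z assume z: "z \<in> upper_half_plane - swallowed new_Y (\<sigma> t)"
  then have "Hinv 0 z \<in> upper_half_plane - swallowed X t"
    using new_swallowed[OF t, of z] \<psi>_upper[of z] Hinv_upper[of z] by auto
  moreover have "H 0 (Hinv 0 z) = z"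
    using H_Hinv inv_den_upper z by (simp add: upper_half_plane_def)
  ultimately show "z \<in> H 0 ` (upper_half_plane - swallowed X t)"
    by (metis image_eqI)
next
  fix z assume "z \<in> H 0 ` (upper_half_plane - swallowed X t)"
  then obtain w where w: "z = H 0 w" "w \<in> upper_half_plane" "w \<notin> swallowed X t"
    by auto
  then have "z \<in> upper_half_plane" "Hinv 0 z = w"
    using H_upper Hinv_H den_upper by (auto simp: upper_half_plane_def)
  then show "z \<in> upper_half_plane - swallowed new_Y (\<sigma> t)"
    using new_swallowed[OF t, of z] \<psi>_upper[of z] w by auto
qed

text \<open>The curve also contains its real starting point. The condition on
  \<open>\<Gamma>\<close> makes \<open>H 0\<close> injective on \<open>\<Gamma>\<close> and the
  half-plane together, so that the image of the complement does not meet the image of the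
  curve.\<close>

lemma new_component:
  assumes t: "t \<in> time_interval T"
    and comp: "upper_half_plane - swallowed X t \<in> components (upper_half_plane - \<Gamma>)"
    and \<Gamma>: "\<And>z. z \<in> \<Gamma> \<Longrightarrow> den z \<noteq> 0"
  shows "upper_half_plane - swallowed new_Y (\<sigma> t) \<in> components (upper_half_plane - H 0 ` \<Gamma>)"
  unfolding new_surviving[OF t]
proof (rule components_image[OF _ _ _ _ _ _ comp])
  show "continuous_on (upper_half_plane - \<Gamma>) (H 0)"
    by (rule continuous_on_subset[OF H_continuous]) (use den_upper in \<open>auto simp: upper_half_plane_def\<close>)
  show "continuous_on (upper_half_plane - H 0 ` \<Gamma>) (Hinv 0)"
    by (rule continuous_on_subset[OF Hinv_continuous]) (use inv_den_upper in \<open>auto simp: upper_half_plane_def\<close>)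
  show "Hinv 0 (H 0 z) = z" if "z \<in> upper_half_plane - \<Gamma>" for z
    using that Hinv_H den_upper by (simp add: upper_half_plane_def)
  show *: "H 0 (Hinv 0 z) = z" if "z \<in> upper_half_plane - H 0 ` \<Gamma>" for z
    using that H_Hinv inv_den_upper by (simp add: upper_half_plane_def)
  show "H 0 ` (upper_half_plane - \<Gamma>) \<subseteq> upper_half_plane - H 0 ` \<Gamma>"
  proof
    fix z assume "z \<in> H 0 ` (upper_half_plane - \<Gamma>)"
    then obtain w where w: "z = H 0 w" "w \<in> upper_half_plane" "w \<notin> \<Gamma>"
      by auto
    have "H 0 w \<noteq> H 0 v" if "v \<in> \<Gamma>" for v
    proof
      assume eq: "H 0 w = H 0 v"
      have "den w \<noteq> 0"
        using den_upper w(2) by (simp add: upper_half_plane_def)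
      from Hinv_H[OF this] have "w = Hinv 0 (H 0 v)"
        by (simp only: eq)
      then have "w = v"
        by (simp only: Hinv_H[OF \<Gamma>[OF that]])
      then show False
        using w(3) that by simp
    qed
    then show "z \<in> upper_half_plane - H 0 ` \<Gamma>"
      using w H_upper by auto
  qed
  show "Hinv 0 ` (upper_half_plane - H 0 ` \<Gamma>) \<subseteq> upper_half_plane - \<Gamma>"
    using Hinv_upper * by (auto simp: image_iff) metis
qed

text \<open>If \<open>c \<noteq> 0\<close>, unboundedness holds because the point sent to infinity has survived.\<close>

lemma new_unbounded:
  assumes t: "t \<in> time_interval T" and unb: "\<not> bounded (upper_half_plane - swallowed X t)"
  shows "\<not> bounded (upper_half_plane - swallowed new_Y (\<sigma> t))"
proof
  assume "bounded (upper_half_plane - swallowed new_Y (\<sigma> t))"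
  then obtain M where M: "\<And>z. z \<in> upper_half_plane - swallowed X t \<Longrightarrow> cmod (H 0 z) \<le> M"
    unfolding new_surviving[OF t] bounded_iff by auto
  define N where "N = \<bar>M\<bar> + \<bar>Y 0\<bar>"
  have N: "cmod ((z - of_real (X 0)) / (den z * of_real (j 0))) \<le> N" if "z \<in> upper_half_plane - swallowed X t" for z
  proof -
    have "cmod ((z - of_real (X 0)) / (den z * of_real (j 0))) = cmod (H 0 z - of_real (Y 0))"
      by (simp add: H_def chart_map_def)
    also have "\<dots> \<le> cmod (H 0 z) + \<bar>Y 0\<bar>"
      by (rule order_trans[OF norm_triangle_ineq4]) simp
    also have "\<dots> \<le> N"
      using M[OF that] by (simp add: N_def)
    finally show ?thesis .
  qed
  show False
  proof (cases "c 0 = 0")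
    case True
    have "cmod z \<le> N * (j 0)\<^sup>2 + \<bar>X 0\<bar>" if "z \<in> upper_half_plane - swallowed X t" for z
    proof -
      have "cmod (z - of_real (X 0)) / (j 0)\<^sup>2 \<le> N"
        using N[OF that] True by (simp add: norm_divide norm_mult power2_eq_square abs_mult_self_eq)
      then have "cmod (z - of_real (X 0)) \<le> N * (j 0)\<^sup>2"
        using j0 by (simp add: pos_divide_le_eq)
      then show ?thesis
        using norm_triangle_sub[of z "of_real (X 0)"] by simp
    qed
    then show False
      using unb unfolding bounded_iff by blast
  next
    case False
    define p where "p = X 0 - j 0 / c 0"
    have px: "p \<noteq> x"
      using j0 False by (simp add: p_def X_0)
    define d where "d = \<bar>p - X 0\<bar>"
    have d: "0 < d"
      using px by (simp add: d_def X_0)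
    have N0: "0 \<le> N"
      by (simp add: N_def)
    \<comment> \<open>At height \<open>\<epsilon>\<close> above the pole,
      \<open>cmod (H 0 z - of_real (Y 0))\<close> is at least
      \<open>d / (\<epsilon> * \<bar>c 0 * j 0\<bar>)\<close>, which exceeds \<open>N + 1\<close> as
      soon as \<open>\<epsilon> < r\<close>.\<close>
    define r where "r = d / ((N + 1) * \<bar>c 0 * j 0\<bar>)"
    have r: "0 < r"
      using d N0 False j0 by (simp add: r_def)
    obtain \<epsilon> where \<epsilon>: "0 < \<epsilon>" "\<epsilon> < r" "Complex p \<epsilon> \<in> upper_half_plane - swallowed X t"
      using alive_near[OF t px r] .
    have "d \<le> cmod (Complex p \<epsilon> - of_real (X 0))"
      using abs_Re_le_cmod[of "Complex p \<epsilon> - of_real (X 0)"] by (simp add: d_def)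
    moreover have "den (Complex p \<epsilon>) = \<i> * of_real (c 0 * \<epsilon>)"
      using False by (simp add: complex_eq_iff p_def field_simps)
    then have "cmod (den (Complex p \<epsilon>) * of_real (j 0)) = \<epsilon> * \<bar>c 0 * j 0\<bar>"
      using \<epsilon>(1) by (simp add: norm_mult abs_mult)
    then have "cmod (Complex p \<epsilon> - of_real (X 0)) / (\<epsilon> * \<bar>c 0 * j 0\<bar>) \<le> N"
      using N[OF \<epsilon>(3)] by (simp only: norm_divide)
    then have "cmod (Complex p \<epsilon> - of_real (X 0)) \<le> N * (\<epsilon> * \<bar>c 0 * j 0\<bar>)"
      using \<epsilon>(1) False j0 by (simp add: pos_divide_le_eq)
    ultimately have "d \<le> N * (\<epsilon> * \<bar>c 0 * j 0\<bar>)"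
      by linarith
    also have "\<dots> \<le> (N + 1) * (\<epsilon> * \<bar>c 0 * j 0\<bar>)"
      using \<epsilon>(1) by (intro mult_right_mono) auto
    also have "\<dots> < (N + 1) * (r * \<bar>c 0 * j 0\<bar>)"
      using \<epsilon>(2) N0 False j0 by (intro mult_strict_left_mono mult_strict_right_mono) auto
    also have "\<dots> = d"
      using N0 False j0 by (simp add: r_def)
    finally show False
      by simp
  qed
qed

section \<open>Boundedness and lifetime in the new chart\<close>

text \<open>The chart multiplies heights by \<open>1 / ((c 0)\<^sup>2 * (cmod (\<gamma> t - of_real
  p))\<^sup>2)\<close>, where \<open>p\<close> is the point sent to infinity. A quadratic lower
  bound on the height of the curve near \<open>p\<close> therefore becomes a constant lower bound on
  the height of its image far out, so two large discs centred on the real axis, one on each side,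
  are missed.\<close>

lemma new_Y_bounded:
  assumes X': "\<And>t. t \<in> time_interval T \<Longrightarrow> X' t = speed t"
    and S': "S = ereal S'" and c0: "c 0 \<noteq> 0"
    and comp: "\<And>t. t \<in> time_interval T \<Longrightarrow>
      upper_half_plane - swallowed X t \<in> components (upper_half_plane - \<gamma> ` {0..t})"
    and \<gamma>0: "\<gamma> 0 = of_real x"
    and \<gamma>_upper: "\<And>t. t \<in> time_interval T - {0} \<Longrightarrow> 0 < Im (\<gamma> t)"
    and non_tangential: "\<And>K. 0 < K \<Longrightarrow> \<exists>\<epsilon>>0. \<forall>t\<in>time_interval T - {0}.
      cmod (\<gamma> t - of_real (X 0 - j 0 / c 0)) < \<epsilon> \<longrightarrow>
      K * (cmod (\<gamma> t - of_real (X 0 - j 0 / c 0)))\<^sup>2 \<le> Im (\<gamma> t)"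
  obtains M where "\<And>s. s \<in> {0..<S'} \<Longrightarrow> \<bar>new_Y s\<bar> \<le> M"
proof -
  interpret new: loewner_charges "Y 0" new_\<rho> S new_Y new_g
    by (rule new_charges[OF X'])
  have TI: "time_interval S = {0..<S'}"
    by (simp add: S' time_interval_ereal)
  have pos: "0 < S'"
    using S_pos by (simp add: S')
  define p where "p = X 0 - j 0 / c 0"
  define A where "A = Y 0 + 1 / (c 0 * j 0)"
  \<comment> \<open>Radius large enough for the distortion bound up to time \<open>S'\<close>; the
    non-tangential constant \<open>r * (c 0)\<^sup>2\<close> below is chosen so that the image
    height is at least \<open>r\<close>.\<close>
  define r where "r = sqrt (4 * S' + 1) + 1"
  have r: "0 < r" "4 * S' + 1 < r\<^sup>2"
    using pos by (auto simp: r_def power2_sum add_pos_pos)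
  obtain \<epsilon> where \<epsilon>: "\<epsilon> > 0" "\<And>t. t \<in> time_interval T - {0} \<Longrightarrow> cmod (\<gamma> t - of_real p) < \<epsilon> \<Longrightarrow>
      r * (c 0)\<^sup>2 * (cmod (\<gamma> t - of_real p))\<^sup>2 \<le> Im (\<gamma> t)"
    using non_tangential[of "r * (c 0)\<^sup>2"] r(1) c0 unfolding p_def by auto
  \<comment> \<open>An image point in the disc of radius \<open>r\<close> around
    \<open>A - k\<close> or \<open>A + k\<close> is at distance more than
    \<open>1 / ((c 0)\<^sup>2 * \<epsilon>)\<close> from \<open>A\<close>, which means that the
    original point is within \<open>\<epsilon>\<close> of \<open>p\<close>. The last two terms leave
    the starting point \<open>Y 0\<close> outside both discs and between them.\<close>
  define k where "k = r + 1 / ((c 0)\<^sup>2 * \<epsilon>) + \<bar>Y 0 - A\<bar> + 1"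
  have away: "H 0 (\<gamma> t) \<notin> ball (of_real q) r" if q: "q = A - k \<or> q = A + k" and t: "t \<in> time_interval T - {0}" for q t
  proof
    assume mem: "H 0 (\<gamma> t) \<in> ball (of_real q) r"
    note up = \<gamma>_upper[OF t]
    have dp: "den (\<gamma> t) = of_real (c 0) * (\<gamma> t - of_real p)"
      using c0 by (simp add: p_def algebra_simps)
    have nz: "\<gamma> t - of_real p \<noteq> 0"
      using up by (auto simp: complex_eq_iff)
    define w where "w = \<gamma> t - of_real p"
    have "H 0 (\<gamma> t) - of_real A = - (1 / (of_real ((c 0)\<^sup>2) * w))"
    proof -
      define C J where "C = complex_of_real (c 0)" and "J = complex_of_real (j 0)"
      have nzz: "C \<noteq> 0" "J \<noteq> 0" "w \<noteq> 0"
        using c0 j0 nz by (auto simp: C_def J_def w_def)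
      have "\<gamma> t - of_real (X 0) = w - J / C"
        by (simp add: w_def p_def C_def J_def)
      then have "H 0 (\<gamma> t) - of_real A = (w - J / C) / (C * w * J) - 1 / (C * J)"
        unfolding H_def chart_map_def dp by (simp add: A_def C_def J_def w_def)
      also have "\<dots> = - (1 / (C\<^sup>2 * w))"
        using nzz by (simp add: field_simps power2_eq_square)
      finally show ?thesis
        by (simp add: C_def)
    qed
    then have dist: "cmod (H 0 (\<gamma> t) - of_real A) = 1 / ((c 0)\<^sup>2 * cmod w)"
      by (simp add: norm_divide norm_mult norm_power)
    have "cmod (of_real q - of_real A) \<le> cmod (of_real q - H 0 (\<gamma> t)) + cmod (H 0 (\<gamma> t) - of_real A)"
      using norm_triangle_ineq[of "of_real q - H 0 (\<gamma> t)" "H 0 (\<gamma> t) - of_real A"] by simp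
    moreover have "0 < k"
      using r(1) \<epsilon>(1) by (simp add: k_def add_pos_nonneg)
    then have "\<bar>q - A\<bar> = k"
      using q by auto
    then have "cmod (of_real q - of_real A) = k"
      by (simp only: norm_of_real flip: of_real_diff)
    moreover have "cmod (of_real q - H 0 (\<gamma> t)) < r"
      using mem by (simp add: dist_norm)
    ultimately have "1 / ((c 0)\<^sup>2 * \<epsilon>) < 1 / ((c 0)\<^sup>2 * cmod w)"
      unfolding dist by (simp add: k_def)
    then have "cmod w < \<epsilon>"
      using c0 \<epsilon>(1) nz by (simp add: w_def field_simps)
    then have "r * (c 0)\<^sup>2 * (cmod w)\<^sup>2 \<le> Im (\<gamma> t)"
      using \<epsilon>(2)[OF t] by (simp add: w_def)
    moreover have "(cmod (den (\<gamma> t)))\<^sup>2 = (c 0)\<^sup>2 * (cmod w)\<^sup>2"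
      by (simp add: dp w_def norm_mult power_mult_distrib)
    moreover have "0 < (c 0)\<^sup>2 * (cmod w)\<^sup>2"
      using c0 nz by (simp add: w_def)
    ultimately have "r \<le> Im (H 0 (\<gamma> t))"
      unfolding Im_H by (simp add: pos_le_divide_eq mult.assoc)
    also have "\<dots> \<le> cmod (of_real q - H 0 (\<gamma> t))"
      using abs_Im_le_cmod[of "of_real q - H 0 (\<gamma> t)"] by simp
    finally show False
      using mem by (simp add: dist_norm)
  qed
  have kA: "r < k" "\<bar>Y 0 - A\<bar> + r < k"
    using \<epsilon>(1) c0 by (auto simp: k_def add_nonneg_pos)
  have alive: "loewner_solution new_Y s z (\<lambda>s. new_g s z)"
    if q: "q = A - k \<or> q = A + k" and s: "0 \<le> s" "s < S'" and z: "z \<in> ball (of_real q) r" for q s z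
  proof -
    have sS: "s \<in> time_interval S"
      using s by (simp add: TI)
    define t where "t = \<tau> s"
    have t: "t \<in> time_interval T" "\<sigma> t = s"
      using sS by (auto simp: t_def \<tau>_mem)
    have den\<gamma>: "den (\<gamma> r) \<noteq> 0" if "r \<in> {0..t}" for r
      using \<gamma>_upper[of r] time_interval_mono[OF t(1) that] den_upper[of "\<gamma> r"] \<gamma>0 j0 X_0
      by (cases "r = 0") auto
    have comp': "upper_half_plane - swallowed new_Y s \<in> components (upper_half_plane - H 0 ` \<gamma> ` {0..t})"
      unfolding t(2)[symmetric]
      by (rule new_component[OF t(1) comp[OF t(1)]]) (use den\<gamma> in blast)
    show ?thesis
    proof (rule new.ball_alive[OF sS r(1) comp' _ _ z])
      show "of_real (Y 0) \<notin> ball (complex_of_real q) r"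
        using q kA by (auto simp: dist_of_real dist_real_def)
      have "H 0 (\<gamma> r') \<notin> ball (of_real q) r \<inter> upper_half_plane" if "r' \<in> {0..t}" for r'
      proof (cases "r' = 0")
        case True
        then show ?thesis
          using \<gamma>0 X_0 by (simp add: upper_half_plane_def H_def chart_map_def)
      next
        case False
        then show ?thesis
          using away[OF q, of r'] time_interval_mono[OF t(1) that] by blast
      qed
      then show "ball (of_real q) r \<inter> upper_half_plane \<inter> H 0 ` \<gamma> ` {0..t} = {}"
        by blast
    qed
  qed
  have cont: "continuous_on {0..<S'} new_Y"
    by (rule continuous_on_deriv_atLeast[where f' = new.speed]) (simp add: new.X_deriv TI)
  obtain M where "\<And>s. s \<in> {0..<S'} \<Longrightarrow> \<bar>new_Y s\<bar> \<le> M"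
  proof (rule driving_bounded[OF pos cont r, of "A - k" "A + k" new_g])
    show "A - k < new_Y 0" "new_Y 0 < A + k"
      using kA r(1) unfolding new.X_0 by auto
  qed (use alive in blast)+
  then show thesis
    by (rule that)
qed

text \<open>For an affine chart the clock has constant rate and the old collision is simply carried
  over. Otherwise, absence of a collision bounds \<open>c\<close> and \<open>j\<close> above and
  below: the upper bound on \<open>j\<close> makes \<open>T\<close> finite, and the lower bound on
  \<open>j\<close> together with the upper bound on \<open>c\<close> separates all old charges from
  the driving point, against the collision at \<open>T\<close>.\<close>

lemma new_lifetime:
  assumes X': "\<And>t. t \<in> time_interval T \<Longrightarrow> X' t = speed t"
    and S': "S = ereal S'"
    and hit: "\<And>T'. T = ereal T' \<Longrightarrow> \<exists>w\<in>finite_support \<rho>. ((\<lambda>t. of_real (X t) - g t w) \<longlongrightarrow> 0) (at_left T')"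
    and four: "\<And>w. Im w \<noteq> 0 \<Longrightarrow> \<exists>k::int. Poly_Mapping.lookup \<rho> (Some w) = 4 * of_int k"
    and bounded: "c 0 \<noteq> 0 \<Longrightarrow> \<exists>M. \<forall>s\<in>{0..<S'}. \<bar>new_Y s\<bar> \<le> M"
  shows "\<exists>z\<in>finite_support new_\<rho>. ((\<lambda>s. of_real (new_Y s) - new_g s z) \<longlongrightarrow> 0) (at_left S')"
proof (rule ccontr)
  assume no: "\<not> ?thesis"
  interpret new: loewner_charges "Y 0" new_\<rho> S new_Y new_g
    by (rule new_charges[OF X'])
  have TI: "time_interval S = {0..<S'}"
    by (simp add: S' time_interval_ereal)
  have pos: "0 < S'"
    using S_pos by (simp add: S')
  have \<sigma>S: "\<sigma> t \<in> {0..<S'}" if "t \<in> time_interval T" for t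
    using \<sigma>_mem[OF that] by (simp add: TI)
  have finite_T: "\<exists>T'. T = ereal T'" if le: "\<And>t. t \<in> time_interval T \<Longrightarrow> t \<le> B" for B
  proof (cases T)
    case PInf
    then have "\<bar>B\<bar> + 1 \<in> time_interval T"
      by (simp add: time_interval_def)
    from le[OF this] show ?thesis
      by auto
  qed (use T in auto)
  show False
  proof (cases "c 0 = 0")
    case True
    define J0 where "J0 = j 0"
    have J0: "J0 \<noteq> 0"
      using j0 by (simp add: J0_def)
    have cj: "c t = 0" "j t = J0" for t
      using c_zero[OF True, of t] by (auto simp: J0_def)
    have \<sigma>t: "\<sigma> t = t / J0 ^ 4" if "0 \<le> t" for t
      unfolding \<sigma>_def cj(2) using that by simp
    have "t \<le> S' * J0 ^ 4" if t: "t \<in> time_interval T" for t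
    proof -
      have "t / J0 ^ 4 < S'"
        using \<sigma>S[OF t] \<sigma>t[of t] t by (simp add: time_interval_def)
      then show ?thesis
        using J0 by (simp add: divide_less_eq zero_less_power_eq)
    qed
    then obtain T' where T': "T = ereal T'"
      using finite_T by blast
    then have T'0: "0 < T'"
      using T by simp
    obtain w where w: "w \<in> finite_support \<rho>" "((\<lambda>t. of_real (X t) - g t w) \<longlongrightarrow> 0) (at_left T')"
      using hit[OF T'] by blast
    define z where "z = H 0 w"
    have "\<phi> (Some w) = Some z"
      unfolding \<phi>_Some z_def using True J0 by (simp add: cj)
    then have z: "\<psi> (Some z) = Some w"
      using \<psi>_\<phi>[of "Some w"] by simp
    then have zS: "z \<in> finite_support new_\<rho>"
      using w(1) by (simp add: new_support) (simp add: finite_support_def)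
    have "((\<lambda>s. of_real (new_Y s) - new_g s z) \<longlongrightarrow> 0) (at_left S')"
    proof (rule tendstoI)
      fix e :: real assume e: "0 < e"
      have "\<forall>\<^sub>F t in at_left T'. dist (of_real (X t) - g t w) 0 < e * J0\<^sup>2"
        by (rule tendstoD[OF w(2)]) (use e J0 in simp)
      then obtain b where b: "b < T'" "\<And>t. \<lbrakk>b < t; t < T'\<rbrakk> \<Longrightarrow> cmod (of_real (X t) - g t w) < e * J0\<^sup>2"
        unfolding eventually_at_left[OF T'0] by auto
      obtain t1 where t1: "max b 0 < t1" "t1 < T'"
        using dense[of "max b 0" T'] b(1) T'0 by auto
      then have t1T: "t1 \<in> time_interval T"
        by (simp add: T' time_interval_ereal)
      show "\<forall>\<^sub>F s in at_left S'. dist (of_real (new_Y s) - new_g s z) 0 < e"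
        unfolding eventually_at_left[OF pos]
      proof (intro exI[of _ "\<sigma> t1"] conjI allI impI)
        show "\<sigma> t1 < S'"
          using \<sigma>S[OF t1T] by simp
        fix s assume s: "\<sigma> t1 < s" "s < S'"
        then have sS: "s \<in> time_interval S"
          using \<sigma>S[OF t1T] by (simp add: TI)
        have \<tau>s: "\<tau> s \<in> time_interval T"
          by (rule \<tau>_mem[OF sS])
        have "t1 < \<tau> s"
          using \<sigma>_le[OF \<tau>s t1T] s(1) sS by (cases "t1 < \<tau> s") auto
        then have "cmod (of_real (X (\<tau> s)) - g (\<tau> s) w) < e * J0\<^sup>2"
          using b(2)[of "\<tau> s"] t1 \<tau>s by (simp add: T' time_interval_ereal)
        moreover have "of_real (new_Y s) - new_g s z = (of_real (X (\<tau> s)) - g (\<tau> s) w) / of_real (J0\<^sup>2)"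
          by (simp add: new_Y_def new_g_def z H_def chart_map_def cj power2_eq_square minus_divide_left)
        ultimately show "dist (of_real (new_Y s) - new_g s z) 0 < e"
          using J0 by (simp add: norm_divide norm_power pos_divide_less_eq)
      qed
    qed
    with zS no show False
      by blast
  next
    case False
    obtain M where M: "\<And>s. s \<in> {0..<S'} \<Longrightarrow> \<bar>new_Y s\<bar> \<le> M"
      using bounded[OF False] by blast
    define A where "A s = new_Y s + 1 / (c (\<tau> s) * j (\<tau> s))" for s
    define a where "a = Y 0 + 1 / (c 0 * j 0)"
    have Aflow: "loewner_solution new_Y s (of_real a) (\<lambda>s. of_real (A s))" if "0 \<le> s" "s < S'" for s
      using new_flow_infinity[OF False \<tau>_mem[of s]] that by (simp add: TI A_def a_def)
    obtain \<epsilon> where \<epsilon>: "\<epsilon> > 0" "\<And>s. s \<in> {0..<S'} \<Longrightarrow> \<epsilon> \<le> cmod (of_real (new_Y s) - of_real (A s))"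
      "\<And>s z. \<lbrakk>s \<in> {0..<S'}; z \<in> finite_support new_\<rho>\<rbrakk> \<Longrightarrow> \<epsilon> \<le> cmod (of_real (new_Y s) - new_g s z)"
    proof (rule loewner_charges_dichotomy[where W = "finite_support new_\<rho>" and X = new_Y and g = new_g
          and \<rho> = "\<lambda>z. Poly_Mapping.lookup new_\<rho> (Some z)" and S = S' and M = M and a = a
          and u = "\<lambda>s. of_real (A s)"])
      show "((\<lambda>s. complex_of_real (new_Y s)) has_vector_derivative (\<Sum>w\<in>finite_support new_\<rho>.
          of_real (Poly_Mapping.lookup new_\<rho> (Some w)) / (of_real (new_Y t) - new_g t w))) (at t within {0..})"
        if "t \<in> {0..<S'}" for t
        by (rule new.driving) (use that in \<open>simp add: TI\<close>)
      show "loewner_solution new_Y t w (\<lambda>s. new_g s w)"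
        if "w \<in> finite_support new_\<rho>" "0 \<le> t" "t < S'" for w t
        by (rule new.charge_flow) (use that in \<open>simp_all add: TI\<close>)
      show "\<exists>k::int. Poly_Mapping.lookup new_\<rho> (Some z) = 4 * of_int k"
        if "z \<in> finite_support new_\<rho>" "Im z \<noteq> 0" for z
      proof (cases "\<psi> (Some z)")
        case None
        then show ?thesis
          using \<psi>_NoneD(2)[OF None] that(2) by simp
      next
        case (Some w)
        have "Im w \<noteq> 0"
          using that(2) Im_H[of w] \<psi>_SomeD(2)[OF Some] by auto
        then show ?thesis
          using four Some by (simp add: lookup_new_\<rho>)
      qed
      show "\<not> ((\<lambda>t. of_real (new_Y t) - new_g t w) \<longlongrightarrow> 0) (at_left S')" if "w \<in> finite_support new_\<rho>" for w
        using no that by blast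
    qed (use pos finite_finite_support M Aflow in auto)
    have cnz: "c t \<noteq> 0" "\<bar>c 0\<bar> \<le> \<bar>c t\<bar>" if "t \<in> time_interval T" for t
      using c_nonzero[OF False that] False by auto
    \<comment> \<open>The distance between the driving point and the image of infinity is
      \<open>1 / \<bar>c * j\<bar>\<close>, so separation from that point is exactly an upper bound
      on the product.\<close>
    have cj: "\<bar>c t * j t\<bar> \<le> 1 / \<epsilon>" if t: "t \<in> time_interval T" for t
    proof -
      have "\<epsilon> \<le> cmod (complex_of_real (new_Y (\<sigma> t)) - of_real (A (\<sigma> t)))"
        by (rule \<epsilon>(2)[OF \<sigma>S[OF t]])
      also have "complex_of_real (new_Y (\<sigma> t)) - of_real (A (\<sigma> t)) = of_real (- (1 / (c t * j t)))"
        using t by (simp add: A_def)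
      also have "cmod \<dots> = 1 / \<bar>c t * j t\<bar>"
        by (simp only: norm_of_real abs_minus_cancel abs_divide abs_one)
      finally show ?thesis
        using \<epsilon>(1) cnz(1)[OF t] j_nz[OF t] by (simp add: field_simps)
    qed
    \<comment> \<open>In the new time \<open>c\<close> grows at relative rate
      \<open>(c * j)\<^sup>2\<close>, which is at most \<open>1 / \<epsilon>\<^sup>2\<close>;
      Gronwall over time at most \<open>S'\<close> gives this bound.\<close>
    define c1 where "c1 = \<bar>c 0\<bar> * exp (1 / \<epsilon>\<^sup>2 * S')"
    have c1: "0 < c1"
      using False by (simp add: c1_def)
    have c_le: "\<bar>c t\<bar> \<le> c1" if t: "t \<in> time_interval T" for t
    proof -
      have "norm ((\<lambda>s. c (\<tau> s)) (\<sigma> t)) \<le> norm ((\<lambda>s. c (\<tau> s)) 0) * exp (1 / \<epsilon>\<^sup>2 * \<sigma> t)"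
      proof (rule gronwall)
        fix s assume s: "s \<in> {0..\<sigma> t}"
        have r: "\<tau> s \<in> time_interval T"
          using \<tau>_image[OF t] s time_interval_mono[OF t] by blast
        show "((\<lambda>s. c (\<tau> s)) has_vector_derivative j (\<tau> s) ^ 4 *\<^sub>R (c (\<tau> s) ^ 3 / j (\<tau> s) ^ 2)) (at s within {0..\<sigma> t})"
          by (rule new_time_deriv[OF t s subset_deriv[OF c[OF r]]])
        have "j (\<tau> s) ^ 4 *\<^sub>R (c (\<tau> s) ^ 3 / j (\<tau> s) ^ 2) = (c (\<tau> s) * j (\<tau> s))\<^sup>2 * c (\<tau> s)"
          using j_nz[OF r] by (simp add: field_simps eval_nat_numeral)
        then have "norm (j (\<tau> s) ^ 4 *\<^sub>R (c (\<tau> s) ^ 3 / j (\<tau> s) ^ 2)) = \<bar>c (\<tau> s) * j (\<tau> s)\<bar>\<^sup>2 * norm (c (\<tau> s))"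
          by (simp only: real_norm_def abs_mult[of "(c (\<tau> s) * j (\<tau> s))\<^sup>2"] power2_abs abs_power2)
        also have "\<dots> \<le> (1 / \<epsilon>)\<^sup>2 * norm (c (\<tau> s))"
          by (intro mult_right_mono power_mono cj r) auto
        finally show "norm (j (\<tau> s) ^ 4 *\<^sub>R (c (\<tau> s) ^ 3 / j (\<tau> s) ^ 2)) \<le> 1 / \<epsilon>\<^sup>2 * norm (c (\<tau> s))"
          by (simp add: power_one_over)
      qed (use \<sigma>S[OF t] in auto)
      also have "\<dots> \<le> c1"
        unfolding c1_def using \<sigma>S[OF t] by (auto intro!: mult_left_mono divide_right_mono)
      finally show ?thesis
        using t by simp
    qed
    define J where "J = 1 / (\<epsilon> * \<bar>c 0\<bar>)"
    have j_le: "\<bar>j t\<bar> \<le> J" if t: "t \<in> time_interval T" for t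
    proof -
      have "\<bar>c 0\<bar> * \<bar>j t\<bar> \<le> \<bar>c t\<bar> * \<bar>j t\<bar>"
        by (intro mult_right_mono cnz(2) t) auto
      also have "\<dots> \<le> 1 / \<epsilon>"
        using cj[OF t] by (simp add: abs_mult)
      finally show ?thesis
        using False \<epsilon>(1) by (simp add: J_def field_simps)
    qed
    \<comment> \<open>Old time runs at rate \<open>j ^ 4\<close> in new time, hence at most at rate
      \<open>J ^ 4\<close> over a duration \<open>S'\<close>.\<close>
    have "t \<le> J ^ 4 * S'" if t: "t \<in> time_interval T" for t
    proof -
      have "norm (\<tau> (\<sigma> t) - \<tau> 0) \<le> J ^ 4 * \<bar>\<sigma> t - 0\<bar>"
      proof (rule vector_lipschitz[where I = "{0..\<sigma> t}"])
        fix s assume s: "s \<in> {0..\<sigma> t}"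
        show "(\<tau> has_vector_derivative j (\<tau> s) ^ 4) (at s within {0..\<sigma> t})"
          by (rule \<tau>_deriv_within[OF t s])
        have "\<tau> s \<in> time_interval T"
          using \<tau>_image[OF t] s time_interval_mono[OF t] by blast
        then show "norm (j (\<tau> s) ^ 4) \<le> J ^ 4"
          using j_le power_mono[of "\<bar>j (\<tau> s)\<bar>" J 4] by simp
      qed (use \<sigma>S[OF t] in auto)
      also have "\<dots> \<le> J ^ 4 * S'"
        using \<sigma>S[OF t] by (intro mult_left_mono) auto
      finally show ?thesis
        using t by simp
    qed
    then obtain T' where T': "T = ereal T'"
      using finite_T by blast
    then have T'0: "0 < T'"
      using T by simp
    \<comment> \<open>Upper bound for the distance from the driving point to the image of infinity:
      the latter starts at \<open>a\<close> and moves with speed at most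
      \<open>2 / \<epsilon>\<close>, the former is bounded by \<open>M\<close>. Its reciprocal
      bounds \<open>\<bar>c * j\<bar>\<close> from below.\<close>
    define K where "K = \<bar>a\<bar> + 2 / \<epsilon> * S' + M"
    have K: "1 / K \<le> \<bar>c t * j t\<bar> \<and> 0 < K" if t: "t \<in> time_interval T" for t
    proof -
      have st: "0 \<le> \<sigma> t" "\<sigma> t < S'"
        using \<sigma>S[OF t] by auto
      note D = loewner_solutionD[OF Aflow[OF st]]
      have "norm (complex_of_real (A (\<sigma> t)) - of_real (A 0)) \<le> 2 / \<epsilon> * \<bar>\<sigma> t - 0\<bar>"
      proof (rule vector_lipschitz[where I = "{0..\<sigma> t}"])
        fix s assume s: "s \<in> {0..\<sigma> t}"
        show "((\<lambda>s. complex_of_real (A s)) has_vector_derivative 2 / (of_real (A s) - of_real (new_Y s)))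
          (at s within {0..\<sigma> t})"
          by (rule D(3)[OF s])
        have "\<epsilon> \<le> cmod (complex_of_real (A s) - of_real (new_Y s))"
          using \<epsilon>(2)[of s] s st by (simp add: norm_minus_commute)
        then show "cmod (2 / (complex_of_real (A s) - of_real (new_Y s))) \<le> 2 / \<epsilon>"
          unfolding norm_divide using \<epsilon>(1) by (intro frac_le) auto
      qed (use st in auto)
      also have "\<dots> \<le> 2 / \<epsilon> * S'"
        using st \<epsilon>(1) by (intro mult_left_mono) auto
      finally have "norm (A (\<sigma> t) - a) \<le> 2 / \<epsilon> * S'"
        using D(1) by (simp flip: of_real_diff)
      then have "\<bar>A (\<sigma> t) - new_Y (\<sigma> t)\<bar> \<le> K"
        using M[OF \<sigma>S[OF t]] by (simp add: K_def)
      then have le: "1 / \<bar>c t * j t\<bar> \<le> K"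
        using t by (simp add: A_def abs_mult)
      have p: "0 < \<bar>c t * j t\<bar>"
        using cnz(1)[OF t] j_nz[OF t] by simp
      then have "0 < 1 / \<bar>c t * j t\<bar>"
        by (rule divide_pos_pos[OF zero_less_one])
      then have "0 < K"
        using le by linarith
      then show ?thesis
        using le p by (simp add: field_simps)
    qed
    have K0: "0 < K"
      using K[OF zero_mem] by simp
    have j_ge: "1 / (K * c1) \<le> \<bar>j t\<bar>" if t: "t \<in> time_interval T" for t
    proof -
      have "1 / K \<le> \<bar>c t\<bar> * \<bar>j t\<bar>"
        using K[OF t] by (simp add: abs_mult)
      also have "\<dots> \<le> c1 * \<bar>j t\<bar>"
        by (intro mult_right_mono c_le t) auto
      finally show ?thesis
        using K0 c1 by (simp add: field_simps)
    qed
    \<comment> \<open>The first entry is for a charge sent to infinity, whose old distance is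
      \<open>\<bar>j / c\<bar>\<close>. The second is for any other charge: separation in the new
      chart and \<open>\<epsilon> * \<bar>c * j\<bar> \<le> 1\<close> give
      \<open>\<epsilon> * j\<^sup>2 \<le> 2 * cmod e\<close> for its old distance
      \<open>cmod e\<close>.\<close>
    define m where "m = min (1 / (K * c1) / c1) (\<epsilon> * (1 / (K * c1))\<^sup>2 / 2)"
    have m: "0 < m"
      using K0 c1 \<epsilon>(1) by (simp add: m_def)
    obtain w where w: "w \<in> finite_support \<rho>" "((\<lambda>t. of_real (X t) - g t w) \<longlongrightarrow> 0) (at_left T')"
      using hit[OF T'] by blast
    have far: "m \<le> cmod (of_real (X t) - g t w)" if t: "t \<in> time_interval T" for t
    proof (cases "\<phi> (Some w)")
      case None
      then have "den w = 0"
        unfolding \<phi>_Some by (simp split: if_splits)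
      then have "w = of_real (X 0 - j 0 / c 0)"
        using False by (simp add: field_simps eq_neg_iff_add_eq_0)
      then have "of_real (X t) - g t w = of_real (j t / c t)"
        using c_nonzero[OF False t] by simp
      then have "cmod (of_real (X t) - g t w) = \<bar>j t\<bar> / \<bar>c t\<bar>"
        by (simp only: norm_of_real abs_divide)
      also have "1 / (K * c1) / c1 \<le> \<dots>"
        using j_ge[OF t] c_le[OF t] cnz(1)[OF t] by (intro frac_le) auto
      finally show ?thesis
        by (simp add: m_def)
    next
      case (Some z)
      then have z: "\<psi> (Some z) = Some w"
        using \<psi>_\<phi>[of "Some w"] by simp
      then have zS: "z \<in> finite_support new_\<rho>"
        using w(1) by (simp add: new_support) (simp add: finite_support_def)
      have mem: "t \<in> {0..t}"
        using t by (simp add: time_interval_def)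
      define e \<kappa> where "e = g t w - of_real (X t)" and "\<kappa> = of_real (c t) * e + complex_of_real (j t)"
      have \<kappa>0: "\<kappa> \<noteq> 0"
        unfolding \<kappa>_def e_def
        by (rule denominator_nonzero[OF t charge_flow[OF t w(1)] \<psi>_SomeD(1)[OF z] mem])
      have "\<epsilon> \<le> cmod (of_real (new_Y (\<sigma> t)) - new_g (\<sigma> t) z)"
        by (rule \<epsilon>(3)[OF \<sigma>S[OF t] zS])
      also have "of_real (new_Y (\<sigma> t)) - new_g (\<sigma> t) z = - (e / (\<kappa> * of_real (j t)))"
        using t by (simp add: new_Y_def new_g_def z H_def chart_map_def e_def \<kappa>_def)
      also have "cmod \<dots> = cmod e / (cmod \<kappa> * \<bar>j t\<bar>)"
        by (simp add: norm_divide norm_mult)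
      finally have "\<epsilon> * (cmod \<kappa> * \<bar>j t\<bar>) \<le> cmod e"
        using \<kappa>0 j_nz[OF t] by (simp add: pos_le_divide_eq)
      moreover have "\<bar>j t\<bar> - \<bar>c t\<bar> * cmod e \<le> cmod \<kappa>"
        using norm_triangle_ineq2[of "complex_of_real (j t)" "- (of_real (c t) * e)"]
        by (simp add: \<kappa>_def norm_mult add.commute)
      then have "\<epsilon> * ((\<bar>j t\<bar> - \<bar>c t\<bar> * cmod e) * \<bar>j t\<bar>) \<le> \<epsilon> * (cmod \<kappa> * \<bar>j t\<bar>)"
        using \<epsilon>(1) by (intro mult_left_mono mult_right_mono) auto
      moreover have "\<epsilon> * ((\<bar>j t\<bar> - \<bar>c t\<bar> * cmod e) * \<bar>j t\<bar>) = \<epsilon> * \<bar>j t\<bar>\<^sup>2 - \<epsilon> * \<bar>c t * j t\<bar> * cmod e"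
        by (simp only: abs_mult) (simp add: algebra_simps power2_eq_square)
      moreover have "\<epsilon> * \<bar>c t * j t\<bar> * cmod e \<le> 1 * cmod e"
        using cj[OF t] \<epsilon>(1) by (intro mult_right_mono) (auto simp: field_simps)
      ultimately have "\<epsilon> * \<bar>j t\<bar>\<^sup>2 \<le> 2 * cmod e"
        by linarith
      moreover have "\<epsilon> * (1 / (K * c1))\<^sup>2 \<le> \<epsilon> * \<bar>j t\<bar>\<^sup>2"
        using j_ge[OF t] \<epsilon>(1) K0 c1 by (intro mult_left_mono power_mono) auto
      ultimately have "\<epsilon> * (1 / (K * c1))\<^sup>2 / 2 \<le> cmod e"
        by simp
      then show ?thesis
        by (simp add: m_def e_def norm_minus_commute min_le_iff_disj)
    qed
    have "\<forall>\<^sub>F t in at_left T'. dist (of_real (X t) - g t w) 0 < m"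
      by (rule tendstoD[OF w(2) m])
    then obtain b where b: "b < T'" "\<And>t. \<lbrakk>b < t; t < T'\<rbrakk> \<Longrightarrow> cmod (of_real (X t) - g t w) < m"
      unfolding eventually_at_left[OF T'0] by auto
    obtain t where t: "max b 0 < t" "t < T'"
      using dense[of "max b 0" T'] b(1) T'0 by auto
    then have "t \<in> time_interval T"
      by (simp add: T' time_interval_ereal)
    from far[OF this] b(2)[of t] t show False
      by simp
  qed
qed

end

theorem corollary2p4:
  fixes n j :: nat and x :: "nat \<Rightarrow> real" and \<zeta> :: "nat \<Rightarrow> sphere"
    and R \<phi> :: "sphere \<Rightarrow> sphere" and C :: "complex set"
    and T :: ereal and \<gamma> :: "real \<Rightarrow> complex"
  assumes "inj_on x {1..2*n}"
    and "j \<in> {1..2*n}"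
    and "R \<in> CRR (n + 1) (x ` {1..2*n})"
    and "inj_on \<zeta> {1..n+1}"
    and "pole_set R = \<zeta> ` {1..n+1}"
    and "C \<in> SLE0_ensemble R"
    and "SLE0_curve (x j) (ensemble_charge n x \<zeta> j) T \<gamma>"
    and "\<gamma> ` (time_interval T - {0}) \<subseteq> C"
    and "\<phi> \<in> PSL2R"
    and "\<phi> (Some (of_real (x j))) \<noteq> None"
  shows "\<exists>y S \<sigma> \<gamma>'.
           \<phi> (Some (of_real (x j))) = Some (of_real y) \<and>
           SLE0_curve y (pushforward \<phi> (ensemble_charge n x \<zeta> j)) S \<gamma>' \<and>
           time_change T S \<sigma> \<and>
           (\<forall>t\<in>time_interval T. \<phi> (Some (\<gamma> t)) = Some (\<gamma>' (\<sigma> t)))"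
proof -
  define \<rho> where "\<rho> = ensemble_charge n x \<zeta> j"
  obtain X g where sle: "SLE0_chain (x j) \<rho> T X g"
    and \<gamma>: "continuous_on (time_interval T) \<gamma>" "\<gamma> 0 = of_real (x j)"
      "\<And>t. t \<in> time_interval T \<Longrightarrow>
        upper_half_plane - swallowed X t \<in> components (upper_half_plane - \<gamma> ` {0..t})"
      "\<And>t. t \<in> time_interval T \<Longrightarrow> \<not> bounded (upper_half_plane - swallowed X t)"
    using assms(7) unfolding SLE0_curve_def \<rho>_def by blast
  interpret loewner_charges "x j" \<rho> T X g
    using sle by (simp add: SLE0_chain_iff)
  obtain y c0 j0 where j0: "j0 \<noteq> 0" and \<phi>: "\<phi> = sphere_map (x j) y c0 j0"
    and y: "\<phi> (Some (of_real (x j))) = Some (of_real y)"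
    using PSL2R_sphere_map[OF assms(9,10)] .
  \<comment> \<open>The time-dependent chart starts at \<open>\<phi>\<close>. Its pole
    \<open>X 0 - j0 / c0\<close> differs from the starting point because
    \<open>j0 \<noteq> 0\<close>, so its flow line survives.\<close>
  obtain c jj Y where cc: "chart_change T X speed c jj Y" "c 0 = c0" "jj 0 = j0" "Y 0 = y"
    "\<And>t. c0 = 0 \<Longrightarrow> c t = 0 \<and> jj t = j0"
    "\<And>t. \<lbrakk>c0 \<noteq> 0; t \<in> time_interval T\<rbrakk> \<Longrightarrow> \<bar>c0\<bar> \<le> \<bar>c t\<bar> \<and>
      g t (of_real (X 0 - j0 / c0)) = of_real (X t - jj t / c t)"
  proof (rule chart_change_exists[OF T_pos X_deriv speed_continuous j0, where ?c0.0 = c0 and y = y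
        and u = "\<lambda>t. g t (of_real (X 0 - j0 / c0))"])
    show "loewner_solution X t (of_real (X 0 - j0 / c0)) (\<lambda>t. g t (of_real (X 0 - j0 / c0)))"
      if "c0 \<noteq> 0" "t \<in> time_interval T" for t
      by (rule real_alive[OF that(2)]) (use j0 that(1) in \<open>simp add: X_0\<close>)
  qed auto
  interpret ch: charged_chart "x j" \<rho> T X g speed c jj Y
  proof (rule charged_chart.intro[OF loewner_charges_axioms cc(1)], unfold_locales)
    show "(\<Sum>v\<in>Poly_Mapping.keys \<rho>. Poly_Mapping.lookup \<rho> v) = - 6"
      unfolding \<rho>_def by (rule total_ensemble_charge[OF assms(2)])
  qed (use cc in simp_all)
  have \<phi>_eq: "ch.\<phi> = \<phi>"
    by (simp add: ch.\<phi>_def \<phi> cc X_0)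
  have upper: "0 < Im (\<gamma> t)" and locus: "Some (\<gamma> t) \<in> real_locus R" if "t \<in> time_interval T - {0}" for t
  proof -
    have "C \<subseteq> {z \<in> upper_half_plane. Some z \<in> real_locus R}"
      using assms(6) unfolding SLE0_ensemble_def by (rule in_components_subset)
    then show "0 < Im (\<gamma> t)" "Some (\<gamma> t) \<in> real_locus R"
      using assms(8) that by (auto simp: upper_half_plane_def)
  qed
  \<comment> \<open>At time 0 the curve is on the real axis, where the denominator is
    \<open>j0\<close>; at later times it is in the open half-plane, where a real denominator cannot
    vanish.\<close>
  have den\<gamma>: "of_real (c 0) * (\<gamma> t - of_real (X 0)) + complex_of_real (jj 0) \<noteq> 0" if "t \<in> time_interval T" for t
    using upper[of t] that ch.den_upper[of "\<gamma> t"] \<gamma>(2) cc(3) j0 X_0 by (cases "t = 0") auto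
  \<comment> \<open>The curve is moved by the fixed map \<open>H 0\<close>, which is
    \<open>\<phi>\<close> off its pole, and only its clock changes; the maps \<open>H t\<close> for
    later times act on the uniformised picture.\<close>
  define \<gamma>' where "\<gamma>' s = ch.H 0 (\<gamma> (ch.\<tau> s))" for s
  have \<gamma>'_img: "\<gamma>' ` {0..ch.\<sigma> t} = ch.H 0 ` \<gamma> ` {0..t}" if "t \<in> time_interval T" for t
    unfolding \<gamma>'_def ch.\<tau>_image[OF that, symmetric] image_image ..
  have tangent: "\<exists>\<epsilon>>0. \<forall>t\<in>time_interval T - {0}. cmod (\<gamma> t - of_real p) < \<epsilon> \<longrightarrow>
      K * (cmod (\<gamma> t - of_real p))\<^sup>2 \<le> Im (\<gamma> t)" if K: "0 < K" for K p
  proof -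
    have card: "card (x ` {1..2*n}) = 2 * n"
      using card_image[OF assms(1)] by simp
    obtain \<epsilon> where "\<epsilon> > 0" "\<And>z. \<lbrakk>0 < Im z; cmod (z - of_real p) < \<epsilon>; Some z \<in> real_locus R\<rbrakk>
        \<Longrightarrow> K * (cmod (z - of_real p))\<^sup>2 \<le> Im z"
      using CRR_not_tangential[OF assms(3) finite_imageI[OF finite_atLeastAtMost] card K, of p] by blast
    then show ?thesis
      using upper locus by blast
  qed
  have chain': "SLE0_chain y ch.new_\<rho> ch.S ch.new_Y ch.new_g"
    unfolding SLE0_chain_iff
  proof (intro conjI allI impI)
    show "conj_symmetric ch.new_\<rho>"
      using ch.new_conj_symmetric sle by (simp add: SLE0_chain_iff)
    show "loewner_charges y ch.new_\<rho> ch.S ch.new_Y ch.new_g"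
      using ch.new_charges by (simp add: cc)
    fix S' assume S': "ch.S = ereal S'"
    show "\<exists>z\<in>finite_support ch.new_\<rho>. ((\<lambda>s. of_real (ch.new_Y s) - ch.new_g s z) \<longlongrightarrow> 0) (at_left S')"
    proof (rule ch.new_lifetime[OF _ S'])
      show "\<exists>w\<in>finite_support \<rho>. ((\<lambda>t. of_real (X t) - g t w) \<longlongrightarrow> 0) (at_left T')" if "T = ereal T'" for T'
        using sle that by (simp add: SLE0_chain_iff)
      show "\<exists>k::int. Poly_Mapping.lookup \<rho> (Some w) = 4 * of_int k" if "Im w \<noteq> 0" for w
        unfolding \<rho>_def by (rule nonreal_ensemble_charge[OF that])
      show "\<exists>M. \<forall>s\<in>{0..<S'}. \<bar>ch.new_Y s\<bar> \<le> M" if c_nz: "c 0 \<noteq> 0"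
      proof -
        obtain M where "\<And>s. s \<in> {0..<S'} \<Longrightarrow> \<bar>ch.new_Y s\<bar> \<le> M"
          using ch.new_Y_bounded[OF _ S' c_nz \<gamma>(3) \<gamma>(2) upper tangent] by blast
        then show ?thesis
          by blast
      qed
    qed simp
  qed
  have curve': "SLE0_curve y ch.new_\<rho> ch.S \<gamma>'"
    unfolding SLE0_curve_def
  proof (intro exI conjI ballI)
    show "SLE0_chain y ch.new_\<rho> ch.S ch.new_Y ch.new_g"
      by (rule chain')
    show "\<gamma>' 0 = of_real y"
      using \<gamma>(2) X_0 by (simp add: \<gamma>'_def ch.H_def chart_map_def cc)
    have "continuous_on (time_interval ch.S) ch.\<tau>"
      unfolding continuous_on_eq_continuous_within
    proof
      fix s assume s: "s \<in> time_interval ch.S"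
      obtain t' where t': "ch.\<tau> s < t'" "t' \<in> time_interval T"
        using time_interval_dense[OF ch.\<tau>_mem[OF s]] by blast
      have ss: "s < ch.\<sigma> t'" "s \<in> {0..ch.\<sigma> t'}"
        using ch.\<sigma>_less[OF ch.\<tau>_mem[OF s] t'(2,1)] s by (auto simp: time_interval_def)
      have "continuous (at s within {0..ch.\<sigma> t'}) ch.\<tau>"
        using ch.\<tau>_deriv_within[OF t'(2) ss(2)] by (rule has_vector_derivative_continuous)
      moreover have "at s within {0..ch.\<sigma> t'} = at s within time_interval ch.S"
        by (rule at_within_nhd[of s "{..<ch.\<sigma> t'}"])
          (use ss time_interval_mono[OF ch.\<sigma>_mem[OF t'(2)]] in \<open>auto simp: time_interval_def\<close>)
      ultimately show "continuous (at s within time_interval ch.S) ch.\<tau>"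
        by simp
    qed
    then have "continuous_on (time_interval ch.S) (\<lambda>s. \<gamma> (ch.\<tau> s))"
      by (rule continuous_on_compose2[OF \<gamma>(1)]) (use ch.\<tau>_mem in blast)
    then show "continuous_on (time_interval ch.S) \<gamma>'"
      unfolding \<gamma>'_def [abs_def]
      by (rule continuous_on_compose2[OF ch.H_continuous]) (use den\<gamma> ch.\<tau>_mem in auto)
    fix s assume s: "s \<in> time_interval ch.S"
    define t where "t = ch.\<tau> s"
    have t: "t \<in> time_interval T" "ch.\<sigma> t = s"
      using s by (auto simp: t_def ch.\<tau>_mem)
    have "0 \<le> Im (\<gamma> t)"
      using upper[of t] t(1) \<gamma>(2) by (cases "t = 0") auto
    then have "0 \<le> Im (\<gamma>' s)"
      by (simp add: \<gamma>'_def t_def ch.Im_H)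
    then show "\<gamma>' s \<in> closure upper_half_plane"
      using closure_halfspace_gt[of \<i> 0] by (simp add: upper_half_plane_def inner_complex_def)
    show "upper_half_plane - swallowed ch.new_Y s \<in> components (upper_half_plane - \<gamma>' ` {0..s})"
      unfolding t(2)[symmetric] \<gamma>'_img[OF t(1)]
      by (rule ch.new_component[OF t(1) \<gamma>(3)[OF t(1)]]) (use den\<gamma> time_interval_mono[OF t(1)] in blast)
    show "\<not> bounded (upper_half_plane - swallowed ch.new_Y s)"
      using ch.new_unbounded[OF t(1) \<gamma>(4)[OF t(1)]] t(2) by simp
  qed
  show ?thesis
  proof (intro exI conjI ballI)
    show "\<phi> (Some (of_real (x j))) = Some (of_real y)"
      by (rule y)
    show "SLE0_curve y (pushforward \<phi> (ensemble_charge n x \<zeta> j)) ch.S \<gamma>'"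
      using curve' unfolding ch.new_\<rho>_def \<phi>_eq unfolding \<rho>_def .
    show "time_change T ch.S ch.\<sigma>"
      by (rule ch.time_change_\<sigma>)
    fix t assume t: "t \<in> time_interval T"
    show "\<phi> (Some (\<gamma> t)) = Some (\<gamma>' (ch.\<sigma> t))"
      using den\<gamma>[OF t] ch.\<phi>_Some[of "\<gamma> t"] t by (simp add: \<phi>_eq \<gamma>'_def)
  qed
qed

end
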